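(* Let $p,q,r$ be primes with $q\mid p-1$ and $q\mid r-1$, $G=G_1\times G_2$, $H\subseteq G$ a subgroup with $H\cong\mathbb Z_q\times\mathbb Z_q$, $\omega$ a 2-cocycle on $\widehat H$ with nontrivial cohomology class, and $A=(kG)^J$ with $J=\sum_{\alpha,\beta\in\widehat H}\omega(\alpha,\beta)e_\alpha\otimes e_\beta$. Then $A$ (a semisimple Hopf algebra of dimension $prq^2$) is simple as a Hopf algebra.
   Context: $k$ is an algebraically closed field of characteristic zero. $G_1=\mathbb Z_p\rtimes\mathbb Z_q$ and $G_2=\mathbb Z_r\rtimes\mathbb Z_q$ denote the unique nonabelian groups of orders $pq$ and $rq$ ($p=r$ allowed). For a twist $J$ in a Hopf algebra $A$, $A^J$ is the Hopf algebra with the same algebra and counit, comultiplication $\Delta^J(h)=J^{-1}\Delta(h)J$ and twisted antipode. For an abelian subgroup $H$ of a finite group $G$, $\widehat H$ is its character group and $e_\chi=\frac{1}{|H|}\sum_{h\in H}\chi(h^{-1})h$; for a 2-cocycle $\omega$ on $\widehat H$, $J=\sum\omega(\alpha,\beta)e_\alpha\otimes e_\beta$ is a twist in $kG$. A Hopf algebra is simple if it has no normal Hopf subalgebras (stable under ${}^hx=\sum h_1xS(h_2)$) other than $k$ and itself. *)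

theory Defs
  imports "HOL-Algebra.Elementary_Groups" "HOL-Computational_Algebra.Polynomial"
begin

definition alg_closed :: "'k::field itself \<Rightarrow> bool" where
  "alg_closed _ \<longleftrightarrow> (\<forall>p::'k poly. degree p > 0 \<longrightarrow> (\<exists>x. poly p x = 0))"

text \<open>An element of kG is a function from the carrier of G to k, i.e. the coefficient
  vector with respect to the basis G; outside the carrier it is 0.\<close>

definition galg :: "('g, 'm) monoid_scheme \<Rightarrow> ('g \<Rightarrow> 'k::field) set" where
  "galg G = {f. \<forall>x. x \<notin> carrier G \<longrightarrow> f x = 0}"

definition gdelta :: "'g \<Rightarrow> 'g \<Rightarrow> 'k::field" where
  "gdelta g = (\<lambda>x. if x = g then 1 else 0)"

definition gunit :: "('g, 'm) monoid_scheme \<Rightarrow> 'g \<Rightarrow> 'k::field" where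
  "gunit G = gdelta \<one>\<^bsub>G\<^esub>"

definition gmult :: "('g, 'm) monoid_scheme \<Rightarrow> ('g \<Rightarrow> 'k::field) \<Rightarrow> ('g \<Rightarrow> 'k) \<Rightarrow> 'g \<Rightarrow> 'k" where
  "gmult G f f' = (\<lambda>x. if x \<in> carrier G
      then (\<Sum>y\<in>carrier G. f y * f' (inv\<^bsub>G\<^esub> y \<otimes>\<^bsub>G\<^esub> x)) else 0)"

definition gcounit :: "('g, 'm) monoid_scheme \<Rightarrow> ('g \<Rightarrow> 'k::field) \<Rightarrow> 'k" where
  "gcounit G f = (\<Sum>x\<in>carrier G. f x)"

text \<open>kG \<otimes> kG = k[G \<times> G]\<close>

definition tunit :: "('g, 'm) monoid_scheme \<Rightarrow> 'g \<times> 'g \<Rightarrow> 'k::field" where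
  "tunit G = (\<lambda>(x, y). if x = \<one>\<^bsub>G\<^esub> \<and> y = \<one>\<^bsub>G\<^esub> then 1 else 0)"

definition tmult :: "('g, 'm) monoid_scheme \<Rightarrow> ('g \<times> 'g \<Rightarrow> 'k::field) \<Rightarrow> ('g \<times> 'g \<Rightarrow> 'k)
    \<Rightarrow> 'g \<times> 'g \<Rightarrow> 'k" where
  "tmult G T T' = (\<lambda>(x, y). if x \<in> carrier G \<and> y \<in> carrier G
      then (\<Sum>y1\<in>carrier G. \<Sum>y2\<in>carrier G.
              T (y1, y2) * T' (inv\<^bsub>G\<^esub> y1 \<otimes>\<^bsub>G\<^esub> x, inv\<^bsub>G\<^esub> y2 \<otimes>\<^bsub>G\<^esub> y))
      else 0)"

definition tens :: "('g \<Rightarrow> 'k::field) \<Rightarrow> ('g \<Rightarrow> 'k) \<Rightarrow> 'g \<times> 'g \<Rightarrow> 'k" where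
  "tens f f' = (\<lambda>(x, y). f x * f' y)"

definition tinv :: "('g, 'm) monoid_scheme \<Rightarrow> ('g \<times> 'g \<Rightarrow> 'k::field) \<Rightarrow> 'g \<times> 'g \<Rightarrow> 'k" where
  "tinv G T = (THE T'. (\<forall>x y. (x \<notin> carrier G \<or> y \<notin> carrier G) \<longrightarrow> T' (x, y) = 0)
                 \<and> tmult G T' T = tunit G \<and> tmult G T T' = tunit G)"

definition gcomult :: "('g \<Rightarrow> 'k::field) \<Rightarrow> 'g \<times> 'g \<Rightarrow> 'k" where
  "gcomult f = (\<lambda>(x, y). if x = y then f x else 0)"

definition tensor_span :: "('g \<Rightarrow> 'k::field) set \<Rightarrow> ('g \<times> 'g \<Rightarrow> 'k) set" where
  "tensor_span B = {T. \<exists>(n::nat) bs cs. (\<forall>i<n. bs i \<in> B \<and> cs i \<in> B)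
                        \<and> T = (\<lambda>(x, y). \<Sum>i<n. bs i x * cs i y)}"

text \<open>The character group of the (abelian) subgroup H: homomorphisms H \<rightarrow> k^*,
  extended by 0 outside H. Product of characters is pointwise product.\<close>

definition characters :: "('g, 'm) monoid_scheme \<Rightarrow> 'g set \<Rightarrow> ('g \<Rightarrow> 'k::field) set" where
  "characters G H = {\<chi>. (\<forall>x\<in>H. \<forall>y\<in>H. \<chi> (x \<otimes>\<^bsub>G\<^esub> y) = \<chi> x * \<chi> y)
                         \<and> \<chi> \<one>\<^bsub>G\<^esub> = 1 \<and> (\<forall>x. x \<notin> H \<longrightarrow> \<chi> x = 0)}"

definition char_mult :: "('g \<Rightarrow> 'k::field) \<Rightarrow> ('g \<Rightarrow> 'k) \<Rightarrow> 'g \<Rightarrow> 'k" where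
  "char_mult \<alpha> \<beta> = (\<lambda>x. \<alpha> x * \<beta> x)"

definition char_idem :: "('g, 'm) monoid_scheme \<Rightarrow> 'g set \<Rightarrow> ('g \<Rightarrow> 'k::field) \<Rightarrow> 'g \<Rightarrow> 'k" where
  "char_idem G H \<chi> = (\<lambda>x. if x \<in> H then \<chi> (inv\<^bsub>G\<^esub> x) / of_nat (card H) else 0)"

definition two_cocycle :: "('g, 'm) monoid_scheme \<Rightarrow> 'g set
    \<Rightarrow> (('g \<Rightarrow> 'k::field) \<Rightarrow> ('g \<Rightarrow> 'k) \<Rightarrow> 'k) \<Rightarrow> bool" where
  "two_cocycle G H \<omega> \<longleftrightarrow>
     (\<forall>\<alpha>\<in>characters G H. \<forall>\<beta>\<in>characters G H. \<omega> \<alpha> \<beta> \<noteq> 0) \<and>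
     (\<forall>\<alpha>\<in>characters G H. \<forall>\<beta>\<in>characters G H. \<forall>\<gamma>\<in>characters G H.
        \<omega> \<alpha> \<beta> * \<omega> (char_mult \<alpha> \<beta>) \<gamma> = \<omega> \<beta> \<gamma> * \<omega> \<alpha> (char_mult \<beta> \<gamma>))"

definition coboundary :: "('g, 'm) monoid_scheme \<Rightarrow> 'g set
    \<Rightarrow> (('g \<Rightarrow> 'k::field) \<Rightarrow> ('g \<Rightarrow> 'k) \<Rightarrow> 'k) \<Rightarrow> bool" where
  "coboundary G H \<omega> \<longleftrightarrow> (\<exists>f. (\<forall>\<alpha>\<in>characters G H. f \<alpha> \<noteq> 0) \<and>
     (\<forall>\<alpha>\<in>characters G H. \<forall>\<beta>\<in>characters G H.
        \<omega> \<alpha> \<beta> = f \<alpha> * f \<beta> / f (char_mult \<alpha> \<beta>)))"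

definition twist_of :: "('g, 'm) monoid_scheme \<Rightarrow> 'g set
    \<Rightarrow> (('g \<Rightarrow> 'k::field) \<Rightarrow> ('g \<Rightarrow> 'k) \<Rightarrow> 'k) \<Rightarrow> 'g \<times> 'g \<Rightarrow> 'k" where
  "twist_of G H \<omega> = (\<lambda>(x, y). \<Sum>\<alpha>\<in>characters G H. \<Sum>\<beta>\<in>characters G H.
       \<omega> \<alpha> \<beta> * tens (char_idem G H \<alpha>) (char_idem G H \<beta>) (x, y))"

definition tw_comult :: "('g, 'm) monoid_scheme \<Rightarrow> ('g \<times> 'g \<Rightarrow> 'k::field)
    \<Rightarrow> ('g \<Rightarrow> 'k) \<Rightarrow> 'g \<times> 'g \<Rightarrow> 'k" where
  "tw_comult G J f = tmult G (tmult G (tinv G J) (gcomult f)) J"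

text \<open>The antipode of (kG)^J, i.e. the convolution inverse of the identity with respect
  to Delta^J (and the unchanged multiplication, unit, counit). It is given by its values
  s g on the basis elements g of G.\<close>
definition tw_antipode_basis :: "('g, 'm) monoid_scheme \<Rightarrow> ('g \<times> 'g \<Rightarrow> 'k::field)
    \<Rightarrow> 'g \<Rightarrow> 'g \<Rightarrow> 'k" where
  "tw_antipode_basis G J = (THE s.
      (\<forall>g. s g \<in> galg G) \<and> (\<forall>g. g \<notin> carrier G \<longrightarrow> s g = (\<lambda>_. 0)) \<and>
      (\<forall>g\<in>carrier G.
         (\<lambda>x. \<Sum>g1\<in>carrier G. \<Sum>g2\<in>carrier G.
                tw_comult G J (gdelta g) (g1, g2) * gmult G (s g1) (gdelta g2) x)
           = (\<lambda>x. gcounit G (gdelta g) * gunit G x)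
       \<and> (\<lambda>x. \<Sum>g1\<in>carrier G. \<Sum>g2\<in>carrier G.
                tw_comult G J (gdelta g) (g1, g2) * gmult G (gdelta g1) (s g2) x)
           = (\<lambda>x. gcounit G (gdelta g) * gunit G x)))"

definition tw_antipode :: "('g, 'm) monoid_scheme \<Rightarrow> ('g \<times> 'g \<Rightarrow> 'k::field)
    \<Rightarrow> ('g \<Rightarrow> 'k) \<Rightarrow> 'g \<Rightarrow> 'k" where
  "tw_antipode G J f = (\<lambda>x. \<Sum>g\<in>carrier G. f g * tw_antipode_basis G J g x)"

definition hopf_subalgebra :: "('g, 'm) monoid_scheme \<Rightarrow> ('g \<times> 'g \<Rightarrow> 'k::field)
    \<Rightarrow> ('g \<Rightarrow> 'k) set \<Rightarrow> bool" where
  "hopf_subalgebra G J B \<longleftrightarrow>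
     B \<subseteq> galg G \<and> (\<lambda>_. 0) \<in> B \<and>
     (\<forall>f\<in>B. \<forall>f'\<in>B. (\<lambda>x. f x + f' x) \<in> B) \<and>
     (\<forall>c. \<forall>f\<in>B. (\<lambda>x. c * f x) \<in> B) \<and>
     gunit G \<in> B \<and> (\<forall>f\<in>B. \<forall>f'\<in>B. gmult G f f' \<in> B) \<and>
     (\<forall>f\<in>B. tw_comult G J f \<in> tensor_span B) \<and>
     (\<forall>f\<in>B. tw_antipode G J f \<in> B)"

definition tw_adjoint :: "('g, 'm) monoid_scheme \<Rightarrow> ('g \<times> 'g \<Rightarrow> 'k::field)
    \<Rightarrow> ('g \<Rightarrow> 'k) \<Rightarrow> ('g \<Rightarrow> 'k) \<Rightarrow> 'g \<Rightarrow> 'k" where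
  "tw_adjoint G J h y = (\<lambda>z. \<Sum>g1\<in>carrier G. \<Sum>g2\<in>carrier G.
      tw_comult G J h (g1, g2) *
        gmult G (gmult G (gdelta g1) y) (tw_antipode G J (gdelta g2)) z)"

definition normal_hopf_subalgebra :: "('g, 'm) monoid_scheme \<Rightarrow> ('g \<times> 'g \<Rightarrow> 'k::field)
    \<Rightarrow> ('g \<Rightarrow> 'k) set \<Rightarrow> bool" where
  "normal_hopf_subalgebra G J B \<longleftrightarrow> hopf_subalgebra G J B \<and>
     (\<forall>h\<in>galg G. \<forall>y\<in>B. tw_adjoint G J h y \<in> B)"

definition simple_twisted_group_hopf :: "('g, 'm) monoid_scheme \<Rightarrow> ('g \<times> 'g \<Rightarrow> 'k::field) \<Rightarrow> bool" where
  "simple_twisted_group_hopf G J \<longleftrightarrow>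
     (\<forall>B. normal_hopf_subalgebra G J B \<longrightarrow>
        B = {(\<lambda>x. c * gunit G x) | c. True} \<or> B = galg G)"

end

theory Submission
  imports Defs "HOL-Algebra.Sylow" "HOL-Algebra.Multiplicative_Group"
begin

text \<open>
  Let \<open>B\<close> be a normal Hopf subalgebra. The trace formula gives an integral \<open>\<Lambda>\<close> of \<open>B\<close> with
  \<open>\<epsilon>(\<Lambda>) = 1\<close>; normality of \<open>B\<close> makes it central in \<open>kG\<close>. Centrality removes the twist from
  \<open>(1 \<otimes> \<Lambda>) \<Delta>\<^sup>J(\<Lambda>) = \<Lambda> \<otimes> \<Lambda>\<close>, so \<open>\<Lambda>\<close> is the averaging idempotent of a normal subgroup \<open>N\<close> of \<open>G\<close>.
  If \<open>N = 1\<close> then \<open>B = k\<close>, and if \<open>N = G\<close> then \<open>B\<close> is everything, because \<open>\<Delta>\<^sup>J(\<Lambda>)\<close> is nondegenerate.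

  A character \<open>\<beta>\<close> of \<open>G\<close> that is trivial on \<open>N\<close> agrees with \<open>\<epsilon>\<close> on \<open>B\<close>. Applying it to the two legs of
  \<open>\<Delta>\<^sup>J(b)\<close> shows that every \<open>b \<in> B\<close> commutes with the element \<open>t \<in> H\<close> determined by
  \<open>\<alpha>(t) = \<omega>(\<alpha>, \<beta>) / \<omega>(\<beta>, \<alpha>)\<close>; for the legs of \<open>\<Delta>\<^sup>J(\<Lambda>)\<close> this means that \<open>N\<close> centralizes \<open>t\<close>. Since
  \<open>H \<cong> \<int>\<^sub>q \<times> \<int>\<^sub>q\<close> and \<open>\<omega>\<close> is not a coboundary, \<open>t \<noteq> 1\<close> for \<open>\<beta> \<noteq> 1\<close>, while \<open>\<beta>(t) = 1\<close>. No proper nontrivial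
  normal subgroup of \<open>G\<^sub>1 \<times> G\<^sub>2\<close> centralizes all these \<open>t\<close>.
\<close>

text \<open>All twisted structure is computed in the bigrading of \<open>kG\<close> by left and
  right weights for \<open>H\<close>. There \<open>\<Delta>\<^sup>J\<close> differs from the
  untwisted coproduct by the scalars \<open>\<sigma>\<close>, so coassociativity and the antipode
  become identities between values of \<open>\<omega>\<close>. The antipode is given only by a
  description, so it has to be found before normality can be used.

  The element t comes from comparing legs. On \<open>B\<close>, feeding \<beta> into either leg of
  the coproduct returns b, yet the two scalars that this produces in weight (\<alpha>, \<gamma>)
  have ratio \<gamma>(t) / \<alpha>(t). A component survives only where these agree.

  At the end, \<open>H\<close> turns out to be a product \<open>Q1 \<times> Q2\<close> of
  complements, so the group retracts onto \<open>H\<close> with kernel the product of the normal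
  Sylow subgroups; this extends every character of \<open>H\<close>. An element of \<open>N\<close>
  with a nontrivial coordinate in one factor puts the Sylow subgroup of that factor into
  \<open>N\<close>. The complement acts faithfully on it, so that coordinate of t is trivial. If
  \<open>N\<close> lies in one factor, \<chi>(t) = 1 for a \<chi> that is trivial on that factor
  rules out the rest.\<close>

lemma sum_Times: "(\<Sum>p\<in>A \<times> B. f p) = (\<Sum>a\<in>A. \<Sum>b\<in>B. f (a, b))"
  by (simp add: sum.cartesian_product)

section \<open>Linear algebra in finite-dimensional spaces of functions\<close>

lemma linear_combination_closed:
  fixes B :: "('a \<Rightarrow> 'k::field) set"
  assumes "finite I" and "\<And>i. i \<in> I \<Longrightarrow> f i \<in> B" and zero: "(\<lambda>_. 0) \<in> B"
    and add: "\<And>f f'. f \<in> B \<Longrightarrow> f' \<in> B \<Longrightarrow> (\<lambda>x. f x + f' x) \<in> B"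
    and scale: "\<And>c f. f \<in> B \<Longrightarrow> (\<lambda>x. c * f x) \<in> B"
  shows "(\<lambda>x. \<Sum>i\<in>I. c i * f i x) \<in> B"
  using assms(1,2)
proof (induction I rule: finite_induct)
  case (insert i I)
  then have "(\<lambda>x. c i * f i x + (\<Sum>i\<in>I. c i * f i x)) \<in> B" by (intro add scale) auto
  then show ?case using insert by simp
qed (simp add: zero)

text \<open>A reduced echelon basis: choose a maximal set \<open>Y\<close> of points for which
  \<open>B\<close> contains functions dual to evaluation on \<open>Y\<close>. If some member of
  \<open>B\<close> were not recovered from its values on \<open>Y\<close>, the difference would
  vanish on \<open>Y\<close> and supply one more point. Coordinates are then values at points, so a
  trace over \<open>B\<close> is a sum over \<open>Y\<close>.\<close>

lemma ex_evaluation_dual_basis: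
  fixes B :: "('a \<Rightarrow> 'k::field) set"
  assumes fin: "finite C" and out: "\<And>b x. b \<in> B \<Longrightarrow> x \<notin> C \<Longrightarrow> b x = 0"
    and add: "\<And>f f'. f \<in> B \<Longrightarrow> f' \<in> B \<Longrightarrow> (\<lambda>x. f x + f' x) \<in> B"
    and scale: "\<And>c f. f \<in> B \<Longrightarrow> (\<lambda>x. c * f x) \<in> B" and zero: "(\<lambda>_. 0) \<in> B"
  shows "\<exists>Y bas. Y \<subseteq> C \<and> (\<forall>y\<in>Y. bas y \<in> B \<and> (\<forall>z\<in>Y. bas y z = (if z = y then 1 else 0))) \<and>
    (\<forall>b\<in>B. \<forall>x. b x = (\<Sum>y\<in>Y. b y * bas y x))"
proof -
  define P where "P Y bas \<longleftrightarrow> (\<forall>y\<in>Y. bas y \<in> B \<and> (\<forall>z\<in>Y. bas y z = (if z = y then 1 else 0)))"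
    for Y and bas :: "'a \<Rightarrow> 'a \<Rightarrow> 'k"
  have sum_closed: "(\<lambda>x. \<Sum>i\<in>I. c i * f i x) \<in> B" if "finite I" "\<And>i. i \<in> I \<Longrightarrow> f i \<in> B"
    for I :: "'a set" and c f
    using that zero add scale by (rule linear_combination_closed)
  have minus_closed: "(\<lambda>x. f x - f' x) \<in> B" if "f \<in> B" "f' \<in> B" for f f'
    using add[OF that(1) scale[OF that(2), of "-1"]] by simp
  define S where "S = {Y. Y \<subseteq> C \<and> (\<exists>bas. P Y bas)}"
  have "finite S" unfolding S_def by (rule finite_subset[of _ "Pow C"]) (use fin in auto)
  moreover have "S \<noteq> {}" unfolding S_def P_def by blast
  ultimately obtain Y where Y: "Y \<in> S" and max: "\<forall>Z\<in>S. Y \<le> Z \<longrightarrow> Y = Z"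
    using finite_has_maximal[of S] by metis
  obtain bas where YC: "Y \<subseteq> C" and bas: "P Y bas" using Y unfolding S_def by blast
  have finY: "finite Y" using YC fin by (rule finite_subset)
  have "b x = (\<Sum>y\<in>Y. b y * bas y x)" if b: "b \<in> B" for b x
  proof (rule ccontr)
    assume neq: "b x \<noteq> (\<Sum>y\<in>Y. b y * bas y x)"
    define b' where "b' x = b x - (\<Sum>y\<in>Y. b y * bas y x)" for x
    have b'B: "b' \<in> B" unfolding b'_def using bas b finY
      by (intro minus_closed sum_closed) (auto simp: P_def)
    have b'0: "b' z = 0" if "z \<in> Y" for z
    proof -
      have "(\<Sum>y\<in>Y. b y * bas y z) = (\<Sum>y\<in>Y. if y = z then b y else 0)"
        using bas that by (intro sum.cong refl) (auto simp: P_def)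
      then show ?thesis using that finY by (simp add: b'_def)
    qed
    have b'x: "b' x \<noteq> 0" using neq by (simp add: b'_def)
    then have xY: "x \<notin> Y" and xC: "x \<in> C" using b'0 out[OF b'B] by auto
    define c where "c z = inverse (b' x) * b' z" for z
    have cB: "c \<in> B" unfolding c_def using b'B by (rule scale)
    have cx: "c x = 1" "\<And>z. z \<in> Y \<Longrightarrow> c z = 0" using b'x b'0 by (auto simp: c_def)
    \<comment> \<open>Elimination: subtracting a multiple of the new vector clears the old basis
      vectors at the new point.\<close>
    define bas' where "bas' y = (if y = x then c else (\<lambda>z. bas y z - bas y x * c z))" for y
    have "P (insert x Y) bas'"
      unfolding P_def using bas cx cB xY
      by (auto simp: bas'_def P_def intro!: minus_closed scale)
    then have "insert x Y \<in> S" using xC YC unfolding S_def by blast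
    then show False using max xY by blast
  qed
  then show ?thesis using YC bas unfolding P_def by blast
qed

section \<open>Roots of unity\<close>

lemma alg_closed_root:
  assumes "alg_closed TYPE('k::field)" "n > 0"
  shows "\<exists>x::'k. x ^ n = c"
proof -
  let ?p = "Polynomial.monom 1 n + [:- c:] :: 'k poly"
  have deg: "degree ?p = n"
    using assms(2) by (subst degree_add_eq_left) (auto simp: Polynomial.degree_monom_eq)
  obtain x where "poly ?p x = 0" using assms deg unfolding alg_closed_def by metis
  then show ?thesis by (auto simp: Polynomial.poly_monom)
qed

lemma root_of_unity_power_eq_1_iff:
  fixes z :: "'k::field"
  assumes "z ^ q = 1" "z \<noteq> 1" "prime q"
  shows "z ^ a = 1 \<longleftrightarrow> q dvd a"
proof
  assume a: "z ^ a = 1"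
  show "q dvd a"
  proof (rule ccontr)
    assume ndvd: "\<not> q dvd a"
    then have "coprime q a" using assms(3) by (auto intro: prime_imp_coprime)
    then have "gcd a q = 1" by (metis coprime_iff_gcd_eq_1 gcd.commute)
    moreover have "a \<noteq> 0" using ndvd by (metis dvd_0_right)
    ultimately obtain x y where xy: "a * x = q * y + 1" using bezout_nat[of a q] by auto
    have "(z ^ a) ^ x = z ^ (a * x)" by (simp add: power_mult)
    also have "\<dots> = (z ^ q) ^ y * z" unfolding xy by (simp add: power_mult power_add)
    finally show False using a assms by simp
  qed
next
  assume "q dvd a"
  then show "z ^ a = 1" using assms by (auto simp: power_mult)
qed

text \<open>One nontrivial root of unity \<zeta> is enough: its powers are \<open>q\<close> distinct
  roots, which is also the degree bound, and multiplication by \<zeta> permutes \<mu>, so the sum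
  equals \<zeta>^a times itself.\<close>

lemma sum_roots_of_unity:
  fixes q :: nat
  assumes closed: "alg_closed TYPE('k::field_char_0)" and q: "prime q"
  defines "\<mu> \<equiv> {z :: 'k. z ^ q = 1}"
  shows "(\<Sum>z\<in>\<mu>. z ^ a) = (if q dvd a then of_nat q else 0)"
proof -
  have q1: "q > 1" using q by (rule prime_gt_1_nat)
  \<comment> \<open>A root of 1 + z + ... + z^(q-1) cannot be 1, where the value is
    \<open>q\<close>, nonzero in characteristic zero.\<close>
  let ?p = "\<Sum>i<q. Polynomial.monom 1 i :: 'k poly"
  have "Polynomial.coeff ?p (q - 1) = 1" using q1 by (simp add: Polynomial.coeff_sum sum.delta')
  then have "q - 1 \<le> degree ?p" by (intro le_degree) simp
  then have "degree ?p > 0" using q1 by simp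
  then obtain \<zeta> where root: "poly ?p \<zeta> = 0" using closed unfolding alg_closed_def by blast
  then have sum0: "(\<Sum>i<q. \<zeta> ^ i) = 0" by (simp add: poly_sum Polynomial.poly_monom)
  have \<zeta>1: "\<zeta> \<noteq> 1" using sum0 q1 by auto
  have \<zeta>q: "\<zeta> ^ q = 1" using power_diff_1_eq[of \<zeta> q] sum0 by simp
  note iff = root_of_unity_power_eq_1_iff[OF \<zeta>q \<zeta>1 q]
  let ?r = "Polynomial.monom 1 q + [:- 1:] :: 'k poly"
  have deg: "degree ?r = q"
    using q1 by (subst degree_add_eq_left) (auto simp: Polynomial.degree_monom_eq)
  then have r0: "?r \<noteq> 0" using q1 by auto
  have \<mu>: "\<mu> = {z. poly ?r z = 0}" by (auto simp: \<mu>_def Polynomial.poly_monom)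
  have fin: "finite \<mu>" unfolding \<mu> using r0 by (rule poly_roots_finite)
  have le: "card \<mu> \<le> q" unfolding \<mu> using card_poly_roots_bound[OF r0] deg by simp
  have "inj_on (\<lambda>i. \<zeta> ^ i) {..<q}"
  proof (rule linorder_inj_onI)
    fix i j assume ij: "i < j" "i \<in> {..<q}" "j \<in> {..<q}"
    have "\<zeta> ^ (j - i) \<noteq> 1" using iff[of "j - i"] ij by (auto dest: dvd_imp_le)
    moreover have "\<zeta> ^ j = \<zeta> ^ i * \<zeta> ^ (j - i)" using ij by (simp flip: power_add)
    moreover have "\<zeta> \<noteq> 0" using \<zeta>q q1 by (auto simp: power_0_left)
    ultimately show "\<zeta> ^ i \<noteq> \<zeta> ^ j" by simp
  qed auto
  then have "q = card ((\<lambda>i. \<zeta> ^ i) ` {..<q})" by (simp add: card_image)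
  also have "\<dots> \<le> card \<mu>"
    using fin \<zeta>q by (intro card_mono) (auto simp: \<mu>_def simp flip: power_mult, metis mult.commute power_mult power_one)
  finally have card: "card \<mu> = q" using le by simp
  show "(\<Sum>z\<in>\<mu>. z ^ a) = (if q dvd a then of_nat q else 0)"
  proof (cases "q dvd a")
    case True
    then have "(\<Sum>z\<in>\<mu>. z ^ a) = (\<Sum>z\<in>\<mu>. 1)"
      by (intro sum.cong refl) (auto simp: \<mu>_def power_mult)
    then show ?thesis using True card by simp
  next
    case False
    have nz: "\<zeta> \<noteq> 0" using \<zeta>q q1 by (auto simp: power_0_left)
    have "(\<Sum>z\<in>\<mu>. z ^ a) = (\<Sum>z\<in>\<mu>. (\<zeta> * z) ^ a)"
      by (rule sum.reindex_bij_witness[where i = "\<lambda>z. \<zeta> * z" and j = "\<lambda>z. inverse \<zeta> * z"])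
         (use \<zeta>q nz in \<open>auto simp: \<mu>_def power_mult_distrib power_inverse\<close>)
    also have "\<dots> = \<zeta> ^ a * (\<Sum>z\<in>\<mu>. z ^ a)"
      by (simp add: power_mult_distrib sum_distrib_left)
    finally show ?thesis using False iff[of a] by simp
  qed
qed

section \<open>Subgroups of prime order and groups of order pq\<close>

text \<open>In a plane over the field with \<open>q\<close> elements any nonzero vector extends to a
  basis: for \<open>y\<close> outside the powers of \<open>x\<close>, the products of powers form a
  subgroup whose order divides q^2 and exceeds \<open>q\<close>. It will be applied to the group of
  characters, with \<open>x\<close> a prescribed character.\<close>

lemma (in comm_group) elementary_abelian_generators:
  assumes q: "prime q" and order: "card (carrier G) = q * q"
    and exp: "\<And>x. x \<in> carrier G \<Longrightarrow> x [^] q = \<one>"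
    and x: "x \<in> carrier G" "x \<noteq> \<one>"
  shows "\<exists>y\<in>carrier G. carrier G = (\<lambda>(i, j). x [^] i \<otimes> y [^] j) ` ({..<q} \<times> {..<q})"
proof -
  have q1: "q > 1" using q by (rule prime_gt_1_nat)
  have fin: "finite (carrier G)" using order q1 by (metis card.infinite mult_is_0 not_one_less_zero)
  have ordx: "ord x = q"
    using exp[OF x(1)] x q ord_eq_1[OF x(1)] by (metis pow_eq_id prime_nat_iff)
  have red: "z [^] (n::nat) = z [^] (n mod q)" if "z \<in> carrier G" for z n
  proof -
    have "z [^] n = z [^] (q * (n div q)) \<otimes> z [^] (n mod q)" using that by (simp add: nat_pow_mult)
    also have "z [^] (q * (n div q)) = \<one>" using that exp[OF that] by (simp flip: nat_pow_pow)
    finally show ?thesis using that by simp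
  qed
  let ?P = "(\<lambda>i. x [^] i) ` {..<q}"
  have Pq: "card ?P = q"
  proof -
    have "{..<q} = {0..ord x - 1}" using ordx q1 by auto
    then have "inj_on (\<lambda>i. x [^] i) {..<q}" using ord_inj[OF x(1)] by simp
    then show ?thesis by (simp add: card_image)
  qed
  have "\<not> carrier G \<subseteq> ?P"
  proof
    assume "carrier G \<subseteq> ?P"
    then have "card (carrier G) \<le> q" using card_mono[of ?P "carrier G"] Pq by simp
    then show False using order q1 by simp
  qed
  then obtain y where y: "y \<in> carrier G" "y \<notin> ?P" by blast
  define Z where "Z = (\<lambda>(i, j). x [^] i \<otimes> y [^] j) ` ({..<q} \<times> {..<q})"
  have inZ: "x [^] (i::nat) \<otimes> y [^] (j::nat) \<in> Z" for i j
  proof -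
    have "x [^] i \<otimes> y [^] j = x [^] (i mod q) \<otimes> y [^] (j mod q)"
      using red[OF x(1), of i] red[OF y(1), of j] by simp
    then show ?thesis using q1 unfolding Z_def by force
  qed
  have Zc: "Z \<subseteq> carrier G" using x y by (auto simp: Z_def)
  have mult: "a \<otimes> b \<in> Z" if ab: "a \<in> Z" "b \<in> Z" for a b
  proof -
    obtain i j :: nat where a: "a = x [^] i \<otimes> y [^] j" using ab(1) unfolding Z_def by auto
    obtain k l :: nat where b: "b = x [^] k \<otimes> y [^] l" using ab(2) unfolding Z_def by auto
    have "a \<otimes> b = x [^] (i + k) \<otimes> y [^] (j + l)"
      using x y by (simp add: a b nat_pow_mult[symmetric] m_ac)
    then show ?thesis using inZ by simp
  qed
  have pow: "a [^] (n::nat) \<in> Z" if "a \<in> Z" for a n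
    using that inZ[of 0 0] by (induction n) (auto intro: mult)
  have sub: "subgroup Z G"
  proof (rule subgroupI)
    show "Z \<noteq> {}" using inZ by blast
    fix a assume a: "a \<in> Z"
    then have aC: "a \<in> carrier G" using Zc by blast
    have "a [^] (q - 1) \<otimes> a = \<one>" using exp[OF aC] q1 aC by (metis Suc_diff_1 nat_pow_Suc not_one_less_zero gr0I)
    then have "inv a = a [^] (q - 1)" using aC by (metis inv_equality nat_pow_closed)
    then show "inv a \<in> Z" using pow a by simp
  qed (use Zc mult in auto)
  have "card Z dvd q ^ 2"
    using lagrange_finite[OF fin sub] order unfolding Coset.order_def by (metis dvd_triv_right power2_eq_square)
  then obtain m where m: "m \<le> 2" "card Z = q ^ m" using q by (metis divides_primepow_nat)
  have finZ: "finite Z" using Zc fin by (rule finite_subset)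
  have "insert y ?P \<subseteq> Z"
    using inZ[of 0 1] inZ[of _ 0] x y by auto
  then have "card (insert y ?P) \<le> card Z" using finZ by (intro card_mono)
  then have "q < card Z" using y Pq by simp
  then have "m = 2" using m q1 by (cases m; cases "m - 1") (auto simp: le_Suc_eq)
  then have "card Z = card (carrier G)" using m order by (simp add: power2_eq_square)
  then have "Z = carrier G" using Zc fin by (simp add: card_subset_eq)
  then show ?thesis using y unfolding Z_def by blast
qed

lemma (in group) prime_subgroup_powers:
  assumes P: "subgroup P G" "card P = p" "prime p" and c: "c \<in> P" "c \<noteq> \<one>" and x: "x \<in> P"
  shows "\<exists>i::nat. x = c [^] i"
proof -
  have cC: "c \<in> carrier G" using P(1) c(1) by (rule subgroup.mem_carrier)
  have finP: "finite P" using P(2,3) by (metis card.infinite not_prime_0)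
  have pow: "c [^] (i::nat) \<in> P" for i
    using c P(1) by (induction i) (auto simp: subgroup.one_closed subgroup.m_closed)
  interpret P: group "G\<lparr>carrier := P\<rparr>" using P(1) by (rule subgroup_imp_group)
  have "c [^]\<^bsub>G\<lparr>carrier := P\<rparr>\<^esub> p = \<one>"
    using P.pow_order_eq_1[of c] c P(2) by (simp add: Coset.order_def)
  then have "c [^] p = \<one>" by (simp add: nat_pow_consistent[symmetric])
  then have ord: "ord c = p"
    using ord_eq_1[OF cC] c(2) P(3) cC by (metis pow_eq_id prime_nat_iff)
  have "{..<p} = {0..ord c - 1}" using ord prime_gt_0_nat[OF P(3)] by auto
  then have "inj_on (\<lambda>i. c [^] i) {..<p}" using ord_inj[OF cC] by simp
  then have "card ((\<lambda>i. c [^] i) ` {..<p}) = card P" by (simp add: card_image P(2))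
  then have "(\<lambda>i. c [^] i) ` {..<p} = P"
    using finP pow by (intro card_subset_eq) auto
  then show ?thesis using x by blast
qed

lemma (in group) prime_subgroup_commute:
  assumes "subgroup P G" "card P = p" "prime p" "x \<in> P" "y \<in> P"
  shows "x \<otimes> y = y \<otimes> x"
proof (cases "x = \<one>")
  case False
  obtain i :: nat where y: "y = x [^] i" using prime_subgroup_powers[OF assms(1-4) False assms(5)] by blast
  have "x \<in> carrier G" using assms(1,4) by (rule subgroup.mem_carrier)
  then show ?thesis unfolding y by (simp add: group_commutes_pow)
next
  case True
  have "y \<in> carrier G" using assms(1,5) by (rule subgroup.mem_carrier)
  then show ?thesis using True by simp
qed

lemma (in group) subgroup_product_inj:
  assumes "subgroup A G" "subgroup B G" "A \<inter> B = {\<one>}"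
  shows "inj_on (\<lambda>(x, y). x \<otimes> y) (A \<times> B)"
proof (rule inj_onI, clarify)
  fix x y x' y' assume xy: "x \<in> A" "y \<in> B" "x' \<in> A" "y' \<in> B" and eq: "x \<otimes> y = x' \<otimes> y'"
  then have C: "x \<in> carrier G" "y \<in> carrier G" "x' \<in> carrier G" "y' \<in> carrier G"
    using assms by (auto intro: subgroup.mem_carrier)
  have "inv x' \<otimes> (x \<otimes> y) \<otimes> inv y = inv x' \<otimes> (x' \<otimes> y') \<otimes> inv y" using eq by simp
  then have *: "inv x' \<otimes> x = y' \<otimes> inv y" using C by (simp add: m_assoc) (simp flip: m_assoc)
  moreover have "inv x' \<otimes> x \<in> A" "y' \<otimes> inv y \<in> B"
    using xy assms by (auto simp: subgroup.m_closed subgroup.m_inv_closed)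
  ultimately have "inv x' \<otimes> x = \<one>" "y' \<otimes> inv y = \<one>" using assms(3) by auto
  then show "x = x' \<and> y = y'" using C by (metis inv_inv inv_equality inv_closed)
qed

lemma (in group) coprime_subgroups_inter:
  assumes "subgroup A G" "subgroup B G" "coprime (card A) (card B)" "finite A" "finite B"
  shows "A \<inter> B = {\<one>}"
proof -
  have sub: "subgroup (A \<inter> B) G" using assms by (intro subgroups_Inter_pair)
  have dvd: "card (A \<inter> B) dvd card A'" if A': "subgroup A' G" "A \<inter> B \<subseteq> A'" "finite A'" for A'
  proof -
    interpret A': group "G\<lparr>carrier := A'\<rparr>" using A'(1) by (rule subgroup_imp_group)
    have "subgroup (A \<inter> B) (G\<lparr>carrier := A'\<rparr>)" using sub A' by (simp add: subgroup_incl)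
    then show ?thesis using A'.lagrange_finite[of "A \<inter> B"] A'(3)
      by (simp add: Coset.order_def) (metis dvd_triv_right)
  qed
  have "card (A \<inter> B) dvd gcd (card A) (card B)" using dvd assms by (intro gcd_greatest) auto
  then have "card (A \<inter> B) = 1" using assms(3) by simp
  moreover have "\<one> \<in> A \<inter> B" using sub by (rule subgroup.one_closed)
  ultimately show ?thesis by (metis card_1_singletonE singletonD)
qed

section \<open>Nonabelian groups of order pq with a given complement\<close>

locale pq_group = group G for G (structure) +
  fixes p q :: nat and Q :: "'a set"
  assumes p: "prime p" and q: "prime q" and q_dvd: "q dvd p - 1"
    and order: "card (carrier G) = p * q" and noncomm: "\<not> comm_group G"
    and Q: "subgroup Q G" "card Q = q"
begin

lemma q_less_p: "q < p"
  using dvd_imp_le[OF q_dvd] prime_gt_1_nat[OF p] by simp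

lemma fin: "finite (carrier G)"
  using order p q by (metis card.infinite mult_is_0 not_prime_0)

lemma coprime_pq: "coprime p q"
  using p q q_less_p by (simp add: primes_coprime)

text \<open>By counting: a conjugate of \<open>P\<close> different from \<open>P\<close> meets it
  trivially, because any nontrivial common element would generate both. The product set would then
  have p * p elements, more than p * q.\<close>

lemma ex_normal_Sylow: "\<exists>P. P \<lhd> G \<and> card P = p"
proof -
  obtain P where P: "subgroup P G" "card P = p"
    using sylow_thm[OF p is_group, of 1 q] fin order by (auto simp: Coset.order_def)
  have finP: "finite P" using P fin by (meson finite_subset subgroup.subset)
  have PC: "x \<in> carrier G" if "x \<in> P" for x using P(1) that by (rule subgroup.mem_carrier)
  have "g \<otimes> h \<otimes> inv g \<in> P" if g: "g \<in> carrier G" and h: "h \<in> P" for g h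
  proof (rule ccontr)
    assume notin: "g \<otimes> h \<otimes> inv g \<notin> P"
    define P' where "P' = (\<lambda>x. g \<otimes> x \<otimes> inv g) ` P"
    have P'sub: "subgroup P' G"
    proof (rule subgroupI)
      show "P' \<subseteq> carrier G" using g PC by (auto simp: P'_def)
      show "P' \<noteq> {}" using h by (auto simp: P'_def)
      fix a assume "a \<in> P'"
      then obtain x where x: "x \<in> P" "a = g \<otimes> x \<otimes> inv g" by (auto simp: P'_def)
      then have "inv a = g \<otimes> inv x \<otimes> inv g" using g PC by (simp add: inv_mult_group m_assoc)
      then show "inv a \<in> P'" using x P(1) by (auto simp: P'_def subgroup.m_inv_closed)
      fix b assume "b \<in> P'"
      then obtain y where y: "y \<in> P" "b = g \<otimes> y \<otimes> inv g" by (auto simp: P'_def)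
      have "a \<otimes> b = g \<otimes> (x \<otimes> y) \<otimes> inv g"
        using x y g PC by (simp add: m_assoc) (simp flip: m_assoc)
      then show "a \<otimes> b \<in> P'" using x y P(1) by (auto simp: P'_def subgroup.m_closed)
    qed
    have cardP': "card P' = p"
      unfolding P'_def P(2)[symmetric] using g PC by (intro card_image inj_onI) simp
    have int: "P \<inter> P' = {\<one>}"
    proof (rule ccontr)
      assume "P \<inter> P' \<noteq> {\<one>}"
      then obtain z where z: "z \<in> P" "z \<in> P'" "z \<noteq> \<one>"
        using P(1) P'sub subgroup.one_closed by blast
      have "g \<otimes> h \<otimes> inv g \<in> P'" using h by (auto simp: P'_def)
      then obtain i :: nat where "g \<otimes> h \<otimes> inv g = z [^] i"
        using prime_subgroup_powers[OF P'sub cardP' p z(2,3)] by blast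
      moreover have "z [^] i \<in> P"
        using z P(1) by (induction i) (auto simp: subgroup.one_closed subgroup.m_closed)
      ultimately show False using notin by simp
    qed
    have "card (P \<times> P') \<le> card (carrier G)"
      using PC P'sub fin by (intro card_inj_on_le[OF subgroup_product_inj[OF P(1) P'sub int]])
        (auto simp: subgroup.mem_carrier)
    then have "p * p \<le> p * q" using P cardP' order by (simp add: card_cartesian_product)
    then show False using q_less_p p by (simp add: prime_gt_0_nat)
  qed
  then have "P \<lhd> G" using P(1) by (simp add: normal_inv_iff)
  then show ?thesis using P by blast
qed

definition P :: "'a set" where "P = (SOME P. P \<lhd> G \<and> card P = p)"

lemma P_normal: "P \<lhd> G" and card_P: "card P = p"
  using someI_ex[OF ex_normal_Sylow] by (auto simp: P_def)

lemma P_sub: "subgroup P G"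
  using P_normal by (rule normal_imp_subgroup)

lemma PC [simp]: "x \<in> P \<Longrightarrow> x \<in> carrier G"
  using P_sub by (rule subgroup.mem_carrier)

lemma QC [simp]: "x \<in> Q \<Longrightarrow> x \<in> carrier G"
  using Q(1) by (rule subgroup.mem_carrier)

lemma P_closed [simp]: "\<one> \<in> P" "x \<in> P \<Longrightarrow> y \<in> P \<Longrightarrow> x \<otimes> y \<in> P" "x \<in> P \<Longrightarrow> inv x \<in> P"
  and Q_closed [simp]: "\<one> \<in> Q" "x \<in> Q \<Longrightarrow> y \<in> Q \<Longrightarrow> x \<otimes> y \<in> Q" "x \<in> Q \<Longrightarrow> inv x \<in> Q"
  using P_sub Q(1) by (auto simp: subgroup.one_closed subgroup.m_closed subgroup.m_inv_closed)

lemma P_conj: "g \<in> carrier G \<Longrightarrow> x \<in> P \<Longrightarrow> g \<otimes> x \<otimes> inv g \<in> P"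
  using P_normal by (simp add: normal_inv_iff)

lemma PQ_int: "P \<inter> Q = {\<one>}"
proof (rule coprime_subgroups_inter[OF P_sub Q(1)])
  show "finite P" "finite Q" using fin P_sub Q(1) by (meson finite_subset subgroup.subset)+
qed (simp add: card_P Q coprime_pq)

lemma factor: "g \<in> carrier G \<Longrightarrow> \<exists>x\<in>P. \<exists>h\<in>Q. g = x \<otimes> h"
proof -
  assume g: "g \<in> carrier G"
  have "card ((\<lambda>(x, y). x \<otimes> y) ` (P \<times> Q)) = card (carrier G)"
    using subgroup_product_inj[OF P_sub Q(1) PQ_int]
    by (simp add: card_image card_cartesian_product card_P Q order)
  then have "(\<lambda>(x, y). x \<otimes> y) ` (P \<times> Q) = carrier G"
    using fin by (intro card_subset_eq) auto
  then show ?thesis using g by force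
qed

text \<open>The projection of the semidirect product of \<open>P\<close> and \<open>Q\<close> onto
  \<open>Q\<close>. The complement \<open>Q\<close> is a parameter of the locale because it will be
  a projection of the given \<open>H\<close>, and this map must retract onto exactly that
  subgroup.\<close>

definition \<phi> :: "'a \<Rightarrow> 'a" where "\<phi> g = (SOME h. h \<in> Q \<and> (\<exists>x\<in>P. g = x \<otimes> h))"

lemma \<phi>_eq: "x \<in> P \<Longrightarrow> h \<in> Q \<Longrightarrow> \<phi> (x \<otimes> h) = h"
  unfolding \<phi>_def
proof (rule some_equality)
  fix h' assume x: "x \<in> P" and h: "h \<in> Q" and "h' \<in> Q \<and> (\<exists>x'\<in>P. x \<otimes> h = x' \<otimes> h')"
  then obtain x' where x': "x' \<in> P" "h' \<in> Q" "x \<otimes> h = x' \<otimes> h'" by blast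
  then show "h' = h"
    using inj_onD[OF subgroup_product_inj[OF P_sub Q(1) PQ_int], of "(x, h)" "(x', h')"] x h by simp
qed blast

lemma \<phi>_in: "g \<in> carrier G \<Longrightarrow> \<phi> g \<in> Q"
  using factor \<phi>_eq by metis

lemma \<phi>_Q: "h \<in> Q \<Longrightarrow> \<phi> h = h"
  using \<phi>_eq[of \<one> h] by simp

lemma \<phi>_mult: "x \<in> carrier G \<Longrightarrow> y \<in> carrier G \<Longrightarrow> \<phi> (x \<otimes> y) = \<phi> x \<otimes> \<phi> y"
proof -
  assume "x \<in> carrier G" "y \<in> carrier G"
  then obtain a h b k where *: "a \<in> P" "h \<in> Q" "x = a \<otimes> h" "b \<in> P" "k \<in> Q" "y = b \<otimes> k"
    using factor by metis
  have "x \<otimes> y = (a \<otimes> (h \<otimes> b \<otimes> inv h)) \<otimes> (h \<otimes> k)"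
    using * by (simp add: m_assoc) (simp flip: m_assoc)
  then show ?thesis using * P_conj[of h b] by (simp add: \<phi>_eq)
qed

lemma \<phi>_one_iff: "x \<in> carrier G \<Longrightarrow> \<phi> x = \<one> \<longleftrightarrow> x \<in> P"
proof
  assume x: "x \<in> carrier G" "\<phi> x = \<one>"
  obtain a h where *: "a \<in> P" "h \<in> Q" "x = a \<otimes> h" using factor[OF x(1)] by blast
  then have "h = \<one>" using x \<phi>_eq by simp
  then show "x \<in> P" using * by simp
next
  assume "x \<in> P"
  then show "\<phi> x = \<one>" using \<phi>_eq[of x \<one>] by simp
qed

lemma \<phi>_inv: "x \<in> carrier G \<Longrightarrow> \<phi> (inv x) = inv (\<phi> x)"
proof -
  assume x: "x \<in> carrier G"
  have "\<phi> (inv x) \<otimes> \<phi> x = \<one>" using \<phi>_mult[of "inv x" x] \<phi>_Q[of \<one>] x by simp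
  then show ?thesis using x \<phi>_in[of x] \<phi>_in[of "inv x"] by (metis QC inv_closed inv_equality)
qed

lemma P_commute: "x \<in> P \<Longrightarrow> y \<in> P \<Longrightarrow> x \<otimes> y = y \<otimes> x"
  by (rule prime_subgroup_commute[OF P_sub card_P p])

lemma Q_commute: "x \<in> Q \<Longrightarrow> y \<in> Q \<Longrightarrow> x \<otimes> y = y \<otimes> x"
  by (rule prime_subgroup_commute[OF Q q])

text \<open>The quotient by \<open>P\<close> is a copy of the abelian group
  \<open>Q\<close>.\<close>

lemma commutator_in_P:
  assumes "x \<in> carrier G" "y \<in> carrier G"
  shows "x \<otimes> y \<otimes> inv x \<otimes> inv y \<in> P"
proof -
  have "\<phi> (x \<otimes> y \<otimes> inv x \<otimes> inv y) = \<phi> x \<otimes> \<phi> y \<otimes> inv (\<phi> x) \<otimes> inv (\<phi> y)"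
    using assms by (simp add: \<phi>_mult \<phi>_inv)
  also have "\<dots> = \<one>"
    using assms \<phi>_in Q_commute[of "\<phi> x" "\<phi> y"] by (simp add: m_assoc)
  finally show ?thesis using assms by (simp add: \<phi>_one_iff)
qed

text \<open>\<open>Q\<close> acts faithfully on \<open>P\<close>: a nontrivial \<open>h\<close>
  generates the group \<open>Q\<close> of prime order, so all of \<open>Q\<close> would commute with
  \<open>P\<close> and the whole group would be abelian.\<close>

lemma centralizing_P_trivial:
  assumes h: "h \<in> Q" and comm: "\<And>x. x \<in> P \<Longrightarrow> h \<otimes> x = x \<otimes> h"
  shows "h = \<one>"
proof (rule ccontr)
  assume "h \<noteq> \<one>"
  have PQ: "k \<otimes> x = x \<otimes> k" if k: "k \<in> Q" and x: "x \<in> P" for k x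
  proof -
    obtain i :: nat where "k = h [^] i"
      using prime_subgroup_powers[OF Q q h \<open>h \<noteq> \<one>\<close> k] by blast
    then show ?thesis using group_commutes_pow[OF comm[OF x]] h x by simp
  qed
  have "x \<otimes> y = y \<otimes> x" if xy: "x \<in> carrier G" "y \<in> carrier G" for x y
  proof -
    obtain a k b l where *: "a \<in> P" "k \<in> Q" "x = a \<otimes> k" "b \<in> P" "l \<in> Q" "y = b \<otimes> l"
      using factor xy by metis
    have "x \<otimes> y = a \<otimes> (k \<otimes> b) \<otimes> l" using * by (simp add: m_assoc)
    also have "\<dots> = (a \<otimes> b) \<otimes> (k \<otimes> l)" using * PQ[of k b] by (simp add: m_assoc)
    also have "\<dots> = (b \<otimes> a) \<otimes> (l \<otimes> k)" using * P_commute[of a b] Q_commute[of k l] by simp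
    also have "\<dots> = b \<otimes> (a \<otimes> l) \<otimes> k" using * by (simp add: m_assoc)
    also have "\<dots> = b \<otimes> (l \<otimes> a) \<otimes> k" using * PQ[of l a] by simp
    also have "\<dots> = y \<otimes> x" using * by (simp add: m_assoc)
    finally show ?thesis .
  qed
  then show False using noncomm by (simp add: group_comm_groupI)
qed

text \<open>The \<open>Q\<close>-part of a central element centralizes the abelian group
  \<open>P\<close>, hence is trivial. What remains lies in \<open>P\<close> and, if nontrivial,
  generates it, so that all of \<open>Q\<close> would centralize \<open>P\<close>.\<close>

lemma center_trivial:
  assumes n: "n \<in> carrier G" and comm: "\<And>g. g \<in> carrier G \<Longrightarrow> n \<otimes> g = g \<otimes> n"
  shows "n = \<one>"
proof (rule ccontr)
  assume "n \<noteq> \<one>"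
  obtain x h where xh: "x \<in> P" "h \<in> Q" "n = x \<otimes> h" using factor[OF n] by blast
  have "h \<otimes> y = y \<otimes> h" if y: "y \<in> P" for y
  proof -
    have "x \<otimes> (h \<otimes> y) = n \<otimes> y" using xh y by (simp add: m_assoc)
    also have "\<dots> = y \<otimes> (x \<otimes> h)" using comm[of y] xh y by simp
    also have "\<dots> = x \<otimes> (y \<otimes> h)" using P_commute[of x y] xh y by (simp flip: m_assoc)
    finally show ?thesis using xh y by simp
  qed
  then have "h = \<one>" using centralizing_P_trivial[OF xh(2)] by blast
  then have nP: "n \<in> P" using xh by simp
  have "Q \<subseteq> {\<one>}"
  proof
    fix k assume k: "k \<in> Q"
    have "k \<otimes> y = y \<otimes> k" if y: "y \<in> P" for y
    proof -
      obtain i :: nat where "y = n [^] i"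
        using prime_subgroup_powers[OF P_sub card_P p nP \<open>n \<noteq> \<one>\<close> y] by blast
      then show ?thesis using group_commutes_pow[OF comm[of k], of i] k n by simp
    qed
    then show "k \<in> {\<one>}" using centralizing_P_trivial[OF k] by simp
  qed
  then have "card Q \<le> 1" by (metis card.empty card_insert_disjoint card_mono finite.intros One_nat_def empty_iff)
  then show False using Q prime_gt_1_nat[OF q] by simp
qed

end

section \<open>The group algebra\<close>

locale fin_group = group G for G (structure) +
  assumes finite_carrier [simp, intro]: "finite (carrier G)"
begin

abbreviation C where "C \<equiv> carrier G"

lemma sum_left_translate:
  "a \<in> C \<Longrightarrow> (\<Sum>x\<in>C. f (a \<otimes> x)) = (\<Sum>x\<in>C. f x)"
  by (rule sum.reindex_bij_witness[where i = "\<lambda>x. inv a \<otimes> x" and j = "\<lambda>x. a \<otimes> x"])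
     (auto simp: m_assoc[symmetric])

lemma gmult_outside: "x \<notin> C \<Longrightarrow> gmult G f f' x = 0"
  by (simp add: gmult_def)

lemma gmult_in_galg [simp, intro]: "gmult G f f' \<in> galg G"
  by (simp add: galg_def gmult_def)

lemma gdelta_in_galg [simp, intro]: "g \<in> C \<Longrightarrow> gdelta g \<in> galg G"
  by (auto simp: galg_def gdelta_def)

lemma gunit_in_galg [simp, intro]: "gunit G \<in> galg G"
  by (simp add: gunit_def)

lemma gmult_right_conv:
  assumes "x \<in> C"
  shows "gmult G f f' x = (\<Sum>z\<in>C. f (x \<otimes> inv z) * f' z)"
proof -
  have "gmult G f f' x = (\<Sum>y\<in>C. f y * f' (inv y \<otimes> x))"
    using assms by (simp add: gmult_def)
  also have "\<dots> = (\<Sum>z\<in>C. f (x \<otimes> inv z) * f' z)"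
    using assms
    by (intro sum.reindex_bij_witness[where i = "\<lambda>z. x \<otimes> inv z" and j = "\<lambda>y. inv y \<otimes> x"])
       (auto simp: inv_mult_group m_assoc, auto simp: m_assoc[symmetric])
  finally show ?thesis .
qed

lemma gmult_assoc: "gmult G (gmult G f f') f'' = gmult G f (gmult G f' f'')"
proof
  fix x
  show "gmult G (gmult G f f') f'' x = gmult G f (gmult G f' f'') x"
  proof (cases "x \<in> C")
    case True
    have "gmult G (gmult G f f') f'' x =
        (\<Sum>w\<in>C. \<Sum>y\<in>C. f y * f' (inv y \<otimes> w) * f'' (inv w \<otimes> x))"
      using True by (simp add: gmult_def sum_distrib_right)
    also have "\<dots> = (\<Sum>y\<in>C. \<Sum>w\<in>C. f y * f' (inv y \<otimes> w) * f'' (inv w \<otimes> x))"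
      by (rule sum.swap)
    also have "\<dots> = (\<Sum>y\<in>C. \<Sum>z\<in>C.
        f y * f' (inv y \<otimes> (y \<otimes> z)) * f'' (inv (y \<otimes> z) \<otimes> x))"
      by (intro sum.cong refl sum_left_translate[symmetric])
    also have "\<dots> = (\<Sum>y\<in>C. \<Sum>z\<in>C. f y * (f' z * f'' (inv z \<otimes> (inv y \<otimes> x))))"
      using True by (intro sum.cong refl) (simp add: m_assoc[symmetric] inv_mult_group)
    also have "\<dots> = gmult G f (gmult G f' f'') x"
      using True by (simp add: gmult_def sum_distrib_left)
    finally show ?thesis .
  qed (simp add: gmult_outside)
qed

lemma gdelta_gmult:
  "g \<in> C \<Longrightarrow> x \<in> C \<Longrightarrow> gmult G (gdelta g) f x = f (inv g \<otimes> x)"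
  by (simp add: gmult_def gdelta_def if_distrib[where f = "\<lambda>c. c * _"] sum.delta cong: if_cong)

lemma gmult_gdelta:
  "g \<in> C \<Longrightarrow> x \<in> C \<Longrightarrow> gmult G f (gdelta g) x = f (x \<otimes> inv g)"
  by (simp add: gmult_right_conv gdelta_def if_distrib[where f = "\<lambda>c. _ * c"] sum.delta cong: if_cong)

lemma gmult_gdelta_gdelta:
  assumes "g \<in> C" "h \<in> C"
  shows "gmult G (gdelta g) (gdelta h) = gdelta (g \<otimes> h)"
proof
  fix x show "gmult G (gdelta g) (gdelta h) x = gdelta (g \<otimes> h) x"
  proof (cases "x \<in> C")
    case True
    then show ?thesis using assms
      by (simp add: gdelta_gmult) (metis gdelta_def inv_solve_left' m_closed)
  next
    case False
    then show ?thesis using assms by (auto simp: gmult_outside gdelta_def)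
  qed
qed

lemma gmult_gunit_left [simp]: "f \<in> galg G \<Longrightarrow> gmult G (gunit G) f = f"
  by (rule ext, rename_tac x, case_tac "x \<in> C")
     (auto simp: gunit_def gdelta_gmult gmult_outside galg_def)

lemma gmult_gunit_right [simp]: "f \<in> galg G \<Longrightarrow> gmult G f (gunit G) = f"
  by (rule ext, rename_tac x, case_tac "x \<in> C")
     (auto simp: gunit_def gmult_gdelta gmult_outside galg_def)

lemma gmult_sum_left:
  "gmult G (\<lambda>x. \<Sum>i\<in>I. c i * F i x) f = (\<lambda>x. \<Sum>i\<in>I. c i * gmult G (F i) f x)"
  by (rule ext) (auto simp: gmult_def sum_distrib_left sum_distrib_right mult.assoc intro: sum.swap)

lemma gmult_sum_right:
  "gmult G f (\<lambda>x. \<Sum>i\<in>I. c i * F i x) = (\<lambda>x. \<Sum>i\<in>I. c i * gmult G f (F i) x)"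
proof (rule ext)
  fix x
  show "gmult G f (\<lambda>x. \<Sum>i\<in>I. c i * F i x) x = (\<Sum>i\<in>I. c i * gmult G f (F i) x)"
  proof (cases "x \<in> C")
    case True
    have "gmult G f (\<lambda>x. \<Sum>i\<in>I. c i * F i x) x =
      (\<Sum>y\<in>C. \<Sum>i\<in>I. c i * (f y * F i (inv y \<otimes> x)))"
      using True by (simp add: gmult_def sum_distrib_left mult_ac)
    also have "\<dots> = (\<Sum>i\<in>I. \<Sum>y\<in>C. c i * (f y * F i (inv y \<otimes> x)))"
      by (rule sum.swap)
    finally show ?thesis using True by (simp add: gmult_def sum_distrib_left)
  qed (simp add: gmult_outside)
qed

lemma gmult_scale_left: "gmult G (\<lambda>x. c * f x) f' = (\<lambda>x. c * gmult G f f' x)"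
  by (rule ext) (simp add: gmult_def sum_distrib_left mult.assoc)

lemma gmult_scale_right: "gmult G f (\<lambda>x. c * f' x) = (\<lambda>x. c * gmult G f f' x)"
  by (rule ext) (simp add: gmult_def sum_distrib_left mult_ac)

lemma galg_expand: "f \<in> galg G \<Longrightarrow> f = (\<lambda>x. \<Sum>g\<in>C. f g * gdelta g x)"
  by (rule ext) (auto simp: gdelta_def galg_def if_distrib[where f = "\<lambda>c. _ * c"] sum.delta cong: if_cong)

lemma gmult_expand_left:
  "f \<in> galg G \<Longrightarrow> gmult G f f' = (\<lambda>x. \<Sum>g\<in>C. f g * gmult G (gdelta g) f' x)"
  by (subst galg_expand) (auto simp: gmult_sum_left)

lemma gmult_expand_right:
  "f' \<in> galg G \<Longrightarrow> gmult G f f' = (\<lambda>x. \<Sum>g\<in>C. f' g * gmult G f (gdelta g) x)"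
  by (subst galg_expand[of f']) (auto simp: gmult_sum_right)

text \<open>A one-dimensional representation extends linearly to an algebra map on the group
  algebra; the counit is the constant case.\<close>

lemma gcounit_gmult_char:
  assumes "\<And>x y. x \<in> C \<Longrightarrow> y \<in> C \<Longrightarrow> \<beta> (x \<otimes> y) = \<beta> x * \<beta> y"
  shows "(\<Sum>x\<in>C. \<beta> x * gmult G f f' x) =
    (\<Sum>x\<in>C. \<beta> x * f x) * (\<Sum>x\<in>C. \<beta> x * f' x)"
proof -
  have "(\<Sum>x\<in>C. \<beta> x * gmult G f f' x) =
      (\<Sum>x\<in>C. \<Sum>y\<in>C. \<beta> x * (f y * f' (inv y \<otimes> x)))"
    by (simp add: gmult_def sum_distrib_left)
  also have "\<dots> = (\<Sum>y\<in>C. \<Sum>x\<in>C. \<beta> x * (f y * f' (inv y \<otimes> x)))"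
    by (rule sum.swap)
  also have "\<dots> = (\<Sum>y\<in>C. \<Sum>x\<in>C. \<beta> (y \<otimes> x) * (f y * f' (inv y \<otimes> (y \<otimes> x))))"
    by (intro sum.cong refl sum_left_translate[symmetric])
  also have "\<dots> = (\<Sum>y\<in>C. \<Sum>x\<in>C. (\<beta> y * f y) * (\<beta> x * f' x))"
    by (intro sum.cong refl) (simp add: m_assoc[symmetric] assms)
  finally show ?thesis by (simp add: sum_product)
qed

lemma gcounit_gmult: "gcounit G (gmult G f f') = gcounit G f * gcounit G f'"
  using gcounit_gmult_char[of "\<lambda>_. 1" f f'] by (simp add: gcounit_def)

lemma gcounit_gdelta [simp]: "g \<in> C \<Longrightarrow> gcounit G (gdelta g) = 1"
  by (simp add: gcounit_def gdelta_def sum.delta)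

text \<open>Up to the factor |G|, the coefficient of the unit is the character of the regular
  representation, hence a trace.\<close>

lemma gmult_one_commute:
  "gmult G f f' \<one> = gmult G f' f \<one>"
  by (simp add: gmult_right_conv[of _ f]) (simp add: gmult_def mult.commute)

section \<open>The tensor square as the group algebra of G x G\<close>

lemma fin_group_DirProd: "fin_group (G \<times>\<times> G)"
  by (intro fin_group.intro DirProd_group fin_group_axioms.intro) (auto intro: is_group)

lemma tmult_eq: "tmult G T T' = gmult (G \<times>\<times> G) T T'"
proof (rule ext, clarify)
  fix x y
  show "tmult G T T' (x, y) = gmult (G \<times>\<times> G) T T' (x, y)"
    by (cases "x \<in> C \<and> y \<in> C")
       (auto simp: tmult_def gmult_def inv_DirProd is_group sum.cartesian_product intro!: sum.cong)
qed

lemma tunit_eq: "tunit G = gunit (G \<times>\<times> G)"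
  by (auto simp: tunit_def gunit_def gdelta_def)

lemma tens_in_galg [intro]: "a \<in> galg G \<Longrightarrow> b \<in> galg G \<Longrightarrow> tens a b \<in> galg (G \<times>\<times> G)"
  by (auto simp: galg_def tens_def)

lemma tmult_in_galg [simp, intro]: "tmult G T T' \<in> galg (G \<times>\<times> G)"
  by (simp add: tmult_eq fin_group.gmult_in_galg fin_group_DirProd)

lemma tmult_tens: "tmult G (tens a b) (tens c d) = tens (gmult G a c) (gmult G b d)"
  by (rule ext) (auto simp: tmult_def tens_def gmult_def sum_product mult_ac)

lemma tunit_tens: "tunit G = tens (gunit G) (gunit G)"
  by (auto simp: tunit_def tens_def gunit_def gdelta_def)

lemma tmult_assoc: "tmult G (tmult G T T') T'' = tmult G T (tmult G T' T'')"
  by (simp add: tmult_eq fin_group.gmult_assoc[OF fin_group_DirProd])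

lemma tmult_tunit_left [simp]: "T \<in> galg (G \<times>\<times> G) \<Longrightarrow> tmult G (tunit G) T = T"
  by (simp add: tmult_eq tunit_eq fin_group.gmult_gunit_left[OF fin_group_DirProd])

lemma tmult_tunit_right [simp]: "T \<in> galg (G \<times>\<times> G) \<Longrightarrow> tmult G T (tunit G) = T"
  by (simp add: tmult_eq tunit_eq fin_group.gmult_gunit_right[OF fin_group_DirProd])

lemmas tmult_sum_left = fin_group.gmult_sum_left[OF fin_group_DirProd, folded tmult_eq]
lemmas tmult_sum_right = fin_group.gmult_sum_right[OF fin_group_DirProd, folded tmult_eq]

lemma tinv_eqI:
  assumes "T' \<in> galg (G \<times>\<times> G)" "tmult G T' T = tunit G" "tmult G T T' = tunit G"
  shows "tinv G T = T'"
  unfolding tinv_def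
proof (rule the_equality)
  show "(\<forall>x y. (x \<notin> C \<or> y \<notin> C) \<longrightarrow> T' (x, y) = 0)
                 \<and> tmult G T' T = tunit G \<and> tmult G T T' = tunit G"
    using assms by (auto simp: galg_def)
next
  fix U assume U: "(\<forall>x y. (x \<notin> C \<or> y \<notin> C) \<longrightarrow> U (x, y) = 0)
                 \<and> tmult G U T = tunit G \<and> tmult G T U = tunit G"
  then have "U \<in> galg (G \<times>\<times> G)" by (auto simp: galg_def)
  then have "U = tmult G U (tmult G T T')" using assms by simp
  also have "\<dots> = tmult G (tunit G) T'" using U by (simp add: tmult_assoc[symmetric])
  also have "\<dots> = T'" using assms(1) by simp
  finally show "U = T'" .
qed

lemma gcomult_gdelta: "gcomult (gdelta g) = tens (gdelta g) (gdelta g)"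
  by (auto simp: gcomult_def tens_def gdelta_def)

lemma gcomult_in_galg: "f \<in> galg G \<Longrightarrow> gcomult f \<in> galg (G \<times>\<times> G)"
  by (auto simp: galg_def gcomult_def)

lemma gcomult_gmult: "tmult G (gcomult f) (gcomult f') = gcomult (gmult G f f')"
proof (rule ext, clarify)
  fix x y
  show "tmult G (gcomult f) (gcomult f') (x, y) = gcomult (gmult G f f') (x, y)"
  proof (cases "x \<in> C \<and> y \<in> C")
    case True
    have "tmult G (gcomult f) (gcomult f') (x, y) = (\<Sum>y1\<in>C. \<Sum>y2\<in>C.
       (if y1 = y2 then f y1 * (if x = y then f' (inv y1 \<otimes> x) else 0) else 0))"
      using True by (simp only: tmult_def gcomult_def prod.case if_True simp_thms)
        (intro sum.cong refl, auto)
    also have "\<dots> = (\<Sum>y1\<in>C. f y1 * (if x = y then f' (inv y1 \<otimes> x) else 0))"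
      by (intro sum.cong refl) (simp add: sum.delta')
    also have "\<dots> = gcomult (gmult G f f') (x, y)"
      using True by (auto simp: gcomult_def gmult_def)
    finally show ?thesis .
  next
    case False
    then show ?thesis by (auto simp: tmult_def gcomult_def gmult_outside)
  qed
qed

lemma gmult_sum2_left:
  "gmult G (\<lambda>x. \<Sum>a\<in>A. \<Sum>b\<in>B. c a b * F a b x) f = (\<lambda>x. \<Sum>a\<in>A. \<Sum>b\<in>B. c a b * gmult G (F a b) f x)"
  using gmult_sum_left[where I = "A \<times> B" and c = "\<lambda>t. c (fst t) (snd t)" and F = "\<lambda>t. F (fst t) (snd t)"]
  by (simp add: sum_Times)

lemma gmult_sum2_right:
  "gmult G f (\<lambda>x. \<Sum>a\<in>A. \<Sum>b\<in>B. c a b * F a b x) = (\<lambda>x. \<Sum>a\<in>A. \<Sum>b\<in>B. c a b * gmult G f (F a b) x)"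
  using gmult_sum_right[where I = "A \<times> B" and c = "\<lambda>t. c (fst t) (snd t)" and F = "\<lambda>t. F (fst t) (snd t)"]
  by (simp add: sum_Times)

lemma galg_sum_gdelta: "f \<in> galg G \<Longrightarrow> (\<Sum>g\<in>C. f g * gdelta g x) = f x"
  using galg_expand[of f] by (rule fun_cong[OF sym])

lemma tmult_tens_gunit_right:
  assumes "T \<in> galg (G \<times>\<times> G)"
  shows "tmult G T (tens h (gunit G)) (x, y) = gmult G (\<lambda>x. T (x, y)) h x"
proof (cases "x \<in> C \<and> y \<in> C")
  case True
  have "tmult G T (tens h (gunit G)) (x, y) = (\<Sum>a\<in>C. \<Sum>b\<in>C.
     if b = y then T (a, y) * h (inv a \<otimes> x) else 0)"
    using True unfolding tmult_def tens_def prod.case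
    by (simp only: simp_thms if_True)
       (intro sum.cong refl, auto simp: gunit_def gdelta_def, metis inv_closed inv_equality inv_inv)
  also have "\<dots> = gmult G (\<lambda>x. T (x, y)) h x"
    using True by (simp add: gmult_def sum.delta)
  finally show ?thesis .
next
  case False
  then have "T (a, y) = 0" if "y \<notin> C" for a using assms that by (auto simp: galg_def)
  with False show ?thesis by (auto simp: tmult_def gmult_def)
qed

lemma tmult_tens_gunit_left:
  assumes "T \<in> galg (G \<times>\<times> G)"
  shows "tmult G T (tens (gunit G) h) (x, y) = gmult G (\<lambda>y. T (x, y)) h y"
proof (cases "x \<in> C \<and> y \<in> C")
  case True
  have "tmult G T (tens (gunit G) h) (x, y) = (\<Sum>a\<in>C. \<Sum>b\<in>C.
     if a = x then T (x, b) * h (inv b \<otimes> y) else 0)"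
    using True unfolding tmult_def tens_def prod.case
    by (simp only: simp_thms if_True)
       (intro sum.cong refl, auto simp: gunit_def gdelta_def, metis inv_closed inv_equality inv_inv)
  also have "\<dots> = (\<Sum>b\<in>C. \<Sum>a\<in>C. if a = x then T (x, b) * h (inv b \<otimes> y) else 0)"
    by (rule sum.swap)
  also have "\<dots> = gmult G (\<lambda>y. T (x, y)) h y"
    using True by (simp add: gmult_def sum.delta)
  finally show ?thesis .
next
  case False
  then have "T (x, b) = 0" if "x \<notin> C" for b using assms that by (auto simp: galg_def)
  with False show ?thesis by (auto simp: tmult_def gmult_def)
qed

lemma tens_gdelta: "tens (gdelta a) (gdelta b) = gdelta (a, b)"
  by (auto simp: tens_def gdelta_def)

lemma gdelta_tmult:
  assumes "a \<in> C" "b \<in> C" "x \<in> C" "y \<in> C"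
  shows "tmult G (tens (gdelta a) (gdelta b)) T (x, y) = T (inv a \<otimes> x, inv b \<otimes> y)"
  using assms fin_group.gdelta_gmult[OF fin_group_DirProd, of "(a, b)" "(x, y)" T]
  by (simp add: tmult_eq tens_gdelta inv_DirProd is_group)

lemma tmult_gdelta:
  assumes "a \<in> C" "b \<in> C" "x \<in> C" "y \<in> C"
  shows "tmult G T (tens (gdelta a) (gdelta b)) (x, y) = T (x \<otimes> inv a, y \<otimes> inv b)"
  using assms fin_group.gmult_gdelta[OF fin_group_DirProd, of "(a, b)" "(x, y)" T]
  by (simp add: tmult_eq tens_gdelta inv_DirProd is_group)

lemma tens_central:
  assumes T: "T \<in> galg (G \<times>\<times> G)"
    and "\<And>g. g \<in> C \<Longrightarrow> gmult G (gdelta g) Z = gmult G Z (gdelta g)"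
    and "\<And>g. g \<in> C \<Longrightarrow> gmult G (gdelta g) Z' = gmult G Z' (gdelta g)"
  shows "tmult G T (tens Z Z') = tmult G (tens Z Z') T"
proof -
  have "tmult G T (tens Z Z') = (\<lambda>x. \<Sum>t\<in>carrier (G \<times>\<times> G). T t * tmult G (gdelta t) (tens Z Z') x)"
    using fin_group.gmult_expand_left[OF fin_group_DirProd T] by (simp add: tmult_eq)
  also have "\<dots> = (\<lambda>x. \<Sum>t\<in>carrier (G \<times>\<times> G). T t * tmult G (tens Z Z') (gdelta t) x)"
    by (intro ext sum.cong refl) (auto simp: tens_gdelta[symmetric] tmult_tens assms)
  also have "\<dots> = tmult G (tens Z Z') T"
    using fin_group.gmult_expand_right[OF fin_group_DirProd T] by (simp add: tmult_eq)
  finally show ?thesis .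
qed

lemma gunit_central: "g \<in> C \<Longrightarrow> gmult G (gdelta g) (gunit G) = gmult G (gunit G) (gdelta g)"
  by simp

end

section \<open>Characters of an abelian subgroup\<close>

text \<open>Column orthogonality stands in for the structure of \<open>H\<close>: it says that there
  are enough characters, and already yields that \<open>X\<close> is finite of the same size as
  \<open>H\<close> and that the character idempotents sum to the unit.\<close>

locale dual_subgroup = fin_group G for G (structure) +
  fixes H :: "'a set" and X :: "('a \<Rightarrow> 'k::field_char_0) set"
  assumes subgroup_H: "subgroup H G"
    and H_commute: "x \<in> H \<Longrightarrow> y \<in> H \<Longrightarrow> x \<otimes> y = y \<otimes> x"
    and X_def: "X = characters G H"
    and sum_characters: "h \<in> H \<Longrightarrow> (\<Sum>\<chi>\<in>X. \<chi> h) = (if h = \<one> then of_nat (card H) else 0)"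
begin

lemma H_carrier [simp]: "h \<in> H \<Longrightarrow> h \<in> C"
  using subgroup.subset[OF subgroup_H] by blast

abbreviation XX :: "(('a \<Rightarrow> 'k) \<times> ('a \<Rightarrow> 'k)) set" where "XX \<equiv> X \<times> X"

lemma H_one [simp]: "\<one> \<in> H" and H_mult [simp]: "x \<in> H \<Longrightarrow> y \<in> H \<Longrightarrow> x \<otimes> y \<in> H"
  and H_inv [simp]: "x \<in> H \<Longrightarrow> inv x \<in> H"
  using subgroup_H by (auto simp: subgroup.one_closed subgroup.m_closed subgroup.m_inv_closed)

lemma finite_H [simp]: "finite H"
  using finite_subset[OF subgroup.subset[OF subgroup_H]] by simp

lemma sum_H_left_translate: "k \<in> H \<Longrightarrow> (\<Sum>h\<in>H. f (k \<otimes> h)) = (\<Sum>h\<in>H. f h)"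
  by (rule sum.reindex_bij_witness[where i = "\<lambda>x. inv k \<otimes> x" and j = "\<lambda>x. k \<otimes> x"])
     (auto simp: m_assoc[symmetric])

lemma char_hom: "\<chi> \<in> X \<Longrightarrow> x \<in> H \<Longrightarrow> y \<in> H \<Longrightarrow> \<chi> (x \<otimes> y) = \<chi> x * \<chi> y"
  and char_one: "\<chi> \<in> X \<Longrightarrow> \<chi> \<one> = 1"
  and char_outside: "\<chi> \<in> X \<Longrightarrow> x \<notin> H \<Longrightarrow> \<chi> x = 0"
  by (auto simp: X_def characters_def)

lemma char_inv_mult: "\<chi> \<in> X \<Longrightarrow> x \<in> H \<Longrightarrow> \<chi> (inv x) * \<chi> x = 1"
  using char_hom[of \<chi> "inv x" x] by (simp add: char_one)

lemma char_nonzero: "\<chi> \<in> X \<Longrightarrow> x \<in> H \<Longrightarrow> \<chi> x \<noteq> 0"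
  using char_inv_mult by force

lemma char_inv: "\<chi> \<in> X \<Longrightarrow> x \<in> H \<Longrightarrow> \<chi> (inv x) = inverse (\<chi> x)"
  using char_inv_mult char_nonzero by (metis inverse_unique mult.commute)

lemma char_pow: "\<chi> \<in> X \<Longrightarrow> h \<in> H \<Longrightarrow> h [^] (n::nat) \<in> H \<and> \<chi> (h [^] n) = \<chi> h ^ n"
  by (induction n) (auto simp: char_one char_hom)

definition triv :: "'a \<Rightarrow> 'k" where "triv = (\<lambda>x. if x \<in> H then 1 else 0)"

text \<open>Since \<open>inverse 0 = 0\<close>, the result still vanishes outside \<open>H\<close>,
  as every member of \<open>characters\<close> must.\<close>

definition cinv :: "('a \<Rightarrow> 'k) \<Rightarrow> 'a \<Rightarrow> 'k" where "cinv \<chi> = (\<lambda>x. inverse (\<chi> x))"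

lemma triv_X [simp]: "triv \<in> X"
  by (auto simp: X_def characters_def triv_def)

lemma char_mult_X [simp]: "\<alpha> \<in> X \<Longrightarrow> \<beta> \<in> X \<Longrightarrow> char_mult \<alpha> \<beta> \<in> X"
  by (auto simp: X_def characters_def char_mult_def)

lemma cinv_X [simp]: "\<alpha> \<in> X \<Longrightarrow> cinv \<alpha> \<in> X"
  by (auto simp: X_def characters_def cinv_def)

lemma char_mult_assoc: "char_mult (char_mult \<alpha> \<beta>) \<gamma> = char_mult \<alpha> (char_mult \<beta> \<gamma>)"
  by (simp add: char_mult_def mult.assoc)

lemma char_mult_commute: "char_mult \<alpha> \<beta> = char_mult \<beta> \<alpha>"
  by (simp add: char_mult_def mult.commute)

lemma char_mult_triv [simp]: "\<alpha> \<in> X \<Longrightarrow> char_mult triv \<alpha> = \<alpha>" "\<alpha> \<in> X \<Longrightarrow> char_mult \<alpha> triv = \<alpha>"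
  by (auto simp: char_mult_def triv_def fun_eq_iff char_outside)

lemma char_mult_cinv [simp]:
  "\<alpha> \<in> X \<Longrightarrow> char_mult (cinv \<alpha>) \<alpha> = triv" "\<alpha> \<in> X \<Longrightarrow> char_mult \<alpha> (cinv \<alpha>) = triv"
  by (auto simp: char_mult_def triv_def cinv_def fun_eq_iff char_outside char_nonzero)

lemma cinv_cinv [simp]: "cinv (cinv \<alpha>) = \<alpha>"
  by (simp add: cinv_def)

lemma cinv_triv [simp]: "cinv triv = triv"
  by (auto simp: cinv_def triv_def)

lemma char_mult_cinv_triv_iff:
  assumes "\<alpha> \<in> X" "\<beta> \<in> X"
  shows "char_mult (cinv \<alpha>) \<beta> = triv \<longleftrightarrow> \<alpha> = \<beta>"
proof
  assume *: "char_mult (cinv \<alpha>) \<beta> = triv"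
  have "\<alpha> = char_mult \<alpha> (char_mult (cinv \<alpha>) \<beta>)" using assms * by simp
  also have "\<dots> = \<beta>" using assms by (simp flip: char_mult_assoc)
  finally show "\<alpha> = \<beta>" .
qed (use assms in simp)

lemma char_eq_triv:
  assumes \<chi>: "\<chi> \<in> X" and K: "\<And>k. k \<in> K \<Longrightarrow> k \<in> H \<and> \<chi> k = 1" and t: "t \<in> H" "\<chi> t = 1"
    and gen: "\<And>h. h \<in> H \<Longrightarrow> \<exists>k\<in>K. \<exists>i::nat. h = k \<otimes> t [^] i"
  shows "\<chi> = triv"
proof (rule ext)
  fix h
  show "\<chi> h = triv h"
  proof (cases "h \<in> H")
    case True
    then obtain k and i :: nat where "k \<in> K" "h = k \<otimes> t [^] i" using gen by blast
    then show ?thesis using K[of k] char_pow[OF \<chi> t(1), of i] t(2) \<chi> True by (simp add: char_hom triv_def)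
  qed (use \<chi> in \<open>simp add: triv_def char_outside\<close>)
qed

lemma H_nonempty: "H \<noteq> {}"
  using H_one by blast

text \<open>A sum over an infinite set is 0, whereas orthogonality at the unit gives
  \<open>card H\<close>.\<close>

lemma finite_X [simp]: "finite X"
proof (rule ccontr)
  assume "infinite X"
  then show False using sum_characters[of \<one>] H_nonempty by simp
qed

lemma card_X: "card X = card H"
proof -
  have "of_nat (card X) = (\<Sum>\<chi>\<in>X. \<chi> \<one>)" by (simp add: char_one)
  also have "\<dots> = of_nat (card H)" by (subst sum_characters) auto
  finally show ?thesis by simp
qed

lemma sum_char_H:
  assumes "\<chi> \<in> X"
  shows "(\<Sum>h\<in>H. \<chi> h) = (if \<chi> = triv then of_nat (card H) else 0)"
proof (cases "\<chi> = triv")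
  case True
  then show ?thesis by (simp add: triv_def)
next
  case False
  then obtain k where k: "k \<in> H" "\<chi> k \<noteq> 1"
    using assms char_outside[of \<chi>] unfolding triv_def by fastforce
  have "(\<Sum>h\<in>H. \<chi> h) = (\<Sum>h\<in>H. \<chi> (k \<otimes> h))" using k by (simp add: sum_H_left_translate)
  also have "\<dots> = \<chi> k * (\<Sum>h\<in>H. \<chi> h)" using k assms by (simp add: sum_distrib_left char_hom)
  finally show ?thesis using k False by simp
qed

section \<open>Character idempotents and the bigrading of the group algebra\<close>

abbreviation e :: "('a \<Rightarrow> 'k) \<Rightarrow> 'a \<Rightarrow> 'k" where "e \<equiv> char_idem G H"

lemma e_in_galg [simp]: "e \<alpha> \<in> galg G"
  by (auto simp: galg_def char_idem_def)

lemma e_orth: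
  assumes "\<alpha> \<in> X" "\<beta> \<in> X"
  shows "(\<Sum>h\<in>H. e \<alpha> h * \<beta> h) = (if \<alpha> = \<beta> then 1 else 0)"
proof -
  have "(\<Sum>h\<in>H. e \<alpha> h * \<beta> h) = (\<Sum>h\<in>H. char_mult (cinv \<alpha>) \<beta> h) / of_nat (card H)"
    unfolding sum_divide_distrib using assms
    by (intro sum.cong) (auto simp: char_mult_def cinv_def char_inv char_idem_def)
  then show ?thesis using assms H_nonempty by (simp add: sum_char_H char_mult_cinv_triv_iff)
qed

lemma sum_e: "(\<Sum>\<alpha>\<in>X. e \<alpha> x) = gunit G x"
proof (cases "x \<in> H")
  case True
  have "(\<Sum>\<alpha>\<in>X. e \<alpha> x) = (\<Sum>\<alpha>\<in>X. \<alpha> (inv x)) / of_nat (card H)"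
    using True by (simp add: char_idem_def sum_divide_distrib)
  also have "\<dots> = gunit G x"
    using True H_nonempty by (auto simp: sum_characters gunit_def gdelta_def)
  finally show ?thesis .
next
  case False
  then show ?thesis by (auto simp: char_idem_def gunit_def gdelta_def)
qed

lemma e_expand: "e \<alpha> = (\<lambda>x. \<Sum>h\<in>H. e \<alpha> h * gdelta h x)"
  by (rule ext) (auto simp: char_idem_def gdelta_def if_distrib[where f = "\<lambda>c. _ * c"] sum.delta
      cong: if_cong)

lemma e_translate:
  "\<alpha> \<in> X \<Longrightarrow> h \<in> H \<Longrightarrow> x \<in> H \<Longrightarrow> e \<alpha> (inv h \<otimes> x) = \<alpha> h * e \<alpha> x"
  by (simp add: char_idem_def inv_mult_group char_hom mult.commute)

lemma gdelta_e:
  assumes "\<alpha> \<in> X" "h \<in> H"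
  shows "gmult G (gdelta h) (e \<alpha>) = (\<lambda>x. \<alpha> h * e \<alpha> x)"
proof (rule ext)
  fix x
  have *: "inv h \<otimes> x \<in> H \<longleftrightarrow> x \<in> H" if "x \<in> C"
    using assms that by (metis H_carrier H_inv H_mult inv_closed inv_solve_left')
  show "gmult G (gdelta h) (e \<alpha>) x = \<alpha> h * e \<alpha> x"
  proof (cases "x \<in> H")
    case True
    then show ?thesis using assms by (simp add: gdelta_gmult e_translate)
  next
    case False
    then show ?thesis using assms *
      by (cases "x \<in> C") (auto simp: gdelta_gmult gmult_outside char_idem_def)
  qed
qed

lemma e_gdelta:
  assumes "\<alpha> \<in> X" "h \<in> H"
  shows "gmult G (e \<alpha>) (gdelta h) = (\<lambda>x. \<alpha> h * e \<alpha> x)"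
proof -
  have "gmult G (e \<alpha>) (gdelta h) = (\<lambda>x. \<Sum>k\<in>H. e \<alpha> k * gmult G (gdelta k) (gdelta h) x)"
    by (subst e_expand) (rule gmult_sum_left)
  also have "\<dots> = (\<lambda>x. \<Sum>k\<in>H. e \<alpha> k * gmult G (gdelta h) (gdelta k) x)"
    using assms by (intro ext sum.cong refl) (simp add: gmult_gdelta_gdelta H_commute[of h])
  also have "\<dots> = gmult G (gdelta h) (e \<alpha>)"
    by (subst (2) e_expand) (rule gmult_sum_right[symmetric])
  finally show ?thesis using assms by (simp add: gdelta_e)
qed

lemma e_mult_e:
  assumes "\<alpha> \<in> X" "\<beta> \<in> X"
  shows "gmult G (e \<alpha>) (e \<beta>) = (if \<alpha> = \<beta> then e \<beta> else (\<lambda>_. 0))"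
proof -
  have "gmult G (e \<alpha>) (e \<beta>) = (\<lambda>x. \<Sum>h\<in>H. e \<alpha> h * gmult G (gdelta h) (e \<beta>) x)"
    by (subst e_expand) (rule gmult_sum_left)
  also have "\<dots> = (\<lambda>x. (\<Sum>h\<in>H. e \<alpha> h * \<beta> h) * e \<beta> x)"
    using assms by (simp add: fun_eq_iff gdelta_e sum_distrib_right mult.assoc)
  also have "\<dots> = (if \<alpha> = \<beta> then e \<beta> else (\<lambda>_. 0))"
    using assms by (simp add: e_orth fun_eq_iff)
  finally show ?thesis .
qed

text \<open>The component \<open>e\<^sub>\<alpha> g e\<^sub>\<gamma>\<close> of the basis element \<open>g\<close> in degree \<open>i = (\<alpha>, \<gamma>)\<close> of the bigrading
  of the group algebra given by left and right multiplication with \<open>H\<close>.\<close>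

definition bicomp :: "('a \<Rightarrow> 'k) \<times> ('a \<Rightarrow> 'k) \<Rightarrow> 'a \<Rightarrow> 'a \<Rightarrow> 'k" where
  "bicomp i g x = (\<Sum>h\<in>H. \<Sum>k\<in>H. e (fst i) h * e (snd i) k * gdelta (h \<otimes> g \<otimes> k) x)"

lemma bicomp_eq:
  assumes "g \<in> C"
  shows "bicomp i g = gmult G (gmult G (e (fst i)) (gdelta g)) (e (snd i))"
proof (rule ext)
  fix x
  have "gmult G (e (fst i)) (gdelta g) = (\<lambda>x. \<Sum>h\<in>H. e (fst i) h * gmult G (gdelta h) (gdelta g) x)"
    by (subst e_expand) (rule gmult_sum_left)
  then have "gmult G (gmult G (e (fst i)) (gdelta g)) (e (snd i)) x =
     (\<Sum>h\<in>H. e (fst i) h * gmult G (gdelta (h \<otimes> g)) (e (snd i)) x)"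
    using assms by (simp add: gmult_gdelta_gdelta gmult_sum_left)
  also have "\<dots> = (\<Sum>h\<in>H. e (fst i) h * (\<Sum>k\<in>H. e (snd i) k * gmult G (gdelta (h \<otimes> g)) (gdelta k) x))"
    by (subst (2) e_expand) (simp add: gmult_sum_right)
  also have "\<dots> = bicomp i g x"
    using assms by (simp add: bicomp_def sum_distrib_left gmult_gdelta_gdelta mult.assoc)
  finally show "bicomp i g x = gmult G (gmult G (e (fst i)) (gdelta g)) (e (snd i)) x" ..
qed

lemma bicomp_in_galg [simp]: "g \<in> C \<Longrightarrow> bicomp i g \<in> galg G"
  by (simp add: bicomp_eq)

lemma sum_bicomp:
  assumes "g \<in> C"
  shows "(\<Sum>u\<in>C. bicomp i g u * F u) =
    (\<Sum>h\<in>H. \<Sum>k\<in>H. e (fst i) h * e (snd i) k * F (h \<otimes> g \<otimes> k))"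
proof -
  have "(\<Sum>u\<in>C. bicomp i g u * F u) = (\<Sum>u\<in>C. \<Sum>h\<in>H. \<Sum>k\<in>H.
     e (fst i) h * e (snd i) k * (gdelta (h \<otimes> g \<otimes> k) u * F u))"
    by (simp add: bicomp_def sum_distrib_right mult.assoc)
  also have "\<dots> = (\<Sum>h\<in>H. \<Sum>u\<in>C. \<Sum>k\<in>H.
      e (fst i) h * e (snd i) k * (gdelta (h \<otimes> g \<otimes> k) u * F u))"
    by (rule sum.swap)
  also have "\<dots> = (\<Sum>h\<in>H. \<Sum>k\<in>H. \<Sum>u\<in>C.
      e (fst i) h * e (snd i) k * (gdelta (h \<otimes> g \<otimes> k) u * F u))"
    by (intro sum.cong refl sum.swap)
  also have "\<dots> = (\<Sum>h\<in>H. \<Sum>k\<in>H. e (fst i) h * e (snd i) k * F (h \<otimes> g \<otimes> k))"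
    using assms by (intro sum.cong refl)
      (simp add: sum_distrib_left[symmetric] gdelta_def if_distrib[where f = "\<lambda>c. c * _"] sum.delta
        cong: if_cong)
  finally show ?thesis .
qed

text \<open>Projection to a weight space: a function that transforms under \<open>H\<close> on the
  two sides by (\<alpha>, \<gamma>) sees only that component of \<open>g\<close>. Products of
  components, characters of the group, and components of inverses taken for \<open>F\<close> give
  the selection rules used later.\<close>

lemma sum_bicomp_mult:
  assumes "g \<in> C" "i \<in> XX" "\<alpha> \<in> X" "\<gamma> \<in> X"
    and "\<And>h k. h \<in> H \<Longrightarrow> k \<in> H \<Longrightarrow> F (h \<otimes> g \<otimes> k) = \<alpha> h * \<gamma> k * F g"
  shows "(\<Sum>u\<in>C. bicomp i g u * F u) = (if i = (\<alpha>, \<gamma>) then F g else 0)"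
proof -
  have "(\<Sum>u\<in>C. bicomp i g u * F u) = (\<Sum>h\<in>H. \<Sum>k\<in>H.
      ((e (fst i) h * \<alpha> h) * (e (snd i) k * \<gamma> k)) * F g)"
    unfolding sum_bicomp[OF assms(1)] using assms(5)
    by (intro sum.cong refl) simp
  also have "\<dots> = (\<Sum>h\<in>H. e (fst i) h * \<alpha> h) * (\<Sum>k\<in>H. e (snd i) k * \<gamma> k) * F g"
    by (simp only: sum_distrib_right[symmetric] sum_product)
  also have "\<dots> = (if i = (\<alpha>, \<gamma>) then F g else 0)"
    using assms(2-4) by (auto simp: e_orth split: if_splits)
  finally show ?thesis .
qed

lemma bicomp_translate:
  assumes "g \<in> C" "i \<in> XX" "h \<in> H" "k \<in> H"
  shows "bicomp i (h \<otimes> g \<otimes> k) x = fst i h * snd i k * bicomp i g x"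
proof -
  have i: "fst i \<in> X" "snd i \<in> X" using assms by auto
  have "bicomp i (h \<otimes> g \<otimes> k) =
     gmult G (gmult G (e (fst i)) (gdelta h)) (gmult G (gdelta g) (gmult G (gdelta k) (e (snd i))))"
    using assms by (simp add: bicomp_eq gmult_assoc flip: gmult_gdelta_gdelta)
  also have "\<dots> = (\<lambda>x. fst i h * (snd i k * bicomp i g x))"
    using assms i by (simp add: e_gdelta gdelta_e gmult_scale_left gmult_scale_right bicomp_eq gmult_assoc)
  finally show ?thesis by simp
qed

lemma sum_all_bicomp:
  assumes "g \<in> C"
  shows "(\<Sum>i\<in>XX. bicomp i g x) = gdelta g x"
proof -
  have "(\<Sum>i\<in>XX. bicomp i g x) = (\<Sum>\<alpha>\<in>X. \<Sum>\<gamma>\<in>X. gmult G (gmult G (e \<alpha>) (gdelta g)) (e \<gamma>) x)"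
    using assms by (simp add: sum.cartesian_product bicomp_eq case_prod_beta)
  also have "\<dots> = gmult G (gmult G (\<lambda>x. \<Sum>\<alpha>\<in>X. 1 * e \<alpha> x) (gdelta g)) (\<lambda>x. \<Sum>\<gamma>\<in>X. 1 * e \<gamma> x) x"
    unfolding gmult_sum_left gmult_sum_right by simp
  also have "\<dots> = gdelta g x" using assms by (simp add: sum_e)
  finally show ?thesis .
qed

text \<open>Double counting of the sum of all \<chi>(k): if only the trivial character were trivial
  on \<open>K\<close>, summing over \<open>K\<close> first gives \<open>card K\<close>, while
  summing over the characters first gives \<open>card H\<close>.\<close>

lemma ex_char_trivial_on:
  assumes K: "K \<subseteq> H" "K \<noteq> H" "subgroup K G"
  shows "\<exists>\<chi>\<in>X. \<chi> \<noteq> triv \<and> (\<forall>k\<in>K. \<chi> k = 1)"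
proof (rule ccontr)
  assume neg: "\<not> ?thesis"
  have finK: "finite K" using K(1) finite_H by (rule finite_subset)
  have K1: "\<one> \<in> K" and Kc: "\<And>k. k \<in> K \<Longrightarrow> k \<in> C"
    using K(3) by (auto simp: subgroup.one_closed subgroup.mem_carrier)
  have "(\<Sum>k\<in>K. \<chi> k) = (if \<chi> = triv then of_nat (card K) else 0)" if \<chi>: "\<chi> \<in> X" for \<chi>
  proof (cases "\<chi> = triv")
    case True
    then show ?thesis using K(1) by (simp add: triv_def subset_iff)
  next
    case False
    then obtain k where k: "k \<in> K" "\<chi> k \<noteq> 1" using neg \<chi> by blast
    have "(\<Sum>h\<in>K. \<chi> h) = (\<Sum>h\<in>K. \<chi> (k \<otimes> h))"
      by (rule sum.reindex_bij_witness[where j = "\<lambda>x. inv k \<otimes> x" and i = "\<lambda>x. k \<otimes> x"])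
         (use k K(3) Kc in \<open>auto simp: subgroup.m_closed subgroup.m_inv_closed m_assoc[symmetric]\<close>)
    also have "\<dots> = (\<Sum>h\<in>K. \<chi> k * \<chi> h)"
      using k \<chi> K(1) by (intro sum.cong refl char_hom) auto
    also have "\<dots> = \<chi> k * (\<Sum>h\<in>K. \<chi> h)" by (rule sum_distrib_left[symmetric])
    finally show ?thesis using k False by simp
  qed
  then have "(\<Sum>\<chi>\<in>X. \<Sum>k\<in>K. \<chi> k) = (\<Sum>\<chi>\<in>X. if \<chi> = triv then of_nat (card K) else 0)"
    by (intro sum.cong) auto
  also have "\<dots> = of_nat (card K)" by (simp add: sum.delta)
  finally have "of_nat (card K) = (\<Sum>k\<in>K. \<Sum>\<chi>\<in>X. \<chi> k)" by (subst sum.swap) simp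
  also have "\<dots> = (\<Sum>k\<in>K. if k = \<one> then of_nat (card H) else 0)"
    using K(1) by (intro sum.cong refl sum_characters) auto
  also have "\<dots> = of_nat (card H)" using finK K1 by (simp add: sum.delta)
  finally have "card K = card H" by simp
  then show False using K(1,2) finite_H by (metis card_subset_eq)
qed

end

section \<open>Elementary abelian subgroups of rank two and their characters\<close>

locale elementary_abelian_sub = group G for G (structure) +
  fixes H :: "'a set" and q :: nat and f :: "'a \<Rightarrow> int \<times> int"
  assumes sub: "subgroup H G" and q: "prime q"
    and f: "f \<in> iso (G\<lparr>carrier := H\<rparr>) (integer_mod_group q \<times>\<times> integer_mod_group q)"
begin

lemma q0 [simp]: "q \<noteq> 0" using q by auto

lemma q1: "q > 1" using q by (rule prime_gt_1_nat)

lemma mem [simp]: "h \<in> H \<Longrightarrow> h \<in> carrier G" "\<one> \<in> H" "x \<in> H \<Longrightarrow> y \<in> H \<Longrightarrow> x \<otimes> y \<in> H"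
  using sub by (auto simp: subgroup.mem_carrier subgroup.one_closed subgroup.m_closed)

lemma bij: "bij_betw f H ({0..<int q} \<times> {0..<int q})"
  using f by (simp add: iso_def carrier_integer_mod_group)

lemma f_mult: "x \<in> H \<Longrightarrow> y \<in> H \<Longrightarrow>
    f (x \<otimes> y) = ((fst (f x) + fst (f y)) mod int q, (snd (f x) + snd (f y)) mod int q)"
  using f by (auto simp: iso_def hom_def mult_DirProd' split: prod.splits)

lemma f_range: "h \<in> H \<Longrightarrow> 0 \<le> fst (f h) \<and> fst (f h) < int q \<and> 0 \<le> snd (f h) \<and> snd (f h) < int q"
  using bij_betwE[OF bij] by (fastforce simp: mem_Times_iff)

lemma inj: "x \<in> H \<Longrightarrow> y \<in> H \<Longrightarrow> f x = f y \<Longrightarrow> x = y"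
  using bij by (auto simp: bij_betw_def inj_on_def)

text \<open>Natural number coordinates, because they serve as exponents both in the group and in the
  field.\<close>

definition ca :: "'a \<Rightarrow> nat" where "ca h = nat (fst (f h))"

definition cb :: "'a \<Rightarrow> nat" where "cb h = nat (snd (f h))"

lemma f_eq: "h \<in> H \<Longrightarrow> f h = (int (ca h), int (cb h))"
  using f_range by (auto simp: ca_def cb_def prod_eq_iff)

lemma coord_less: "h \<in> H \<Longrightarrow> ca h < q" "h \<in> H \<Longrightarrow> cb h < q"
  using f_range by (auto simp: ca_def cb_def nat_less_iff)

lemma coord_mult:
  assumes "x \<in> H" "y \<in> H"
  shows "ca (x \<otimes> y) = (ca x + ca y) mod q" "cb (x \<otimes> y) = (cb x + cb y) mod q"
proof -
  have "(int (ca (x \<otimes> y)), int (cb (x \<otimes> y))) = (int ((ca x + ca y) mod q), int ((cb x + cb y) mod q))"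
    using f_mult[OF assms] assms by (simp add: f_eq zmod_int)
  then show "ca (x \<otimes> y) = (ca x + ca y) mod q" "cb (x \<otimes> y) = (cb x + cb y) mod q" by auto
qed

lemma coord_inj: "x \<in> H \<Longrightarrow> y \<in> H \<Longrightarrow> ca x = ca y \<Longrightarrow> cb x = cb y \<Longrightarrow> x = y"
  by (intro inj) (auto simp: f_eq)

lemma coord_one: "ca \<one> = 0" "cb \<one> = 0"
proof -
  have "ca \<one> = (ca \<one> + ca \<one>) mod q" "cb \<one> = (cb \<one> + cb \<one>) mod q"
    using coord_mult[of \<one> \<one>] by auto
  then show "ca \<one> = 0" "cb \<one> = 0"
    using coord_less[of \<one>] by (auto simp: mod_if split: if_splits)
qed

lemma pow_mem [simp]: "h \<in> H \<Longrightarrow> h [^] (n::nat) \<in> H"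
  by (induction n) auto

lemma coord_pow: "h \<in> H \<Longrightarrow> ca (h [^] (n::nat)) = (n * ca h) mod q"
    "h \<in> H \<Longrightarrow> cb (h [^] (n::nat)) = (n * cb h) mod q"
  by (induction n) (auto simp: coord_one coord_mult mod_simps algebra_simps)

lemma commute: "x \<in> H \<Longrightarrow> y \<in> H \<Longrightarrow> x \<otimes> y = y \<otimes> x"
  by (rule coord_inj) (auto simp: coord_mult add.commute)

lemma exponent: "h \<in> H \<Longrightarrow> h [^] q = \<one>"
  by (rule coord_inj) (auto simp: coord_pow coord_one)

lemma card_H: "card H = q * q"
  using bij_betw_same_card[OF bij] by (simp add: card_cartesian_product)

lemma finite_H: "finite H"
  using card_H by (metis card.infinite mult_is_0 q0)

lemma ex_coord: "i < q \<Longrightarrow> j < q \<Longrightarrow> \<exists>h\<in>H. ca h = i \<and> cb h = j"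
proof -
  assume "i < q" "j < q"
  then have "(int i, int j) \<in> f ` H" using bij by (simp add: bij_betw_def)
  then obtain h where "h \<in> H" "f h = (int i, int j)" by force
  then show ?thesis by (auto simp: f_eq intro!: bexI[of _ h])
qed

text \<open>A character is a free choice of two \<open>q\<close>-th roots of unity, its values on
  the basis \<open>h1\<close>, \<open>h2\<close>. The sum over the characters therefore factors into
  two sums over roots of unity, and one of them vanishes unless both coordinates of \<open>h\<close>
  are 0.\<close>

lemma sum_all_characters:
  assumes closed: "alg_closed TYPE('k::field_char_0)" and h: "h \<in> H"
  shows "(\<Sum>\<chi>\<in>characters G H. \<chi> h) = (if h = \<one> then of_nat (card H) else (0::'k))"
proof -
  define \<mu> where "\<mu> = {z :: 'k. z ^ q = 1}"
  define F where "F t = (\<lambda>h. if h \<in> H then fst t ^ ca h * snd t ^ cb h else (0::'k))" for t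
  obtain h1 where h1: "h1 \<in> H" "ca h1 = 1" "cb h1 = 0" using ex_coord[of 1 0] q1 by auto
  obtain h2 where h2: "h2 \<in> H" "ca h2 = 0" "cb h2 = 1" using ex_coord[of 0 1] q1 by auto
  have red: "z ^ (n mod q) = z ^ n" if "z \<in> \<mu>" for z n
  proof -
    have "z ^ n = z ^ (q * (n div q) + n mod q)" by simp
    also have "\<dots> = z ^ (n mod q)" using that unfolding power_add power_mult by (simp add: \<mu>_def)
    finally show ?thesis ..
  qed
  have gen: "h = h1 [^] ca h \<otimes> h2 [^] cb h" if "h \<in> H" for h
    using that h1 h2 coord_less by (intro coord_inj) (auto simp: coord_mult coord_pow)
  have char_pow: "\<chi> (k [^] (n::nat)) = \<chi> k ^ n" if "\<chi> \<in> characters G H" "k \<in> H" for \<chi> :: "'a \<Rightarrow> 'k" and k n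
    using that by (induction n) (auto simp: characters_def)
  have "bij_betw F (\<mu> \<times> \<mu>) (characters G H)"
  proof (rule bij_betw_byWitness[where f' = "\<lambda>\<chi>. (\<chi> h1, \<chi> h2)"])
    show "\<forall>t\<in>\<mu> \<times> \<mu>. (F t h1, F t h2) = t" using h1 h2 by (auto simp: F_def)
    show "F ` (\<mu> \<times> \<mu>) \<subseteq> characters G H"
      by (auto simp: F_def characters_def coord_mult red power_add coord_one)
    show "(\<lambda>\<chi>. (\<chi> h1, \<chi> h2)) ` characters G H \<subseteq> \<mu> \<times> \<mu>"
    proof clarify
      fix \<chi> :: "'a \<Rightarrow> 'k" assume \<chi>: "\<chi> \<in> characters G H"
      then have "\<chi> \<one> = 1" by (simp add: characters_def)
      then show "\<chi> h1 \<in> \<mu> \<and> \<chi> h2 \<in> \<mu>"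
        using char_pow[OF \<chi> h1(1), of q] char_pow[OF \<chi> h2(1), of q] h1 h2 by (simp add: exponent \<mu>_def)
    qed
    show "\<forall>\<chi>\<in>characters G H. F (\<chi> h1, \<chi> h2) = \<chi>"
    proof (intro ballI ext)
      fix \<chi> :: "'a \<Rightarrow> 'k" and k assume \<chi>: "\<chi> \<in> characters G H"
      show "F (\<chi> h1, \<chi> h2) k = \<chi> k"
      proof (cases "k \<in> H")
        case True
        have "\<chi> (h1 [^] ca k \<otimes> h2 [^] cb k) = \<chi> h1 ^ ca k * \<chi> h2 ^ cb k"
          using \<chi> h1 h2 char_pow[OF \<chi>] by (simp add: characters_def)
        then show ?thesis using gen[OF True] True by (simp add: F_def)
      next
        case False
        then show ?thesis using \<chi> by (simp add: F_def characters_def)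
      qed
    qed
  qed
  then have "(\<Sum>\<chi>\<in>characters G H. \<chi> h) = (\<Sum>t\<in>\<mu>\<times>\<mu>. F t h)"
    by (rule sum.reindex_bij_betw[symmetric])
  also have "\<dots> = (\<Sum>z\<in>\<mu>. z ^ ca h) * (\<Sum>w\<in>\<mu>. w ^ cb h)"
    using h by (simp add: sum_Times F_def sum_product)
  also have "\<dots> = (if q dvd ca h then of_nat q else 0) * (if q dvd cb h then of_nat q else 0)"
    unfolding \<mu>_def using sum_roots_of_unity[OF closed q] by simp
  also have "\<dots> = (if h = \<one> then of_nat (card H) else 0)"
  proof (cases "h = \<one>")
    case True
    then show ?thesis by (simp add: coord_one card_H)
  next
    case False
    then have "ca h \<noteq> 0 \<or> cb h \<noteq> 0" using coord_inj[of h \<one>] h by (auto simp: coord_one)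
    then have "\<not> q dvd ca h \<or> \<not> q dvd cb h" using coord_less[OF h] by (auto dest: dvd_imp_le)
    then show ?thesis using False by auto
  qed
  finally show ?thesis .
qed

end

section \<open>The twisted Hopf algebra\<close>

locale twist = dual_subgroup G H X
  for G (structure) and H :: "'a set" and X :: "('a \<Rightarrow> 'k::field_char_0) set" +
  fixes \<omega> :: "('a \<Rightarrow> 'k) \<Rightarrow> ('a \<Rightarrow> 'k) \<Rightarrow> 'k"
  assumes two_cocycle: "two_cocycle G H \<omega>"
begin

lemma omega_nonzero [simp]: "\<alpha> \<in> X \<Longrightarrow> \<beta> \<in> X \<Longrightarrow> \<omega> \<alpha> \<beta> \<noteq> 0"
  using two_cocycle by (auto simp: two_cocycle_def X_def)

lemma omega_cocycle:
  "\<alpha> \<in> X \<Longrightarrow> \<beta> \<in> X \<Longrightarrow> \<gamma> \<in> X \<Longrightarrow>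
    \<omega> \<alpha> \<beta> * \<omega> (char_mult \<alpha> \<beta>) \<gamma> = \<omega> \<beta> \<gamma> * \<omega> \<alpha> (char_mult \<beta> \<gamma>)"
  using two_cocycle by (auto simp: two_cocycle_def X_def)

text \<open>Cocycles are not normalized here. The cocycle identity makes all values with a trivial
  argument equal to one constant, which cancels in quotients such as
  \<open>\<sigma>\<close>.\<close>

lemma omega_triv_right: "\<alpha> \<in> X \<Longrightarrow> \<omega> \<alpha> triv = \<omega> triv triv"
  using omega_cocycle[of \<alpha> triv triv] by simp

lemma omega_triv_left: "\<alpha> \<in> X \<Longrightarrow> \<omega> triv \<alpha> = \<omega> triv triv"
  using omega_cocycle[of triv triv \<alpha>] by simp

text \<open>The cocycle identity at (\<alpha>, \<alpha>^-1, \<alpha>). It makes the scalars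
  \<open>q\<close> introduced below symmetric under exchanging the arguments of \<omega>.\<close>

lemma omega_cinv_commute: "\<alpha> \<in> X \<Longrightarrow> \<omega> (cinv \<alpha>) \<alpha> = \<omega> \<alpha> (cinv \<alpha>)"
  using omega_cocycle[of \<alpha> "cinv \<alpha>" \<alpha>] omega_triv_left[of \<alpha>] omega_triv_right[of \<alpha>] by simp

abbreviation J :: "'a \<times> 'a \<Rightarrow> 'k" where "J \<equiv> twist_of G H \<omega>"

abbreviation Ji :: "'a \<times> 'a \<Rightarrow> 'k" where "Ji \<equiv> twist_of G H (\<lambda>\<alpha> \<beta>. inverse (\<omega> \<alpha> \<beta>))"

abbreviation \<Delta> :: "('a \<Rightarrow> 'k) \<Rightarrow> 'a \<times> 'a \<Rightarrow> 'k" where "\<Delta> \<equiv> tw_comult G J"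

lemma twist_of_expand:
  "twist_of G H w = (\<lambda>t. \<Sum>p\<in>XX. w (fst p) (snd p) * tens (e (fst p)) (e (snd p)) t)"
  by (auto simp: twist_of_def X_def sum.cartesian_product case_prod_beta)

lemma twist_of_in_galg: "twist_of G H w \<in> galg (G \<times>\<times> G)"
  by (auto simp: galg_def twist_of_def tens_def char_idem_def intro!: sum.neutral)

lemma tens_e_mult:
  assumes "p \<in> XX" "p' \<in> XX"
  shows "tmult G (tens (e (fst p)) (e (snd p))) (tens (e (fst p')) (e (snd p'))) t =
    (if p = p' then tens (e (fst p)) (e (snd p)) t else 0)"
proof -
  have "tmult G (tens (e (fst p)) (e (snd p))) (tens (e (fst p')) (e (snd p'))) t =
     gmult G (e (fst p)) (e (fst p')) (fst t) * gmult G (e (snd p)) (e (snd p')) (snd t)"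
    unfolding tmult_tens by (simp add: tens_def case_prod_beta)
  then show ?thesis
    using assms by (auto simp: e_mult_e mem_Times_iff tens_def case_prod_beta prod_eq_iff)
qed

text \<open>Tensors of character idempotents are orthogonal idempotents, so the coefficients
  multiply pointwise. In particular \<open>J\<close> is inverted by inverting the values of the
  cocycle.\<close>

lemma twist_of_mult:
  fixes w w' :: "('a \<Rightarrow> 'k) \<Rightarrow> ('a \<Rightarrow> 'k) \<Rightarrow> 'k"
  shows "tmult G (twist_of G H w) (twist_of G H w') = twist_of G H (\<lambda>\<alpha> \<beta>. w \<alpha> \<beta> * w' \<alpha> \<beta>)"
proof (rule ext)
  fix t
  have "tmult G (twist_of G H w) (twist_of G H w') t = (\<Sum>p\<in>XX. w (fst p) (snd p) *
     (\<Sum>p'\<in>XX. w' (fst p') (snd p') *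
       tmult G (tens (e (fst p)) (e (snd p))) (tens (e (fst p')) (e (snd p'))) t))"
    unfolding twist_of_expand tmult_sum_left tmult_sum_right by (rule refl)
  also have "\<dots> = (\<Sum>p\<in>XX. w (fst p) (snd p) *
     (\<Sum>p'\<in>XX. if p = p' then w' (fst p) (snd p) * tens (e (fst p)) (e (snd p)) t else 0))"
    by (intro sum.cong refl arg_cong2[where f = "(*)"]) (auto simp: tens_e_mult)
  also have "\<dots> = twist_of G H (\<lambda>\<alpha> \<beta>. w \<alpha> \<beta> * w' \<alpha> \<beta>) t"
    unfolding twist_of_expand by (intro sum.cong refl) (simp add: sum.delta')
  finally show "tmult G (twist_of G H w) (twist_of G H w') t =
    twist_of G H (\<lambda>\<alpha> \<beta>. w \<alpha> \<beta> * w' \<alpha> \<beta>) t" .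
qed

lemma twist_of_cong:
  fixes w w' :: "('a \<Rightarrow> 'k) \<Rightarrow> ('a \<Rightarrow> 'k) \<Rightarrow> 'k"
  shows "(\<And>\<alpha> \<beta>. \<alpha> \<in> X \<Longrightarrow> \<beta> \<in> X \<Longrightarrow> w \<alpha> \<beta> = w' \<alpha> \<beta>) \<Longrightarrow> twist_of G H w = twist_of G H w'"
  unfolding twist_of_expand by (intro ext sum.cong) auto

lemma twist_of_1: "twist_of G H (\<lambda>(_::'a \<Rightarrow> 'k) _. 1) = tunit G"
proof (rule ext)
  fix t :: "'a \<times> 'a"
  have "twist_of G H (\<lambda>(_::'a \<Rightarrow> 'k) _. 1) t = (\<Sum>\<alpha>\<in>X. e \<alpha> (fst t)) * (\<Sum>\<beta>\<in>X. e \<beta> (snd t))"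
    unfolding twist_of_expand
    by (simp add: sum_product sum.cartesian_product case_prod_beta tens_def)
  then show "twist_of G H (\<lambda>(_::'a \<Rightarrow> 'k) _. 1) t = tunit G t"
    by (simp add: sum_e tunit_tens tens_def case_prod_beta)
qed

lemma Ji_J: "tmult G Ji J = tunit G" and J_Ji: "tmult G J Ji = tunit G"
  unfolding twist_of_mult twist_of_1[symmetric] by (auto intro!: twist_of_cong)

lemma tinv_J: "tinv G J = Ji"
  by (rule tinv_eqI) (auto simp: Ji_J J_Ji twist_of_in_galg)

text \<open>In terms of the bigrading, passing from \<open>\<Delta>\<close> to \<open>\<Delta>\<^sup>J\<close> multiplies the component of degree \<open>(i, j)\<close> by
  \<open>\<sigma> i j\<close>, and \<open>\<sigma>\<close> is again a 2-cocycle.\<close>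

definition \<sigma> :: "('a \<Rightarrow> 'k) \<times> ('a \<Rightarrow> 'k) \<Rightarrow> ('a \<Rightarrow> 'k) \<times> ('a \<Rightarrow> 'k) \<Rightarrow> 'k" where
  "\<sigma> i j = \<omega> (snd i) (snd j) / \<omega> (fst i) (fst j)"

text \<open>The structure constants of the twisted coproduct: the coefficient of
  \<open>x \<otimes> y\<close> in the image of \<open>g\<close>. With them Sweedler calculations
  turn into finite sums.\<close>

definition D :: "'a \<Rightarrow> 'a \<Rightarrow> 'a \<Rightarrow> 'k" where
  "D g x y = (\<Sum>i\<in>XX. \<Sum>j\<in>XX. \<sigma> i j * (bicomp i g x * bicomp j g y))"

lemma tw_comult_gdelta:
  assumes "g \<in> C"
  shows "\<Delta> (gdelta g) (x, y) = D g x y"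
proof -
  have "\<Delta> (gdelta g) = tmult G (tmult G Ji (tens (gdelta g) (gdelta g))) J"
    by (simp only: tw_comult_def tinv_J gcomult_gdelta)
  then have "\<Delta> (gdelta g) (x, y) = (\<Sum>p\<in>XX. inverse (\<omega> (fst p) (snd p)) *
     (\<Sum>p'\<in>XX. \<omega> (fst p') (snd p') * tens (bicomp (fst p, fst p') g) (bicomp (snd p, snd p') g) (x, y)))"
    unfolding twist_of_expand tmult_sum_left tmult_sum_right tmult_tens
    using assms by (simp add: bicomp_eq)
  also have "\<dots> = (\<Sum>\<alpha>\<in>X. \<Sum>\<beta>\<in>X. \<Sum>\<gamma>\<in>X. \<Sum>\<delta>\<in>X.
      \<sigma> (\<alpha>, \<gamma>) (\<beta>, \<delta>) * (bicomp (\<alpha>, \<gamma>) g x * bicomp (\<beta>, \<delta>) g y))"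
    by (simp add: sum_Times case_prod_beta sum_distrib_left \<sigma>_def tens_def
        divide_inverse mult_ac)
  also have "\<dots> = (\<Sum>\<alpha>\<in>X. \<Sum>\<gamma>\<in>X. \<Sum>\<beta>\<in>X. \<Sum>\<delta>\<in>X.
      \<sigma> (\<alpha>, \<gamma>) (\<beta>, \<delta>) * (bicomp (\<alpha>, \<gamma>) g x * bicomp (\<beta>, \<delta>) g y))"
    by (intro sum.cong refl sum.swap)
  also have "\<dots> = D g x y"
    by (simp add: D_def sum_Times case_prod_beta)
  finally show ?thesis .
qed

lemma gcomult_expand: "f \<in> galg G \<Longrightarrow> gcomult f = (\<lambda>t. \<Sum>g\<in>C. f g * gcomult (gdelta g) t)"
  by (rule ext) (auto simp: gcomult_def gdelta_def galg_def if_distrib[where f = "\<lambda>c. _ * c"] sum.delta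
      cong: if_cong split: prod.split intro!: sum.neutral)

lemma tw_comult_expand:
  assumes "f \<in> galg G"
  shows "\<Delta> f (x, y) = (\<Sum>g\<in>C. f g * D g x y)"
proof -
  have "\<Delta> f (x, y) = (\<Sum>g\<in>C. f g * \<Delta> (gdelta g) (x, y))"
    unfolding tw_comult_def
    by (subst gcomult_expand[OF assms]) (simp add: tmult_sum_left tmult_sum_right)
  then show ?thesis by (simp add: tw_comult_gdelta)
qed

lemma tw_comult_gmult:
  "\<Delta> (gmult G f f') = tmult G (\<Delta> f) (\<Delta> f')"
proof -
  have "tmult G (\<Delta> f) (\<Delta> f') =
     tmult G Ji (tmult G (gcomult f) (tmult G (tmult G J Ji) (tmult G (gcomult f') J)))"
    by (simp add: tw_comult_def tinv_J tmult_assoc)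
  also have "\<dots> = \<Delta> (gmult G f f')"
    by (simp add: J_Ji tw_comult_def tinv_J tmult_assoc flip: gcomult_gmult)
  finally show ?thesis ..
qed

section \<open>Coassociativity of the twisted coproduct\<close>

lemma sum_bicomp_bicomp2:
  assumes "g \<in> C" "i \<in> XX" "j \<in> XX" "k \<in> XX"
  shows "(\<Sum>u\<in>C. bicomp k g u * (bicomp i u x * bicomp j u y)) =
    (if k = (char_mult (fst i) (fst j), char_mult (snd i) (snd j))
     then bicomp i g x * bicomp j g y else 0)"
  using assms by (intro sum_bicomp_mult) (auto simp: bicomp_translate, auto simp: char_mult_def)

text \<open>Weights are multiplicative under the coproduct, because \<open>H\<close> acts diagonally
  on g \<otimes> g; so only pairs (\<open>i\<close>, \<open>j\<close>) with product \<open>k\<close>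
  contribute.\<close>

lemma sum_bicomp_D:
  assumes "g \<in> C" "k \<in> XX"
  shows "(\<Sum>u\<in>C. bicomp k g u * D u x y) = (\<Sum>i\<in>XX. \<Sum>j\<in>XX.
     \<sigma> i j * (if k = (char_mult (fst i) (fst j), char_mult (snd i) (snd j))
     then bicomp i g x * bicomp j g y else 0))"
proof -
  have "(\<Sum>u\<in>C. bicomp k g u * D u x y) = (\<Sum>u\<in>C. \<Sum>i\<in>XX. \<Sum>j\<in>XX.
     \<sigma> i j * (bicomp k g u * (bicomp i u x * bicomp j u y)))"
    unfolding D_def sum_distrib_left by (intro sum.cong refl) (simp only: mult_ac)
  also have "\<dots> = (\<Sum>i\<in>XX. \<Sum>u\<in>C. \<Sum>j\<in>XX.
     \<sigma> i j * (bicomp k g u * (bicomp i u x * bicomp j u y)))"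
    by (rule sum.swap)
  also have "\<dots> = (\<Sum>i\<in>XX. \<Sum>j\<in>XX. \<Sum>u\<in>C.
     \<sigma> i j * (bicomp k g u * (bicomp i u x * bicomp j u y)))"
    by (intro sum.cong refl sum.swap)
  also have "\<dots> = (\<Sum>i\<in>XX. \<Sum>j\<in>XX.
     \<sigma> i j * (if k = (char_mult (fst i) (fst j), char_mult (snd i) (snd j))
     then bicomp i g x * bicomp j g y else 0))"
    using assms by (intro sum.cong refl) (simp only: sum_distrib_left[symmetric] sum_bicomp_bicomp2)
  finally show ?thesis .
qed

lemma sum_D_linear:
  "(\<Sum>u\<in>C. \<Sum>v\<in>C. D g u v * F u v) = (\<Sum>i\<in>XX. \<Sum>j\<in>XX. \<sigma> i j *
     (\<Sum>u\<in>C. \<Sum>v\<in>C. bicomp i g u * bicomp j g v * F u v))"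
proof -
  have "(\<Sum>u\<in>C. \<Sum>v\<in>C. D g u v * F u v) =
     (\<Sum>t\<in>C \<times> C. \<Sum>p\<in>XX\<times>XX. \<sigma> (fst p) (snd p) *
       (bicomp (fst p) g (fst t) * bicomp (snd p) g (snd t) * F (fst t) (snd t)))"
    by (simp add: D_def sum_Times case_prod_beta sum_distrib_right mult.assoc)
  also have "\<dots> = (\<Sum>p\<in>XX\<times>XX. \<Sum>t\<in>C \<times> C. \<sigma> (fst p) (snd p) *
       (bicomp (fst p) g (fst t) * bicomp (snd p) g (snd t) * F (fst t) (snd t)))"
    by (rule sum.swap)
  also have "\<dots> = (\<Sum>i\<in>XX. \<Sum>j\<in>XX. \<sigma> i j *
     (\<Sum>u\<in>C. \<Sum>v\<in>C. bicomp i g u * bicomp j g v * F u v))"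
    by (simp add: sum_Times case_prod_beta sum_distrib_left)
  finally show ?thesis .
qed

lemma sigma_cocycle:
  assumes "i \<in> XX" "j \<in> XX" "k \<in> XX"
  shows "\<sigma> i j * \<sigma> (char_mult (fst i) (fst j), char_mult (snd i) (snd j)) k =
    \<sigma> j k * \<sigma> i (char_mult (fst j) (fst k), char_mult (snd j) (snd k))"
  using assms omega_cocycle[of "fst i" "fst j" "fst k"] omega_cocycle[of "snd i" "snd j" "snd k"]
  by (auto simp: \<sigma>_def)

lemma sum_product_index:
  fixes F :: "_ \<Rightarrow> _ \<Rightarrow> _ \<Rightarrow> 'k"
  shows "(\<Sum>k\<in>XX. \<Sum>i\<in>XX. \<Sum>j\<in>XX. if k = (char_mult (fst i) (fst j), char_mult (snd i) (snd j)) then F k i j else 0) =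
    (\<Sum>i\<in>XX. \<Sum>j\<in>XX. F (char_mult (fst i) (fst j), char_mult (snd i) (snd j)) i j)" (is "?L = _")
proof -
  let ?m = "\<lambda>i j. (char_mult (fst i) (fst j), char_mult (snd i) (snd j))"
  have "?L = (\<Sum>i\<in>XX. \<Sum>k\<in>XX. \<Sum>j\<in>XX. if k = ?m i j then F k i j else 0)"
    by (rule sum.swap)
  also have "\<dots> = (\<Sum>i\<in>XX. \<Sum>j\<in>XX. \<Sum>k\<in>XX. if k = ?m i j then F k i j else 0)"
    by (intro sum.cong refl sum.swap)
  also have "\<dots> = (\<Sum>i\<in>XX. \<Sum>j\<in>XX. F (?m i j) i j)"
    by (intro sum.cong refl) (auto simp: sum.delta)
  finally show ?thesis .
qed

text \<open>After expansion in weights both sides are sums of triple tensors of components of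
  \<open>g\<close>, with products of two values of \<sigma> as coefficients. These agree by the
  cocycle identity for \<sigma>.\<close>

lemma D_coassoc:
  assumes g: "g \<in> C"
  shows "(\<Sum>u\<in>C. D g u z * D u x y) = (\<Sum>u\<in>C. D g x u * D u y z)"
proof -
  let ?m = "\<lambda>i j. (char_mult (fst i) (fst j), char_mult (snd i) (snd j))"
  let ?b = "\<lambda>i x. bicomp i g x"
  have step: "(\<Sum>k\<in>XX. c k * (\<Sum>u\<in>C. ?b k u * D u x y)) =
      (\<Sum>i\<in>XX. \<Sum>j\<in>XX. c (?m i j) * \<sigma> i j * (?b i x * ?b j y))" for c x y
  proof -
    have "(\<Sum>k\<in>XX. c k * (\<Sum>u\<in>C. ?b k u * D u x y)) = (\<Sum>k\<in>XX. \<Sum>i\<in>XX. \<Sum>j\<in>XX.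
        if k = ?m i j then c k * \<sigma> i j * (?b i x * ?b j y) else 0)"
      using g by (intro sum.cong refl) (simp only: sum_bicomp_D, simp only: sum_distrib_left,
          intro sum.cong refl, simp)
    then show ?thesis by (simp only: sum_product_index)
  qed
  have "(\<Sum>u\<in>C. D g u z * D u x y) = (\<Sum>u\<in>C. \<Sum>l\<in>XX. \<Sum>k\<in>XX. ?b l z * (\<sigma> k l * (?b k u * D u x y)))"
    unfolding D_def[of g] sum_distrib_right
    by (subst sum.swap) (intro sum.cong refl, simp only: mult_ac)
  also have "\<dots> = (\<Sum>l\<in>XX. \<Sum>u\<in>C. \<Sum>k\<in>XX. ?b l z * (\<sigma> k l * (?b k u * D u x y)))"
    by (rule sum.swap)
  also have "\<dots> = (\<Sum>l\<in>XX. \<Sum>k\<in>XX. \<Sum>u\<in>C. ?b l z * (\<sigma> k l * (?b k u * D u x y)))"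
    by (intro sum.cong refl sum.swap)
  also have "\<dots> = (\<Sum>l\<in>XX. ?b l z * (\<Sum>i\<in>XX. \<Sum>j\<in>XX. \<sigma> (?m i j) l * \<sigma> i j * (?b i x * ?b j y)))"
    by (simp only: sum_distrib_left[symmetric] step)
  also have "\<dots> = (\<Sum>l\<in>XX. \<Sum>i\<in>XX. \<Sum>j\<in>XX. ?b i x * (\<sigma> i (?m j l) * \<sigma> j l * (?b j y * ?b l z)))"
    unfolding sum_distrib_left
  proof (intro sum.cong refl)
    fix l i j assume "l \<in> XX" "i \<in> XX" "j \<in> XX"
    then show "?b l z * (\<sigma> (?m i j) l * \<sigma> i j * (?b i x * ?b j y)) =
        ?b i x * (\<sigma> i (?m j l) * \<sigma> j l * (?b j y * ?b l z))"
      using sigma_cocycle[of i j l] by (simp add: mult_ac)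
  qed
  also have "\<dots> = (\<Sum>i\<in>XX. \<Sum>l\<in>XX. \<Sum>j\<in>XX. ?b i x * (\<sigma> i (?m j l) * \<sigma> j l * (?b j y * ?b l z)))"
    by (rule sum.swap)
  also have "\<dots> = (\<Sum>i\<in>XX. \<Sum>j\<in>XX. \<Sum>l\<in>XX. ?b i x * (\<sigma> i (?m j l) * \<sigma> j l * (?b j y * ?b l z)))"
    by (intro sum.cong refl sum.swap)
  also have "\<dots> = (\<Sum>i\<in>XX. \<Sum>k\<in>XX. \<Sum>u\<in>C. ?b i x * (\<sigma> i k * (?b k u * D u y z)))"
    by (simp only: sum_distrib_left[symmetric] step)
  also have "\<dots> = (\<Sum>i\<in>XX. \<Sum>u\<in>C. \<Sum>k\<in>XX. ?b i x * (\<sigma> i k * (?b k u * D u y z)))"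
    by (intro sum.cong refl sum.swap)
  also have "\<dots> = (\<Sum>u\<in>C. \<Sum>i\<in>XX. \<Sum>k\<in>XX. ?b i x * (\<sigma> i k * (?b k u * D u y z)))"
    by (rule sum.swap)
  also have "\<dots> = (\<Sum>u\<in>C. D g x u * D u y z)"
    unfolding D_def[of g] sum_distrib_right by (intro sum.cong refl) (simp only: mult_ac)
  finally show ?thesis .
qed

section \<open>Characters of the group applied to one leg of the coproduct\<close>

lemma sum_bicomp_char:
  assumes "g \<in> C" "i \<in> XX" "\<chi> \<in> X" "\<And>h. h \<in> H \<Longrightarrow> \<chi> h = \<beta> h"
    and "\<And>x y. x \<in> C \<Longrightarrow> y \<in> C \<Longrightarrow> \<beta> (x \<otimes> y) = \<beta> x * \<beta> y"
  shows "(\<Sum>u\<in>C. bicomp i g u * \<beta> u) = (if i = (\<chi>, \<chi>) then \<beta> g else 0)"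
  using assms by (intro sum_bicomp_mult) auto

text \<open>A character of the whole group sees only the weight (\<chi>, \<chi>), which removes the
  sum over \<open>j\<close>. The coefficients \<open>s\<close> are arbitrary so that one computation
  serves both legs: the left one uses \<sigma> with its arguments exchanged.\<close>

lemma sum_bilinear_char:
  assumes "g \<in> C" "\<chi> \<in> X" "\<And>h. h \<in> H \<Longrightarrow> \<chi> h = \<beta> h"
    and "\<And>x y. x \<in> C \<Longrightarrow> y \<in> C \<Longrightarrow> \<beta> (x \<otimes> y) = \<beta> x * \<beta> y"
  shows "(\<Sum>y\<in>C. (\<Sum>i\<in>XX. \<Sum>j\<in>XX. s i j * (bicomp i g x * bicomp j g y)) * \<beta> y) =
    (\<Sum>i\<in>XX. s i (\<chi>, \<chi>) * bicomp i g x) * \<beta> g"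
proof -
  have "(\<Sum>y\<in>C. (\<Sum>i\<in>XX. \<Sum>j\<in>XX. s i j * (bicomp i g x * bicomp j g y)) * \<beta> y) =
      (\<Sum>y\<in>C. \<Sum>i\<in>XX. \<Sum>j\<in>XX. s i j * bicomp i g x * (bicomp j g y * \<beta> y))"
    by (simp add: sum_distrib_right mult.assoc)
  also have "\<dots> = (\<Sum>i\<in>XX. \<Sum>y\<in>C. \<Sum>j\<in>XX. s i j * bicomp i g x * (bicomp j g y * \<beta> y))"
    by (rule sum.swap)
  also have "\<dots> = (\<Sum>i\<in>XX. \<Sum>j\<in>XX. \<Sum>y\<in>C. s i j * bicomp i g x * (bicomp j g y * \<beta> y))"
    by (intro sum.cong refl sum.swap)
  also have "\<dots> = (\<Sum>i\<in>XX. \<Sum>j\<in>XX. if j = (\<chi>, \<chi>) then s i j * bicomp i g x * \<beta> g else 0)"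
    unfolding sum_distrib_left[symmetric]
    by (intro sum.cong refl, subst sum_bicomp_char[where \<chi> = \<chi>]) (use assms in auto)
  also have "\<dots> = (\<Sum>i\<in>XX. s i (\<chi>, \<chi>) * bicomp i g x) * \<beta> g"
    unfolding sum_distrib_right using assms by (intro sum.cong refl) (simp add: sum.delta)
  finally show ?thesis .
qed

lemmas sum_D_char_right = sum_bilinear_char[where s = \<sigma>, folded D_def]

lemma sum_D_char_left:
  assumes "g \<in> C" "\<chi> \<in> X" "\<And>h. h \<in> H \<Longrightarrow> \<chi> h = \<beta> h"
    and "\<And>x y. x \<in> C \<Longrightarrow> y \<in> C \<Longrightarrow> \<beta> (x \<otimes> y) = \<beta> x * \<beta> y"
  shows "(\<Sum>x\<in>C. D g x y * \<beta> x) = (\<Sum>i\<in>XX. \<sigma> (\<chi>, \<chi>) i * bicomp i g y) * \<beta> g"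
proof -
  have "D g x y = (\<Sum>i\<in>XX. \<Sum>j\<in>XX. \<sigma> j i * (bicomp i g y * bicomp j g x))" for x
    unfolding D_def by (subst sum.swap) (simp add: mult.commute)
  then show ?thesis using sum_bilinear_char[OF assms, of "\<lambda>i j. \<sigma> j i"] by simp
qed

lemma triv_on_H: "h \<in> H \<Longrightarrow> triv h = 1"
  by (simp add: triv_def)

lemma sigma_triv: "i \<in> XX \<Longrightarrow> \<sigma> i (triv, triv) = 1" "i \<in> XX \<Longrightarrow> \<sigma> (triv, triv) i = 1"
  using omega_triv_left[of "fst i"] omega_triv_left[of "snd i"]
    omega_triv_right[of "fst i"] omega_triv_right[of "snd i"] by (auto simp: \<sigma>_def)

lemma D_counit_right:
  assumes "g \<in> C" shows "(\<Sum>y\<in>C. D g x y) = gdelta g x"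
  using sum_D_char_right[of g triv "\<lambda>_. 1" x] assms
  by (simp add: sigma_triv sum_all_bicomp triv_on_H)

lemma D_counit_left:
  assumes "g \<in> C" shows "(\<Sum>x\<in>C. D g x y) = gdelta g y"
  using sum_D_char_left[of g triv "\<lambda>_. 1" y] assms
  by (simp add: sigma_triv sum_all_bicomp triv_on_H)

section \<open>The twisted antipode\<close>

definition q :: "('a \<Rightarrow> 'k) \<Rightarrow> 'k" where "q \<alpha> = \<omega> \<alpha> (cinv \<alpha>)"

lemma q_nonzero [simp]: "\<alpha> \<in> X \<Longrightarrow> q \<alpha> \<noteq> 0"
  by (simp add: q_def)

lemma sum_cinv: "(\<Sum>\<alpha>\<in>X. f (cinv \<alpha>)) = (\<Sum>\<alpha>\<in>X. f \<alpha>)"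
  by (rule sum.reindex_bij_witness[where i = cinv and j = cinv]) auto

lemma gmult_zero [simp]: "gmult G (\<lambda>_. 0) f = (\<lambda>_. 0)" "gmult G f (\<lambda>_. 0) = (\<lambda>_. 0)"
  by (auto simp: gmult_def)

lemma sum_gmult_e: "f \<in> galg G \<Longrightarrow> (\<Sum>\<alpha>\<in>X. gmult G f' (gmult G (e \<alpha>) f) x) = gmult G f' f x"
proof -
  assume f: "f \<in> galg G"
  have "(\<Sum>\<alpha>\<in>X. gmult G f' (gmult G (e \<alpha>) f) x) = gmult G f' (gmult G (\<lambda>x. \<Sum>\<alpha>\<in>X. 1 * e \<alpha> x) f) x"
    unfolding gmult_sum_left gmult_sum_right by simp
  then show ?thesis using f by (simp add: sum_e)
qed

lemma bicomp_mult_bicomp: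
  assumes "g \<in> C" "g' \<in> C" "\<alpha> \<in> X" "\<beta> \<in> X" "\<gamma> \<in> X" "\<delta> \<in> X"
  shows "gmult G (bicomp (\<gamma>, \<alpha>) g') (bicomp (\<beta>, \<delta>) g) = (if \<alpha> = \<beta>
    then gmult G (gmult G (e \<gamma>) (gdelta g')) (gmult G (e \<beta>) (gmult G (gdelta g) (e \<delta>))) else (\<lambda>_. 0))"
proof -
  have "gmult G (bicomp (\<gamma>, \<alpha>) g') (bicomp (\<beta>, \<delta>) g) = gmult G (gmult G (e \<gamma>) (gdelta g'))
      (gmult G (gmult G (e \<alpha>) (e \<beta>)) (gmult G (gdelta g) (e \<delta>)))"
    using assms by (simp add: bicomp_eq gmult_assoc)
  then show ?thesis using assms by (simp add: e_mult_e)
qed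

lemma sum_sandwich:
  assumes "g \<in> C" "g' \<in> C" "g' \<otimes> g = \<one>"
  shows "(\<Sum>\<beta>\<in>X. gmult G (gmult G (e \<gamma>) (gdelta g')) (gmult G (e \<beta>) (gmult G (gdelta g) (e \<delta>))) x)
    = gmult G (e \<gamma>) (e \<delta>) x"
proof -
  have "(\<Sum>\<beta>\<in>X. gmult G (gmult G (e \<gamma>) (gdelta g')) (gmult G (e \<beta>) (gmult G (gdelta g) (e \<delta>))) x)
     = gmult G (e \<gamma>) (gmult G (gmult G (gdelta g') (gdelta g)) (e \<delta>)) x"
    by (subst sum_gmult_e) (simp_all add: gmult_assoc)
  also have "\<dots> = gmult G (e \<gamma>) (e \<delta>) x"
    using assms by (simp add: gmult_gdelta_gdelta gunit_def[symmetric])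
  finally show ?thesis .
qed

definition star :: "('a \<Rightarrow> 'k) \<times> ('a \<Rightarrow> 'k) \<Rightarrow> ('a \<Rightarrow> 'k) \<times> ('a \<Rightarrow> 'k)" where
  "star i = (cinv (snd i), cinv (fst i))"

text \<open>The element u, the sum of all q(\<alpha>) \<open>e \<alpha>\<close>, arises from
  \<open>J\<close> by applying the untwisted antipode to the second leg and multiplying the legs.
  The twisted antipode is the untwisted one conjugated by u, and \<open>\<tau> i\<close> is the
  scalar that this produces in weight \<open>i\<close>.\<close>

definition \<tau> :: "('a \<Rightarrow> 'k) \<times> ('a \<Rightarrow> 'k) \<Rightarrow> 'k" where
  "\<tau> i = q (fst i) / q (snd i)"

text \<open>Orthogonality in the middle forces \<beta> = \<alpha>^-1, where \<open>w\<close> gives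
  \<open>q \<alpha>\<close> and cancels against \<tau>. Then the idempotents between g^-1 and g sum
  to the unit, and orthogonality once more leaves \<delta> = \<gamma>^-1. Only values of
  \<open>w\<close> at inverse pairs enter, so a general \<open>w\<close> covers both \<omega> and
  its opposite.\<close>

lemma antipode_core_left:
  fixes w :: "('a \<Rightarrow> 'k) \<Rightarrow> ('a \<Rightarrow> 'k) \<Rightarrow> 'k"
  assumes g: "g \<in> C" and w: "\<And>\<alpha>. \<alpha> \<in> X \<Longrightarrow> w \<alpha> (cinv \<alpha>) = q \<alpha>"
  shows "(\<Sum>i\<in>XX. \<Sum>j\<in>XX. w (snd i) (snd j) / w (fst i) (fst j) *
    (\<tau> i * gmult G (bicomp (star i) (inv g)) (bicomp j g) x)) = gunit G x"
proof -
  define P where "P \<gamma> \<beta> \<delta> = gmult G (gmult G (e (cinv \<gamma>)) (gdelta (inv g)))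
     (gmult G (e \<beta>) (gmult G (gdelta g) (e \<delta>))) x" for \<gamma> \<beta> \<delta>
  have "(\<Sum>i\<in>XX. \<Sum>j\<in>XX. w (snd i) (snd j) / w (fst i) (fst j) *
      (\<tau> i * gmult G (bicomp (star i) (inv g)) (bicomp j g) x)) =
    (\<Sum>\<alpha>\<in>X. \<Sum>\<gamma>\<in>X. \<Sum>\<beta>\<in>X. \<Sum>\<delta>\<in>X. if \<beta> = cinv \<alpha> then w \<gamma> \<delta> / q \<gamma> * P \<gamma> (cinv \<alpha>) \<delta> else 0)"
    unfolding sum_Times using g w
    by (intro sum.cong refl) (auto simp: star_def \<tau>_def bicomp_mult_bicomp P_def)
  also have "\<dots> = (\<Sum>\<alpha>\<in>X. \<Sum>\<gamma>\<in>X. \<Sum>\<delta>\<in>X. \<Sum>\<beta>\<in>X. if \<beta> = cinv \<alpha> then w \<gamma> \<delta> / q \<gamma> * P \<gamma> (cinv \<alpha>) \<delta> else 0)"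
    by (intro sum.cong refl sum.swap)
  also have "\<dots> = (\<Sum>\<alpha>\<in>X. \<Sum>\<gamma>\<in>X. \<Sum>\<delta>\<in>X. w \<gamma> \<delta> / q \<gamma> * P \<gamma> (cinv \<alpha>) \<delta>)"
    by (intro sum.cong refl) (simp add: sum.delta)
  also have "\<dots> = (\<Sum>\<alpha>\<in>X. \<Sum>\<gamma>\<in>X. \<Sum>\<delta>\<in>X. w \<gamma> \<delta> / q \<gamma> * P \<gamma> \<alpha> \<delta>)"
    by (rule sum_cinv)
  also have "\<dots> = (\<Sum>\<gamma>\<in>X. \<Sum>\<alpha>\<in>X. \<Sum>\<delta>\<in>X. w \<gamma> \<delta> / q \<gamma> * P \<gamma> \<alpha> \<delta>)"
    by (rule sum.swap)
  also have "\<dots> = (\<Sum>\<gamma>\<in>X. \<Sum>\<delta>\<in>X. \<Sum>\<alpha>\<in>X. w \<gamma> \<delta> / q \<gamma> * P \<gamma> \<alpha> \<delta>)"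
    by (intro sum.cong refl sum.swap)
  also have "\<dots> = (\<Sum>\<gamma>\<in>X. \<Sum>\<delta>\<in>X. w \<gamma> \<delta> / q \<gamma> * gmult G (e (cinv \<gamma>)) (e \<delta>) x)"
    unfolding P_def sum_distrib_left[symmetric] using g
    by (intro sum.cong refl) (simp add: sum_sandwich)
  also have "\<dots> = (\<Sum>\<gamma>\<in>X. \<Sum>\<delta>\<in>X. if \<delta> = cinv \<gamma> then e (cinv \<gamma>) x else 0)"
    using w by (intro sum.cong refl) (auto simp: e_mult_e)
  also have "\<dots> = (\<Sum>\<gamma>\<in>X. e (cinv \<gamma>) x)"
    by (intro sum.cong refl) (simp add: sum.delta)
  also have "\<dots> = (\<Sum>\<gamma>\<in>X. e \<gamma> x)" by (rule sum_cinv)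
  finally show ?thesis by (simp add: sum_e)
qed

lemma antipode_core_right:
  fixes w :: "('a \<Rightarrow> 'k) \<Rightarrow> ('a \<Rightarrow> 'k) \<Rightarrow> 'k"
  assumes g: "g \<in> C" and w: "\<And>\<alpha>. \<alpha> \<in> X \<Longrightarrow> w (cinv \<alpha>) \<alpha> = q \<alpha>"
  shows "(\<Sum>i\<in>XX. \<Sum>j\<in>XX. w (snd i) (snd j) / w (fst i) (fst j) *
    (\<tau> j * gmult G (bicomp i g) (bicomp (star j) (inv g)) x)) = gunit G x"
proof -
  define P where "P \<alpha> \<delta> \<beta> = gmult G (gmult G (e \<alpha>) (gdelta g))
     (gmult G (e \<delta>) (gmult G (gdelta (inv g)) (e (cinv \<beta>)))) x" for \<alpha> \<delta> \<beta>
  have "(\<Sum>i\<in>XX. \<Sum>j\<in>XX. w (snd i) (snd j) / w (fst i) (fst j) *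
      (\<tau> j * gmult G (bicomp i g) (bicomp (star j) (inv g)) x)) =
    (\<Sum>\<alpha>\<in>X. \<Sum>\<gamma>\<in>X. \<Sum>\<beta>\<in>X. \<Sum>\<delta>\<in>X. if \<gamma> = cinv \<delta> then q \<beta> / w \<alpha> \<beta> * P \<alpha> (cinv \<delta>) \<beta> else 0)"
    unfolding sum_Times using g w
    by (intro sum.cong refl) (auto simp: star_def \<tau>_def bicomp_mult_bicomp P_def)
  also have "\<dots> = (\<Sum>\<alpha>\<in>X. \<Sum>\<beta>\<in>X. \<Sum>\<gamma>\<in>X. \<Sum>\<delta>\<in>X. if \<gamma> = cinv \<delta> then q \<beta> / w \<alpha> \<beta> * P \<alpha> (cinv \<delta>) \<beta> else 0)"
    by (intro sum.cong refl sum.swap)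
  also have "\<dots> = (\<Sum>\<alpha>\<in>X. \<Sum>\<beta>\<in>X. \<Sum>\<delta>\<in>X. \<Sum>\<gamma>\<in>X. if \<gamma> = cinv \<delta> then q \<beta> / w \<alpha> \<beta> * P \<alpha> (cinv \<delta>) \<beta> else 0)"
    by (intro sum.cong refl sum.swap)
  also have "\<dots> = (\<Sum>\<alpha>\<in>X. \<Sum>\<beta>\<in>X. \<Sum>\<delta>\<in>X. q \<beta> / w \<alpha> \<beta> * P \<alpha> (cinv \<delta>) \<beta>)"
    by (intro sum.cong refl) (simp add: sum.delta)
  also have "\<dots> = (\<Sum>\<alpha>\<in>X. \<Sum>\<beta>\<in>X. \<Sum>\<delta>\<in>X. q \<beta> / w \<alpha> \<beta> * P \<alpha> \<delta> \<beta>)"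
    by (intro sum.cong refl sum_cinv)
  also have "\<dots> = (\<Sum>\<alpha>\<in>X. \<Sum>\<beta>\<in>X. q \<beta> / w \<alpha> \<beta> * gmult G (e \<alpha>) (e (cinv \<beta>)) x)"
    unfolding P_def sum_distrib_left[symmetric] using g
    by (intro sum.cong refl) (simp add: sum_sandwich)
  also have "\<dots> = (\<Sum>\<alpha>\<in>X. \<Sum>\<beta>\<in>X. if \<alpha> = cinv \<beta> then e (cinv \<beta>) x else 0)"
    using w by (intro sum.cong refl) (auto simp: e_mult_e)
  also have "\<dots> = (\<Sum>\<beta>\<in>X. \<Sum>\<alpha>\<in>X. if \<alpha> = cinv \<beta> then e (cinv \<beta>) x else 0)"
    by (rule sum.swap)
  also have "\<dots> = (\<Sum>\<beta>\<in>X. e (cinv \<beta>) x)"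
    by (intro sum.cong refl) (simp add: sum.delta)
  also have "\<dots> = (\<Sum>\<beta>\<in>X. e \<beta> x)" by (rule sum_cinv)
  finally show ?thesis by (simp add: sum_e)
qed

text \<open>\<open>S(e\<^sub>\<alpha> g e\<^sub>\<gamma>) = (q \<alpha> / q \<gamma>) e\<^sub>\<gamma>\<^sub>' g\<inverse> e\<^sub>\<alpha>\<^sub>'\<close> with \<open>\<alpha>' = cinv \<alpha>\<close>, \<open>\<gamma>' = cinv \<gamma>\<close>.\<close>

definition anti :: "'a \<Rightarrow> 'a \<Rightarrow> 'k" where
  "anti g = (\<lambda>x. if g \<in> C then (\<Sum>i\<in>XX. \<tau> i * bicomp (star i) (inv g) x) else 0)"

lemma anti_in_galg [simp]: "anti g \<in> galg G"
  using bicomp_in_galg[of "inv g"] by (auto simp: anti_def galg_def intro!: sum.neutral)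

lemma anti_outside: "g \<notin> C \<Longrightarrow> anti g = (\<lambda>_. 0)"
  by (simp add: anti_def)

lemma sum_bicomp_anti:
  assumes g: "g \<in> C" and i: "i \<in> XX"
  shows "(\<Sum>u\<in>C. bicomp i g u * anti u x) = \<tau> i * bicomp (star i) (inv g) x"
proof -
  have "(\<Sum>u\<in>C. bicomp i g u * anti u x) =
     (\<Sum>u\<in>C. \<Sum>j\<in>XX. \<tau> j * (bicomp i g u * bicomp (star j) (inv u) x))"
    unfolding anti_def by (intro sum.cong refl) (simp add: sum_distrib_left mult_ac)
  also have "\<dots> = (\<Sum>j\<in>XX. \<Sum>u\<in>C. \<tau> j * (bicomp i g u * bicomp (star j) (inv u) x))"
    by (rule sum.swap)
  also have "\<dots> = (\<Sum>j\<in>XX. if j = i then \<tau> i * bicomp (star i) (inv g) x else 0)"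
    unfolding sum_distrib_left[symmetric]
  proof (intro sum.cong refl)
    fix j assume j: "j \<in> XX"
    have "(\<Sum>u\<in>C. bicomp i g u * bicomp (star j) (inv u) x) =
       (if i = (fst j, snd j) then bicomp (star j) (inv g) x else 0)"
    proof (rule sum_bicomp_mult[OF g i])
      fix h k assume hk: "h \<in> H" "k \<in> H"
      have "inv (h \<otimes> g \<otimes> k) = inv k \<otimes> inv g \<otimes> inv h"
        using g hk by (simp add: inv_mult_group m_assoc)
      then have "bicomp (star j) (inv (h \<otimes> g \<otimes> k)) x =
          fst (star j) (inv k) * snd (star j) (inv h) * bicomp (star j) (inv g) x"
        using g hk j by (simp only:) (rule bicomp_translate, auto simp: star_def)
      then show "bicomp (star j) (inv (h \<otimes> g \<otimes> k)) x = fst j h * snd j k * bicomp (star j) (inv g) x"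
        using hk j by (auto simp: star_def cinv_def char_inv)
    qed (use j in auto)
    then show "\<tau> j * (\<Sum>u\<in>C. bicomp i g u * bicomp (star j) (inv u) x) =
       (if j = i then \<tau> i * bicomp (star i) (inv g) x else 0)" by auto
  qed
  also have "\<dots> = \<tau> i * bicomp (star i) (inv g) x"
    using i by (simp add: sum.delta)
  finally show ?thesis .
qed

lemma sum_bicomp_gdelta: "g \<in> C \<Longrightarrow> (\<Sum>u\<in>C. bicomp i g u * gdelta u x) = bicomp i g x"
  using galg_expand[of "bicomp i g"] by (metis bicomp_in_galg)

lemma sum_sum_gmult:
  "(\<Sum>u\<in>C. \<Sum>v\<in>C. a u * b v * gmult G (F u) (K v) x) =
    gmult G (\<lambda>x. \<Sum>u\<in>C. a u * F u x) (\<lambda>x. \<Sum>v\<in>C. b v * K v x) x"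
  unfolding gmult_sum_left gmult_sum_right by (simp add: sum_distrib_left mult.assoc)

lemma D_anti_left:
  assumes g: "g \<in> C"
  shows "(\<Sum>u\<in>C. \<Sum>v\<in>C. D g u v * gmult G (anti u) (gdelta v) x) = gunit G x"
proof -
  have "(\<Sum>u\<in>C. \<Sum>v\<in>C. D g u v * gmult G (anti u) (gdelta v) x) =
    (\<Sum>i\<in>XX. \<Sum>j\<in>XX. \<sigma> i j * (\<tau> i * gmult G (bicomp (star i) (inv g)) (bicomp j g) x))"
    unfolding sum_D_linear sum_sum_gmult using g
    by (intro sum.cong refl) (simp only: sum_bicomp_anti sum_bicomp_gdelta gmult_scale_left)
  also have "\<dots> = gunit G x"
    unfolding \<sigma>_def using g by (rule antipode_core_left) (simp add: q_def)
  finally show ?thesis .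
qed

lemma D_anti_right:
  assumes g: "g \<in> C"
  shows "(\<Sum>u\<in>C. \<Sum>v\<in>C. D g u v * gmult G (gdelta u) (anti v) x) = gunit G x"
proof -
  have "(\<Sum>u\<in>C. \<Sum>v\<in>C. D g u v * gmult G (gdelta u) (anti v) x) =
    (\<Sum>i\<in>XX. \<Sum>j\<in>XX. \<sigma> i j * (\<tau> j * gmult G (bicomp i g) (bicomp (star j) (inv g)) x))"
    unfolding sum_D_linear sum_sum_gmult using g
    by (intro sum.cong refl) (simp only: sum_bicomp_anti sum_bicomp_gdelta gmult_scale_right)
  also have "\<dots> = gunit G x"
    unfolding \<sigma>_def using g by (rule antipode_core_right) (simp_all add: q_def omega_cinv_commute)
  finally show ?thesis .
qed

text \<open>Equivalent to the antipode being involutive. It holds because \<open>q\<close> does not change when \<open>\<omega>\<close> is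
  replaced by its opposite.\<close>

lemma D_anti_op:
  assumes g: "g \<in> C"
  shows "(\<Sum>u\<in>C. \<Sum>v\<in>C. D g u v * gmult G (anti v) (gdelta u) x) = gunit G x"
proof -
  have *: "(\<Sum>u\<in>C. \<Sum>v\<in>C. a u * b v * gmult G (F v) (K u) x) =
    gmult G (\<lambda>x. \<Sum>v\<in>C. b v * F v x) (\<lambda>x. \<Sum>u\<in>C. a u * K u x) x"
    for a b :: "'a \<Rightarrow> 'k" and F K
    unfolding sum_sum_gmult[symmetric] by (subst sum.swap) (simp add: mult_ac)
  have "(\<Sum>u\<in>C. \<Sum>v\<in>C. D g u v * gmult G (anti v) (gdelta u) x) =
    (\<Sum>j\<in>XX. \<Sum>i\<in>XX. \<sigma> j i * (\<tau> i * gmult G (bicomp (star i) (inv g)) (bicomp j g) x))"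
    unfolding sum_D_linear * using g
    by (intro sum.cong refl) (simp only: sum_bicomp_anti sum_bicomp_gdelta gmult_scale_left)
  also have "\<dots> = (\<Sum>i\<in>XX. \<Sum>j\<in>XX. \<sigma> j i *
      (\<tau> i * gmult G (bicomp (star i) (inv g)) (bicomp j g) x))"
    by (rule sum.swap)
  also have "\<dots> = gunit G x"
    unfolding \<sigma>_def using g antipode_core_left[of g "\<lambda>\<alpha> \<beta>. \<omega> \<beta> \<alpha>" x]
    by (simp add: q_def omega_cinv_commute)
  finally show ?thesis .
qed

lemma star_eq_triv: "star i = (triv, triv) \<longleftrightarrow> i = (triv, triv)"
proof
  assume "star i = (triv, triv)"
  then have "cinv (cinv (snd i)) = cinv triv" "cinv (cinv (fst i)) = cinv triv"
    by (simp_all only: star_def prod.inject)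
  then show "i = (triv, triv)" by (simp add: prod_eq_iff)
qed (simp add: star_def)

lemma gcounit_anti:
  assumes g: "g \<in> C"
  shows "gcounit G (anti g) = 1"
proof -
  have "gcounit G (anti g) = (\<Sum>x\<in>C. \<Sum>i\<in>XX. \<tau> i * bicomp (star i) (inv g) x)"
    using g by (simp add: gcounit_def anti_def)
  also have "\<dots> = (\<Sum>i\<in>XX. \<Sum>x\<in>C. \<tau> i * bicomp (star i) (inv g) x)"
    by (rule sum.swap)
  also have "\<dots> = (\<Sum>i\<in>XX. \<tau> i * (if star i = (triv, triv) then 1 else 0))"
    using sum_bicomp_char[of "inv g" _ triv "\<lambda>_. 1"] g
    by (intro sum.cong refl) (auto simp: sum_distrib_left[symmetric] triv_on_H star_def mem_Times_iff)
  also have "\<dots> = (\<Sum>i\<in>XX. if i = (triv, triv) then \<tau> i else 0)"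
    by (intro sum.cong refl) (simp add: star_eq_triv)
  also have "\<dots> = \<tau> (triv, triv)" by (simp add: sum.delta)
  finally show ?thesis by (simp add: \<tau>_def)
qed

text \<open>Coassociativity tested against an arbitrary function of three legs; this is the form in
  which Sweedler indices get regrouped.\<close>

lemma D_coassoc_sum:
  assumes g: "g \<in> C"
  shows "(\<Sum>u\<in>C. \<Sum>v\<in>C. D g u v * (\<Sum>a\<in>C. \<Sum>b\<in>C. D v a b * F u a b)) =
    (\<Sum>v\<in>C. \<Sum>b\<in>C. D g v b * (\<Sum>u\<in>C. \<Sum>a\<in>C. D v u a * F u a b))"
proof -
  have "(\<Sum>u\<in>C. \<Sum>v\<in>C. D g u v * (\<Sum>a\<in>C. \<Sum>b\<in>C. D v a b * F u a b)) =
     (\<Sum>u\<in>C. \<Sum>v\<in>C. \<Sum>t\<in>C\<times>C. D g u v * D v (fst t) (snd t) * F u (fst t) (snd t))"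
    by (simp add: sum_Times sum_distrib_left mult.assoc)
  also have "\<dots> = (\<Sum>u\<in>C. \<Sum>t\<in>C\<times>C. \<Sum>v\<in>C. D g u v * D v (fst t) (snd t) * F u (fst t) (snd t))"
    by (intro sum.cong refl sum.swap)
  also have "\<dots> = (\<Sum>u\<in>C. \<Sum>t\<in>C\<times>C. \<Sum>v\<in>C. D g v (snd t) * D v u (fst t) * F u (fst t) (snd t))"
    unfolding sum_distrib_right[symmetric] using g by (simp only: D_coassoc)
  also have "\<dots> = (\<Sum>u\<in>C. \<Sum>a\<in>C. \<Sum>t\<in>C\<times>C. D g (snd t) (fst t) * D (snd t) u a * F u a (fst t))"
    by (simp add: sum_Times)
  also have "\<dots> = (\<Sum>s\<in>C\<times>C. \<Sum>t\<in>C\<times>C. D g (snd t) (fst t) * D (snd t) (fst s) (snd s) * F (fst s) (snd s) (fst t))"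
    by (simp add: sum_Times)
  also have "\<dots> = (\<Sum>t\<in>C\<times>C. \<Sum>s\<in>C\<times>C. D g (snd t) (fst t) * D (snd t) (fst s) (snd s) * F (fst s) (snd s) (fst t))"
    by (rule sum.swap)
  also have "\<dots> = (\<Sum>b\<in>C. \<Sum>v\<in>C. D g v b * (\<Sum>u\<in>C. \<Sum>a\<in>C. D v u a * F u a b))"
    by (simp add: sum_Times sum_distrib_left mult.assoc)
  also have "\<dots> = (\<Sum>v\<in>C. \<Sum>b\<in>C. D g v b * (\<Sum>u\<in>C. \<Sum>a\<in>C. D v u a * F u a b))"
    by (rule sum.swap)
  finally show ?thesis .
qed

lemma sum_gdelta: "g \<in> C \<Longrightarrow> (\<Sum>u\<in>C. gdelta g u * F u) = F g"
  by (simp add: gdelta_def if_distrib[where f = "\<lambda>c. c * _"] sum.delta cong: if_cong)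

lemma sum_D_counit_right:
  assumes "g \<in> C"
  shows "(\<Sum>u\<in>C. \<Sum>v\<in>C. D g u v * F u) = F g"
  using assms by (simp add: sum_distrib_right[symmetric] D_counit_right sum_gdelta)

lemma sum_D_counit_left:
  assumes "g \<in> C"
  shows "(\<Sum>u\<in>C. \<Sum>v\<in>C. D g u v * F v) = F g"
  by (subst sum.swap) (use assms in \<open>simp add: sum_distrib_right[symmetric] D_counit_left sum_gdelta\<close>)

text \<open>Uniqueness is that of convolution inverses: s = s * (id * anti) = (s * id) * anti =
  anti, with coassociativity regrouping the legs.\<close>

lemma tw_antipode_basis_eq: "tw_antipode_basis G J = anti"
  unfolding tw_antipode_basis_def
proof (rule the_equality)
  show "(\<forall>g. anti g \<in> galg G) \<and> (\<forall>g. g \<notin> C \<longrightarrow> anti g = (\<lambda>_. 0)) \<and>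
      (\<forall>g\<in>C.
         (\<lambda>x. \<Sum>g1\<in>C. \<Sum>g2\<in>C.
                \<Delta> (gdelta g) (g1, g2) * gmult G (anti g1) (gdelta g2) x)
           = (\<lambda>x. gcounit G (gdelta g) * gunit G x)
       \<and> (\<lambda>x. \<Sum>g1\<in>C. \<Sum>g2\<in>C.
                \<Delta> (gdelta g) (g1, g2) * gmult G (gdelta g1) (anti g2) x)
           = (\<lambda>x. gcounit G (gdelta g) * gunit G x))"
    by (simp add: anti_outside tw_comult_gdelta D_anti_left D_anti_right)
next
  fix s :: "'a \<Rightarrow> 'a \<Rightarrow> 'k"
  assume s: "(\<forall>g. s g \<in> galg G) \<and> (\<forall>g. g \<notin> C \<longrightarrow> s g = (\<lambda>_. 0)) \<and>
      (\<forall>g\<in>C.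
         (\<lambda>x. \<Sum>g1\<in>C. \<Sum>g2\<in>C.
                \<Delta> (gdelta g) (g1, g2) * gmult G (s g1) (gdelta g2) x)
           = (\<lambda>x. gcounit G (gdelta g) * gunit G x)
       \<and> (\<lambda>x. \<Sum>g1\<in>C. \<Sum>g2\<in>C.
                \<Delta> (gdelta g) (g1, g2) * gmult G (gdelta g1) (s g2) x)
           = (\<lambda>x. gcounit G (gdelta g) * gunit G x))"
  have s1: "s g \<in> galg G" for g using s by blast
  have s2: "(\<Sum>u\<in>C. \<Sum>v\<in>C. D g u v * gmult G (s u) (gdelta v) x) = gunit G x"
    if "g \<in> C" for g x
    using s that by (auto simp: tw_comult_gdelta fun_eq_iff)
  show "s = anti"
  proof (rule ext)
    fix g
    show "s g = anti g"
    proof (cases "g \<in> C")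
      case g: True
      show ?thesis
      proof (rule ext)
        fix x
        have "s g x = (\<Sum>u\<in>C. \<Sum>v\<in>C. D g u v * s u x)"
          using g by (simp only: sum_D_counit_right)
        also have "\<dots> = (\<Sum>u\<in>C. \<Sum>v\<in>C. D g u v *
           (\<Sum>a\<in>C. \<Sum>b\<in>C. D v a b * gmult G (s u) (gmult G (gdelta a) (anti b)) x))"
        proof (intro sum.cong refl arg_cong2[where f = "(*)"])
          fix u v assume v: "v \<in> C"
          have "s u x = gmult G (s u) (gunit G) x" using s1 by simp
          also have "gunit G = (\<lambda>x. \<Sum>a\<in>C. \<Sum>b\<in>C. D v a b * gmult G (gdelta a) (anti b) x)"
            using v by (simp add: D_anti_right)
          finally show "s u x = (\<Sum>a\<in>C. \<Sum>b\<in>C. D v a b * gmult G (s u) (gmult G (gdelta a) (anti b)) x)"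
            by (simp only: gmult_sum2_right)
        qed
        also have "\<dots> = (\<Sum>v\<in>C. \<Sum>b\<in>C. D g v b * (\<Sum>u\<in>C. \<Sum>a\<in>C. D v u a *
            gmult G (s u) (gmult G (gdelta a) (anti b)) x))"
          using g by (rule D_coassoc_sum)
        also have "\<dots> = (\<Sum>v\<in>C. \<Sum>b\<in>C. D g v b * anti b x)"
        proof (intro sum.cong refl arg_cong2[where f = "(*)"])
          fix v b assume v: "v \<in> C"
          have "anti b x = gmult G (gunit G) (anti b) x" by simp
          also have "gunit G = (\<lambda>x. \<Sum>u\<in>C. \<Sum>a\<in>C. D v u a * gmult G (s u) (gdelta a) x)"
            using v by (simp add: s2)
          finally show "(\<Sum>u\<in>C. \<Sum>a\<in>C. D v u a * gmult G (s u) (gmult G (gdelta a) (anti b)) x) = anti b x"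
            by (simp only: gmult_sum2_left gmult_assoc)
        qed
        also have "\<dots> = anti g x"
          using g by (simp only: sum_D_counit_left)
        finally show "s g x = anti g x" .
      qed
    next
      case False
      then show ?thesis using s by (simp add: anti_outside)
    qed
  qed
qed

section \<open>Identities for the coproduct, the antipode and the adjoint action\<close>

lemma tw_comult_in_galg [simp]: "\<Delta> f \<in> galg (G \<times>\<times> G)"
  by (simp add: tw_comult_def)

lemma tw_comult_linear:
  assumes "\<And>i. i \<in> I \<Longrightarrow> f i \<in> galg G"
  shows "\<Delta> (\<lambda>x. \<Sum>i\<in>I. c i * f i x) t = (\<Sum>i\<in>I. c i * \<Delta> (f i) t)"
proof -
  have "gcomult (\<lambda>x. \<Sum>i\<in>I. c i * f i x) = (\<lambda>t. \<Sum>i\<in>I. c i * gcomult (f i) t)"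
    by (auto simp: gcomult_def fun_eq_iff)
  then show ?thesis by (simp add: tw_comult_def tmult_sum_left tmult_sum_right)
qed

lemma tw_antipode_eq: "tw_antipode G J f = (\<lambda>x. \<Sum>v\<in>C. f v * anti v x)"
  by (simp add: tw_antipode_def tw_antipode_basis_eq)

lemma tw_antipode_gdelta: "g \<in> C \<Longrightarrow> tw_antipode G J (gdelta g) = anti g"
  by (simp add: tw_antipode_eq sum_gdelta)

lemma sum_tw_comult:
  assumes "f \<in> galg G"
  shows "(\<Sum>u\<in>C. \<Sum>v\<in>C. \<Delta> f (u, v) * F u v) =
    (\<Sum>g\<in>C. f g * (\<Sum>u\<in>C. \<Sum>v\<in>C. D g u v * F u v))"
proof -
  have "(\<Sum>u\<in>C. \<Sum>v\<in>C. \<Delta> f (u, v) * F u v) =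
    (\<Sum>t\<in>C\<times>C. \<Sum>g\<in>C. f g * (D g (fst t) (snd t) * F (fst t) (snd t)))"
    using assms by (simp add: sum_Times tw_comult_expand sum_distrib_right mult.assoc)
  also have "\<dots> = (\<Sum>g\<in>C. \<Sum>t\<in>C\<times>C. f g * (D g (fst t) (snd t) * F (fst t) (snd t)))"
    by (rule sum.swap)
  finally show ?thesis by (simp add: sum_Times sum_distrib_left)
qed

text \<open>In Sweedler notation h \<otimes> 1 = \<Delta>(h1) (1 \<otimes> S(h2)), because h2 S(h3)
  collapses to the counit. It lets a factor be absorbed into a coproduct: \<Delta>(b) (h \<otimes>
  1) = \<Delta>(b h1) (1 \<otimes> S(h2)).\<close>

lemma tens_gunit_eq:
  assumes h: "h \<in> galg G"
  shows "tens h (gunit G) = (\<lambda>t. \<Sum>u\<in>C. \<Sum>v\<in>C. \<Delta> h (u, v) *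
    tmult G (\<Delta> (gdelta u)) (tens (gunit G) (anti v)) t)"
proof (rule ext, clarify)
  fix x y
  have *: "tmult G (\<Delta> (gdelta u)) (tens (gunit G) (anti v)) (x, y) =
     (\<Sum>a\<in>C. \<Sum>b\<in>C. D u a b * (gdelta a x * gmult G (gdelta b) (anti v) y))"
    if u: "u \<in> C" for u v
  proof -
    have D1: "(\<lambda>y. D u x y) \<in> galg G" and D2: "(\<lambda>x. D u x b) \<in> galg G" for b
      using tw_comult_in_galg[of "gdelta u"] u by (auto simp: galg_def tw_comult_gdelta)
    have "tmult G (\<Delta> (gdelta u)) (tens (gunit G) (anti v)) (x, y) =
       (\<Sum>b\<in>C. D u x b * gmult G (gdelta b) (anti v) y)"
      using u by (simp add: tmult_tens_gunit_left tw_comult_gdelta gmult_expand_left[OF D1])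
    also have "\<dots> = (\<Sum>b\<in>C. (\<Sum>a\<in>C. D u a b * gdelta a x) * gmult G (gdelta b) (anti v) y)"
      by (simp add: galg_sum_gdelta[OF D2])
    also have "\<dots> = (\<Sum>b\<in>C. \<Sum>a\<in>C. D u a b * (gdelta a x * gmult G (gdelta b) (anti v) y))"
      by (simp add: sum_distrib_right mult.assoc)
    also have "\<dots> = (\<Sum>a\<in>C. \<Sum>b\<in>C. D u a b * (gdelta a x * gmult G (gdelta b) (anti v) y))"
      by (rule sum.swap)
    finally show ?thesis .
  qed
  have "(\<Sum>u\<in>C. \<Sum>v\<in>C. \<Delta> h (u, v) *
      tmult G (\<Delta> (gdelta u)) (tens (gunit G) (anti v)) (x, y)) =
    (\<Sum>g\<in>C. h g * (\<Sum>u\<in>C. \<Sum>v\<in>C. D g u v *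
      (\<Sum>a\<in>C. \<Sum>b\<in>C. D u a b * (gdelta a x * gmult G (gdelta b) (anti v) y))))"
    unfolding sum_tw_comult[OF h] by (simp add: * cong: sum.cong)
  also have "\<dots> = (\<Sum>g\<in>C. h g * (\<Sum>a\<in>C. \<Sum>w\<in>C. D g a w *
      (\<Sum>b\<in>C. \<Sum>v\<in>C. D w b v * (gdelta a x * gmult G (gdelta b) (anti v) y))))"
    by (intro sum.cong refl arg_cong2[where f = "(*)"] D_coassoc_sum[symmetric])
  also have "\<dots> = (\<Sum>g\<in>C. h g * (\<Sum>a\<in>C. \<Sum>w\<in>C. D g a w * (gdelta a x * gunit G y)))"
  proof (intro sum.cong refl arg_cong2[where f = "(*)"])
    fix a w assume "w \<in> C"
    then have "gdelta a x * gunit G y = gdelta a x * (\<Sum>b\<in>C. \<Sum>v\<in>C. D w b v * gmult G (gdelta b) (anti v) y)"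
      by (simp add: D_anti_right)
    then show "(\<Sum>b\<in>C. \<Sum>v\<in>C. D w b v * (gdelta a x * gmult G (gdelta b) (anti v) y)) = gdelta a x * gunit G y"
      by (simp add: sum_distrib_left mult_ac)
  qed
  also have "\<dots> = (\<Sum>g\<in>C. h g * (gdelta g x * gunit G y))"
    by (intro sum.cong refl arg_cong2[where f = "(*)"] sum_D_counit_right)
  also have "\<dots> = (\<Sum>g\<in>C. h g * gdelta g x) * gunit G y"
    by (simp add: sum_distrib_right mult.assoc)
  also have "\<dots> = tens h (gunit G) (x, y)"
    by (simp add: tens_def galg_sum_gdelta[OF h])
  finally show "tens h (gunit G) (x, y) = (\<Sum>u\<in>C. \<Sum>v\<in>C. \<Delta> h (u, v) *
      tmult G (\<Delta> (gdelta u)) (tens (gunit G) (anti v)) (x, y))" ..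
qed

lemma tmult_sum2_right:
  "tmult G T (\<lambda>t. \<Sum>a\<in>A. \<Sum>b\<in>B. c a b * F a b t) = (\<lambda>t. \<Sum>a\<in>A. \<Sum>b\<in>B. c a b * tmult G T (F a b) t)"
  by (simp add: tmult_eq fin_group.gmult_sum2_right[OF fin_group_DirProd])

lemma tw_comult_tens_gunit:
  assumes h: "h \<in> galg G"
  shows "tmult G (\<Delta> b) (tens h (gunit G)) = (\<lambda>t. \<Sum>u\<in>C. \<Sum>v\<in>C.
    \<Delta> h (u, v) * tmult G (\<Delta> (gmult G b (gdelta u))) (tens (gunit G) (anti v)) t)"
  by (subst tens_gunit_eq[OF h]) (simp add: tmult_sum2_right tw_comult_gmult tmult_assoc)

lemma tw_comult_anti_op:
  assumes "h \<in> galg G"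
  shows "(\<Sum>u\<in>C. \<Sum>v\<in>C. \<Delta> h (u, v) * gmult G (anti v) (gdelta u) x) =
    gcounit G h * gunit G x"
  unfolding sum_tw_comult[OF assms] by (simp add: D_anti_op gcounit_def sum_distrib_right)

lemma sum_tensor:
  fixes us vs :: "nat \<Rightarrow> 'a \<Rightarrow> 'k"
  assumes "T = (\<lambda>(x, y). \<Sum>i<n. us i x * vs i y)"
  shows "(\<Sum>u\<in>C. \<Sum>v\<in>C. T (u, v) * F u v) =
    (\<Sum>i<n. \<Sum>u\<in>C. \<Sum>v\<in>C. us i u * vs i v * F u v)"
proof -
  have "(\<Sum>u\<in>C. \<Sum>v\<in>C. T (u, v) * F u v) =
    (\<Sum>t\<in>C\<times>C. \<Sum>i<n. us i (fst t) * vs i (snd t) * F (fst t) (snd t))"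
    unfolding assms by (simp add: sum_Times sum_distrib_right)
  also have "\<dots> = (\<Sum>i<n. \<Sum>t\<in>C\<times>C. us i (fst t) * vs i (snd t) * F (fst t) (snd t))"
    by (rule sum.swap)
  finally show ?thesis by (simp add: sum_Times)
qed

text \<open>The absorption of \<open>h\<close> into \<Delta>(b), read off at \<open>x\<close> and
  \<open>y\<close>. The legs of \<open>h\<close> enter as given tensor factors, so that for
  \<open>h\<close> in a Hopf subalgebra they can be chosen inside it.\<close>

lemma slice_identity:
  fixes us vs :: "nat \<Rightarrow> 'a \<Rightarrow> 'k"
  assumes h: "h \<in> galg G" and uv: "\<And>i. i < n \<Longrightarrow> us i \<in> galg G"
    and T: "\<Delta> h = (\<lambda>(x, y). \<Sum>i<n. us i x * vs i y)"
  shows "gmult G (\<lambda>x. \<Delta> b (x, y)) h x =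
    (\<Sum>i<n. gmult G (\<lambda>y. \<Delta> (gmult G b (us i)) (x, y)) (tw_antipode G J (vs i)) y)"
proof -
  let ?d = "\<lambda>f y. \<Delta> (gmult G b f) (x, y)"
  have "gmult G (\<lambda>x. \<Delta> b (x, y)) h x = tmult G (\<Delta> b) (tens h (gunit G)) (x, y)"
    by (simp add: tmult_tens_gunit_right)
  also have "\<dots> = (\<Sum>u\<in>C. \<Sum>v\<in>C. \<Delta> h (u, v) * gmult G (?d (gdelta u)) (anti v) y)"
    by (subst tw_comult_tens_gunit[OF h]) (simp add: tmult_tens_gunit_left)
  also have "\<dots> = (\<Sum>i<n. \<Sum>u\<in>C. \<Sum>v\<in>C. us i u * vs i v * gmult G (?d (gdelta u)) (anti v) y)"
    by (rule sum_tensor[OF T])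
  also have "\<dots> = (\<Sum>i<n. gmult G (?d (us i)) (tw_antipode G J (vs i)) y)"
  proof (intro sum.cong refl)
    fix i assume "i \<in> {..<n}"
    then have "gmult G b (us i) = (\<lambda>x. \<Sum>u\<in>C. us i u * gmult G b (gdelta u) x)"
      using uv by (simp add: gmult_expand_right)
    then have "?d (us i) = (\<lambda>y. \<Sum>u\<in>C. us i u * ?d (gdelta u) y)"
      by (simp add: tw_comult_linear)
    then show "(\<Sum>u\<in>C. \<Sum>v\<in>C. us i u * vs i v * gmult G (?d (gdelta u)) (anti v) y) =
      gmult G (?d (us i)) (tw_antipode G J (vs i)) y"
      by (simp add: tw_antipode_eq sum_sum_gmult)
  qed
  finally show ?thesis .
qed

lemma tw_comult_counit_right:
  "f \<in> galg G \<Longrightarrow> (\<Sum>y\<in>C. \<Delta> f (x, y)) = f x"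
proof -
  assume f: "f \<in> galg G"
  have "(\<Sum>y\<in>C. \<Delta> f (x, y)) = (\<Sum>g\<in>C. \<Sum>y\<in>C. f g * D g x y)"
    using f by (simp add: tw_comult_expand) (rule sum.swap)
  also have "\<dots> = f x"
    by (simp add: D_counit_right galg_sum_gdelta[OF f] flip: sum_distrib_left)
  finally show ?thesis .
qed

lemma tw_comult_counit_left:
  "f \<in> galg G \<Longrightarrow> (\<Sum>x\<in>C. \<Delta> f (x, y)) = f y"
proof -
  assume f: "f \<in> galg G"
  have "(\<Sum>x\<in>C. \<Delta> f (x, y)) = (\<Sum>g\<in>C. \<Sum>x\<in>C. f g * D g x y)"
    using f by (simp add: tw_comult_expand) (rule sum.swap)
  also have "\<dots> = f y"
    by (simp add: D_counit_left galg_sum_gdelta[OF f] flip: sum_distrib_left)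
  finally show ?thesis .
qed

lemma tw_adjoint_gdelta:
  "u \<in> C \<Longrightarrow> tw_adjoint G J (gdelta u) c = (\<lambda>z. \<Sum>a\<in>C. \<Sum>b\<in>C.
     D u a b * gmult G (gmult G (gdelta a) c) (anti b) z)"
  by (simp add: tw_adjoint_def tw_comult_gdelta tw_antipode_gdelta cong: sum.cong)

lemma gcounit_tw_adjoint:
  assumes u: "u \<in> C"
  shows "gcounit G (tw_adjoint G J (gdelta u) c) = gcounit G c"
proof -
  have "gcounit G (tw_adjoint G J (gdelta u) c) =
    (\<Sum>z\<in>C. \<Sum>t\<in>C\<times>C. D u (fst t) (snd t) * gmult G (gmult G (gdelta (fst t)) c) (anti (snd t)) z)"
    using u by (simp add: gcounit_def tw_adjoint_gdelta sum_Times)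
  also have "\<dots> = (\<Sum>t\<in>C\<times>C. \<Sum>z\<in>C. D u (fst t) (snd t) * gmult G (gmult G (gdelta (fst t)) c) (anti (snd t)) z)"
    by (rule sum.swap)
  also have "\<dots> = (\<Sum>a\<in>C. \<Sum>b\<in>C. D u a b * gcounit G (gmult G (gmult G (gdelta a) c) (anti b)))"
    by (simp add: sum_Times gcounit_def sum_distrib_left)
  also have "\<dots> = (\<Sum>a\<in>C. \<Sum>b\<in>C. D u a b * gcounit G c)"
    by (intro sum.cong refl) (simp add: gcounit_gmult gcounit_anti)
  also have "\<dots> = gcounit G c" using u by (rule sum_D_counit_right)
  finally show ?thesis .
qed

text \<open>The rule h c = (h1 acting on c) h2, from the cancellation of S(h2) h3. It turns
  stability under the adjoint action into a way of moving group elements across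
  \<open>B\<close>.\<close>

lemma gdelta_mult_eq_adjoint:
  assumes g: "g \<in> C" and c: "c \<in> galg G"
  shows "gmult G (gdelta g) c = (\<lambda>x. \<Sum>u\<in>C. \<Sum>v\<in>C.
    D g u v * gmult G (tw_adjoint G J (gdelta u) c) (gdelta v) x)"
proof (rule ext)
  fix x
  have "(\<Sum>u\<in>C. \<Sum>v\<in>C. D g u v * gmult G (tw_adjoint G J (gdelta u) c) (gdelta v) x) =
    (\<Sum>u\<in>C. \<Sum>v\<in>C. D g u v * (\<Sum>a\<in>C. \<Sum>b\<in>C. D u a b *
       gmult G (gmult G (gdelta a) c) (gmult G (anti b) (gdelta v)) x))"
    by (intro sum.cong refl) (simp add: tw_adjoint_gdelta gmult_sum2_left gmult_assoc)
  also have "\<dots> = (\<Sum>a\<in>C. \<Sum>w\<in>C. D g a w * (\<Sum>b\<in>C. \<Sum>v\<in>C. D w b v *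
       gmult G (gmult G (gdelta a) c) (gmult G (anti b) (gdelta v)) x))"
    by (rule D_coassoc_sum[OF g, symmetric])
  also have "\<dots> = (\<Sum>a\<in>C. \<Sum>w\<in>C. D g a w * gmult G (gdelta a) c x)"
  proof (intro sum.cong refl arg_cong2[where f = "(*)"])
    fix a w assume "w \<in> C"
    then have "gunit G = (\<lambda>x. \<Sum>b\<in>C. \<Sum>v\<in>C. D w b v * gmult G (anti b) (gdelta v) x)"
      by (simp add: D_anti_left)
    moreover have "gmult G (gdelta a) c x = gmult G (gmult G (gdelta a) c) (gunit G) x" by simp
    ultimately show "(\<Sum>b\<in>C. \<Sum>v\<in>C. D w b v *
       gmult G (gmult G (gdelta a) c) (gmult G (anti b) (gdelta v)) x) = gmult G (gdelta a) c x"
      by (simp only: gmult_sum2_right)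
  qed
  also have "\<dots> = gmult G (gdelta g) c x" using g by (rule sum_D_counit_right)
  finally show "gmult G (gdelta g) c x = (\<Sum>u\<in>C. \<Sum>v\<in>C.
    D g u v * gmult G (tw_adjoint G J (gdelta u) c) (gdelta v) x)" ..
qed

lemma twist_of_commute:
  fixes w :: "('a \<Rightarrow> 'k) \<Rightarrow> ('a \<Rightarrow> 'k) \<Rightarrow> 'k"
  assumes "h \<in> H" "k \<in> H"
  shows "tmult G (twist_of G H w) (tens (gdelta h) (gdelta k)) =
    tmult G (tens (gdelta h) (gdelta k)) (twist_of G H w)"
  unfolding twist_of_expand tmult_sum_left tmult_sum_right
  using assms by (intro ext sum.cong refl) (auto simp: tmult_tens gdelta_e e_gdelta)

lemma gcomult_eq_tw_comult:
  "f \<in> galg G \<Longrightarrow> gcomult f = tmult G J (tmult G (\<Delta> f) Ji)"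
proof -
  assume f: "f \<in> galg G"
  have "tmult G J (tmult G (\<Delta> f) Ji) =
      tmult G (tmult G J Ji) (tmult G (gcomult f) (tmult G J Ji))"
    by (simp add: tw_comult_def tinv_J tmult_assoc)
  also have "\<dots> = gcomult f" using f by (simp add: J_Ji gcomult_in_galg)
  finally show ?thesis ..
qed

text \<open>For \<open>g\<close> in \<open>H\<close> the twist has no effect, because
  \<open>J\<close> lies over the commutative algebra of \<open>H\<close>. For other \<open>g\<close>
  the double coset H g H misses the unit.\<close>

lemma D_at_one:
  assumes g: "g \<in> C"
  shows "D g x \<one> = (if g = \<one> then gunit G x else 0)"
proof (cases "g \<in> H")
  case True
  have "\<Delta> (gdelta g) = tmult G Ji (tmult G (tens (gdelta g) (gdelta g)) J)"
    by (simp add: tw_comult_def tinv_J gcomult_gdelta tmult_assoc)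
  also have "\<dots> = tmult G (tmult G Ji J) (tens (gdelta g) (gdelta g))"
    using True by (simp add: twist_of_commute[symmetric] tmult_assoc)
  also have "\<dots> = tens (gdelta g) (gdelta g)"
    using g by (simp add: Ji_J tens_in_galg)
  finally have "D g x \<one> = tens (gdelta g) (gdelta g) (x, \<one>)"
    using tw_comult_gdelta[OF g, of x \<one>] by simp
  then show ?thesis by (auto simp: tens_def gdelta_def gunit_def)
next
  case False
  have "bicomp j g \<one> = 0" for j
  proof -
    have "h \<otimes> g \<otimes> k \<noteq> \<one>" if hk: "h \<in> H" "k \<in> H" for h k
    proof
      assume "h \<otimes> g \<otimes> k = \<one>"
      then have "inv h \<otimes> (h \<otimes> g \<otimes> k) \<otimes> inv k = inv h \<otimes> inv k" using hk by simp
      moreover have "inv h \<otimes> (h \<otimes> g \<otimes> k) \<otimes> inv k = g"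
        using hk g by (simp add: m_assoc) (simp flip: m_assoc)
      ultimately have "g = inv h \<otimes> inv k" by simp
      then show False using False hk by simp
    qed
    then show ?thesis by (force simp: bicomp_def gdelta_def intro!: sum.neutral)
  qed
  then show ?thesis using False by (auto simp: D_def)
qed

text \<open>As a function of \<alpha> the right-hand side is a character of the group
  \<open>X\<close>: it is the alternating bicharacter attached to \<omega>. Duality for the finite
  abelian group \<open>H\<close> makes it evaluation at a point.\<close>

lemma ex_commutator_element:
  assumes \<chi>: "\<chi> \<in> X"
  shows "\<exists>t\<in>H. \<forall>\<alpha>\<in>X. \<alpha> t = \<omega> \<alpha> \<chi> / \<omega> \<chi> \<alpha>"
proof -
  define \<eta> where "\<eta> \<alpha> = \<omega> \<alpha> \<chi> / \<omega> \<chi> \<alpha>" for \<alpha>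
  have \<eta>_nz: "\<eta> \<alpha> \<noteq> 0" if "\<alpha> \<in> X" for \<alpha> using that \<chi> by (simp add: \<eta>_def)
  have \<eta>_mult: "\<eta> (char_mult \<alpha> \<beta>) = \<eta> \<alpha> * \<eta> \<beta>" if ab: "\<alpha> \<in> X" "\<beta> \<in> X" for \<alpha> \<beta>
  proof -
    \<comment> \<open>The cocycle identity for the three positions of \<chi> among \<alpha> and
      \<beta>; combining them is the standard proof that the commutator pairing is
      multiplicative.\<close>
    have 1: "\<omega> \<alpha> \<beta> * \<omega> (char_mult \<alpha> \<beta>) \<chi> = \<omega> \<beta> \<chi> * \<omega> \<alpha> (char_mult \<beta> \<chi>)"
      and 2: "\<omega> \<chi> \<alpha> * \<omega> (char_mult \<chi> \<alpha>) \<beta> = \<omega> \<alpha> \<beta> * \<omega> \<chi> (char_mult \<alpha> \<beta>)"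
      and 3: "\<omega> \<alpha> \<chi> * \<omega> (char_mult \<chi> \<alpha>) \<beta> = \<omega> \<chi> \<beta> * \<omega> \<alpha> (char_mult \<beta> \<chi>)"
      using omega_cocycle[of \<alpha> \<beta> \<chi>] omega_cocycle[of \<chi> \<alpha> \<beta>] omega_cocycle[of \<alpha> \<chi> \<beta>] ab \<chi>
      by (simp_all add: char_mult_commute[of \<alpha> \<chi>] char_mult_commute[of \<chi> \<beta>])
    have nz: "\<omega> \<alpha> \<beta> \<noteq> 0" "\<omega> (char_mult \<alpha> \<beta>) \<chi> \<noteq> 0" "\<omega> \<chi> (char_mult \<alpha> \<beta>) \<noteq> 0" "\<omega> \<chi> \<alpha> \<noteq> 0"
      "\<omega> \<chi> \<beta> \<noteq> 0" "\<omega> (char_mult \<chi> \<alpha>) \<beta> \<noteq> 0" using ab \<chi> by auto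
    have "(\<omega> (char_mult \<alpha> \<beta>) \<chi> * (\<omega> \<chi> \<alpha> * \<omega> \<chi> \<beta>)) * (\<omega> \<alpha> \<beta> * \<omega> (char_mult \<chi> \<alpha>) \<beta>) =
       (\<omega> \<alpha> \<beta> * \<omega> (char_mult \<alpha> \<beta>) \<chi>) * (\<omega> \<chi> \<alpha> * \<omega> (char_mult \<chi> \<alpha>) \<beta>) * \<omega> \<chi> \<beta>"
      by (simp only: mult_ac)
    also have "\<dots> = (\<omega> \<chi> \<beta> * \<omega> \<alpha> (char_mult \<beta> \<chi>)) * \<omega> \<beta> \<chi> * (\<omega> \<alpha> \<beta> * \<omega> \<chi> (char_mult \<alpha> \<beta>))"
      unfolding 1 2 by (simp only: mult_ac)
    also have "\<dots> = (\<omega> \<alpha> \<chi> * \<omega> \<beta> \<chi> * \<omega> \<chi> (char_mult \<alpha> \<beta>)) * (\<omega> \<alpha> \<beta> * \<omega> (char_mult \<chi> \<alpha>) \<beta>)"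
      unfolding 3[symmetric] by (simp only: mult_ac)
    finally have "\<omega> (char_mult \<alpha> \<beta>) \<chi> * (\<omega> \<chi> \<alpha> * \<omega> \<chi> \<beta>) = \<omega> \<alpha> \<chi> * \<omega> \<beta> \<chi> * \<omega> \<chi> (char_mult \<alpha> \<beta>)"
      using nz by simp
    then show ?thesis using nz by (simp add: \<eta>_def field_simps)
  qed
  \<comment> \<open>The element of \<open>kH\<close> with coefficient \<eta>(\<alpha>) at
    \<open>e \<alpha>\<close> has total mass \<eta>(\<open>triv\<close>), hence a nonempty support.
    Translating the sum over \<open>X\<close> by \<gamma> multiplies its value at a support point
    \<open>h\<close> by \<eta>(\<gamma>) / \<gamma>(h), so this factor is 1.\<close>
  have "\<exists>h\<in>H. (\<Sum>\<alpha>\<in>X. \<eta> \<alpha> * e \<alpha> h) \<noteq> 0"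
  proof (rule ccontr)
    assume "\<not> ?thesis"
    then have "0 = (\<Sum>h\<in>H. (\<Sum>\<alpha>\<in>X. \<eta> \<alpha> * e \<alpha> h) * triv h)" by simp
    also have "\<dots> = (\<Sum>h\<in>H. \<Sum>\<alpha>\<in>X. \<eta> \<alpha> * (e \<alpha> h * triv h))"
      by (simp add: sum_distrib_right mult.assoc)
    also have "\<dots> = (\<Sum>\<alpha>\<in>X. \<Sum>h\<in>H. \<eta> \<alpha> * (e \<alpha> h * triv h))" by (rule sum.swap)
    also have "\<dots> = (\<Sum>\<alpha>\<in>X. \<eta> \<alpha> * (if \<alpha> = triv then 1 else 0))"
      by (intro sum.cong refl) (simp add: e_orth flip: sum_distrib_left)
    also have "\<dots> = \<eta> triv" by (simp add: if_distrib[where f = "\<lambda>c. _ * c"] sum.delta cong: if_cong)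
    finally show False using \<eta>_nz by simp
  qed
  then obtain h where h: "h \<in> H" and S: "(\<Sum>\<alpha>\<in>X. \<eta> \<alpha> * e \<alpha> h) \<noteq> 0" by blast
  have "\<gamma> h = \<eta> \<gamma>" if \<gamma>: "\<gamma> \<in> X" for \<gamma>
  proof -
    have "(\<Sum>\<alpha>\<in>X. \<eta> \<alpha> * e \<alpha> h) = (\<Sum>\<alpha>\<in>X. \<eta> (char_mult \<gamma> \<alpha>) * e (char_mult \<gamma> \<alpha>) h)"
      by (rule sum.reindex_bij_witness[where i = "char_mult \<gamma>" and j = "char_mult (cinv \<gamma>)"])
         (use \<gamma> in \<open>auto simp flip: char_mult_assoc\<close>)
    also have "\<dots> = (\<Sum>\<alpha>\<in>X. (\<eta> \<gamma> * \<gamma> (inv h)) * (\<eta> \<alpha> * e \<alpha> h))"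
      using \<gamma> h by (intro sum.cong refl) (simp add: \<eta>_mult, simp add: char_idem_def char_mult_def)
    finally have "\<eta> \<gamma> * \<gamma> (inv h) = 1" using S by (simp flip: sum_distrib_left)
    then show ?thesis using char_inv[OF \<gamma> h] char_nonzero[OF \<gamma> h] by (simp add: field_simps)
  qed
  then show ?thesis using h by (auto simp: \<eta>_def)
qed

text \<open>A character commuting with all others splits the central extension of the character group
  defined by \<open>\<omega>\<close>: lift it and a complementary generator to elements of order \<open>q\<close>.\<close>

lemma coboundary_if_degenerate:
  fixes q :: nat
  assumes closed: "alg_closed TYPE('k)" and q: "prime q" and card: "card H = q * q"
    and exp: "\<And>h. h \<in> H \<Longrightarrow> h [^] q = \<one>"
    and \<chi>: "\<chi> \<in> X" "\<chi> \<noteq> triv" and sym: "\<And>\<alpha>. \<alpha> \<in> X \<Longrightarrow> \<omega> \<alpha> \<chi> = \<omega> \<chi> \<alpha>"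
  shows "coboundary G H \<omega>"
proof -
  have q0: "q > 0" using q by (rule prime_gt_0_nat)
  define K where "K = \<lparr>carrier = X, monoid.mult = char_mult, one = triv\<rparr>"
  interpret K: comm_group K
  proof (rule comm_groupI)
    fix \<alpha> assume "\<alpha> \<in> carrier K"
    then show "\<exists>\<beta>\<in>carrier K. \<beta> \<otimes>\<^bsub>K\<^esub> \<alpha> = \<one>\<^bsub>K\<^esub>"
      by (intro bexI[of _ "cinv \<alpha>"]) (auto simp: K_def)
  qed (auto simp: K_def char_mult_assoc intro: char_mult_commute)
  have Kc: "carrier K = X" by (simp add: K_def)
  have Kpow: "(\<alpha> [^]\<^bsub>K\<^esub> n) h = \<alpha> h ^ n" if "h \<in> H" for \<alpha> h and n :: nat
    using that by (induction n) (auto simp: K_def char_mult_def triv_def)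
  have Kexp: "\<alpha> [^]\<^bsub>K\<^esub> q = \<one>\<^bsub>K\<^esub>" if "\<alpha> \<in> carrier K" for \<alpha>
  proof (rule ext)
    fix x
    have \<alpha>X: "\<alpha> \<in> X" and powX: "\<alpha> [^]\<^bsub>K\<^esub> q \<in> X"
      using that K.nat_pow_closed[OF that] by (auto simp: K_def)
    show "(\<alpha> [^]\<^bsub>K\<^esub> q) x = \<one>\<^bsub>K\<^esub> x"
    proof (cases "x \<in> H")
      case True
      then show ?thesis using char_pow[OF \<alpha>X True, of q] exp[OF True] \<alpha>X
        by (simp add: Kpow) (simp add: K_def triv_def char_one)
    next
      case False
      then show ?thesis using char_outside[OF powX] by (simp add: K_def triv_def)
    qed
  qed
  have "\<exists>y\<in>carrier K. carrier K = (\<lambda>(i, j). \<chi> [^]\<^bsub>K\<^esub> i \<otimes>\<^bsub>K\<^esub> y [^]\<^bsub>K\<^esub> j) ` ({..<q} \<times> {..<q})"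
    using q Kexp \<chi> card by (intro K.elementary_abelian_generators) (auto simp: K_def card_X)
  then obtain \<gamma> where \<gamma>: "\<gamma> \<in> X"
    and gen: "X = (\<lambda>(i, j). \<chi> [^]\<^bsub>K\<^esub> i \<otimes>\<^bsub>K\<^esub> \<gamma> [^]\<^bsub>K\<^esub> j) ` ({..<q} \<times> {..<q})"
    unfolding Kc by blast
  \<comment> \<open>The extension of \<open>X\<close> by the nonzero scalars. The scalar in its unit
    accounts for \<omega> not being normalized.\<close>
  define M where "M = \<lparr>carrier = {c. c \<noteq> (0::'k)} \<times> X,
    monoid.mult = (\<lambda>a b. (fst a * fst b * \<omega> (snd a) (snd b), char_mult (snd a) (snd b))),
    one = (inverse (\<omega> triv triv), triv)\<rparr>"
  interpret M: monoid M
  proof (rule monoidI)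
    fix a b c assume abc: "a \<in> carrier M" "b \<in> carrier M" "c \<in> carrier M"
    then show "a \<otimes>\<^bsub>M\<^esub> b \<otimes>\<^bsub>M\<^esub> c = a \<otimes>\<^bsub>M\<^esub> (b \<otimes>\<^bsub>M\<^esub> c)"
      using omega_cocycle[of "snd a" "snd b" "snd c"]
      by (auto simp: M_def char_mult_assoc mult_ac)
  next
    fix a assume "a \<in> carrier M"
    then show "\<one>\<^bsub>M\<^esub> \<otimes>\<^bsub>M\<^esub> a = a" "a \<otimes>\<^bsub>M\<^esub> \<one>\<^bsub>M\<^esub> = a"
      using omega_triv_left[of "snd a"] omega_triv_right[of "snd a"] by (auto simp: M_def)
  qed (auto simp: M_def)
  have snd_pow: "snd (a [^]\<^bsub>M\<^esub> n) = snd a [^]\<^bsub>K\<^esub> n" for a and n :: nat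
    by (induction n) (auto simp: M_def K_def)
  have scale_pow: "(x, \<alpha>) [^]\<^bsub>M\<^esub> n = (x ^ n * fst ((1, \<alpha>) [^]\<^bsub>M\<^esub> n), snd ((1, \<alpha>) [^]\<^bsub>M\<^esub> n))"
    for x \<alpha> and n :: nat
    by (induction n) (auto simp: M_def)
  \<comment> \<open>The \<open>q\<close>-th power of any lift is a scalar over the trivial
    character; a \<open>q\<close>-th root in the field rescales the lift so that this power becomes
    the unit.\<close>
  have lift: "\<exists>a\<in>carrier M. snd a = \<alpha> \<and> a [^]\<^bsub>M\<^esub> q = \<one>\<^bsub>M\<^esub>" if \<alpha>: "\<alpha> \<in> X" for \<alpha>
  proof -
    let ?u = "(1, \<alpha>) [^]\<^bsub>M\<^esub> q"
    have uM: "?u \<in> carrier M" using \<alpha> by (intro M.nat_pow_closed) (simp add: M_def)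
    then have nz: "fst ?u \<noteq> 0" by (auto simp: M_def)
    obtain x where x: "x ^ q = inverse (\<omega> triv triv * fst ?u)"
      using alg_closed_root[OF closed q0] by blast
    have "x \<noteq> 0" using x nz q0 by (auto simp: power_0_left)
    moreover have "(x, \<alpha>) [^]\<^bsub>M\<^esub> q = \<one>\<^bsub>M\<^esub>"
      using x nz Kexp[of \<alpha>] \<alpha> by (subst scale_pow) (simp add: snd_pow, simp add: M_def K_def)
    ultimately show ?thesis using \<alpha> by (intro bexI[of _ "(x, \<alpha>)"]) (auto simp: M_def)
  qed
  obtain a where a: "a \<in> carrier M" "snd a = \<chi>" "a [^]\<^bsub>M\<^esub> q = \<one>\<^bsub>M\<^esub>" using lift[OF \<chi>(1)] by blast
  obtain b where b: "b \<in> carrier M" "snd b = \<gamma>" "b [^]\<^bsub>M\<^esub> q = \<one>\<^bsub>M\<^esub>" using lift[OF \<gamma>] by blast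
  have comm: "a \<otimes>\<^bsub>M\<^esub> b = b \<otimes>\<^bsub>M\<^esub> a"
    using a b sym[OF \<gamma>] char_mult_commute[of \<chi> \<gamma>] by (auto simp: M_def)
  have red: "z [^]\<^bsub>M\<^esub> n = z [^]\<^bsub>M\<^esub> (n mod q)" if "z \<in> carrier M" "z [^]\<^bsub>M\<^esub> q = \<one>\<^bsub>M\<^esub>" for z and n :: nat
  proof -
    have "z [^]\<^bsub>M\<^esub> n = z [^]\<^bsub>M\<^esub> (q * (n div q)) \<otimes>\<^bsub>M\<^esub> z [^]\<^bsub>M\<^esub> (n mod q)"
      using that by (simp add: M.nat_pow_mult)
    also have "z [^]\<^bsub>M\<^esub> (q * (n div q)) = \<one>\<^bsub>M\<^esub>" using that by (simp flip: M.nat_pow_pow)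
    finally show ?thesis using that by simp
  qed
  \<comment> \<open>Products of powers of the two commuting lifts form a multiplicatively closed set
    of at most q * q elements that maps onto \<open>X\<close>, hence bijectively. The inverse map is
    a multiplicative section of the extension.\<close>
  define S where "S = (\<lambda>(i, j). a [^]\<^bsub>M\<^esub> i \<otimes>\<^bsub>M\<^esub> b [^]\<^bsub>M\<^esub> j) ` ({..<q} \<times> {..<q})"
  have inS: "a [^]\<^bsub>M\<^esub> i \<otimes>\<^bsub>M\<^esub> b [^]\<^bsub>M\<^esub> j \<in> S" for i j :: nat
  proof -
    have "a [^]\<^bsub>M\<^esub> i \<otimes>\<^bsub>M\<^esub> b [^]\<^bsub>M\<^esub> j = a [^]\<^bsub>M\<^esub> (i mod q) \<otimes>\<^bsub>M\<^esub> b [^]\<^bsub>M\<^esub> (j mod q)"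
      using red a b by metis
    then show ?thesis using q0 unfolding S_def by force
  qed
  have SM: "S \<subseteq> carrier M" using a b by (auto simp: S_def)
  have S_mult: "s \<otimes>\<^bsub>M\<^esub> s' \<in> S" if ss: "s \<in> S" "s' \<in> S" for s s'
  proof -
    obtain i j :: nat where s: "s = a [^]\<^bsub>M\<^esub> i \<otimes>\<^bsub>M\<^esub> b [^]\<^bsub>M\<^esub> j" using ss(1) unfolding S_def by auto
    obtain k l :: nat where s': "s' = a [^]\<^bsub>M\<^esub> k \<otimes>\<^bsub>M\<^esub> b [^]\<^bsub>M\<^esub> l" using ss(2) unfolding S_def by auto
    have "b [^]\<^bsub>M\<^esub> j \<otimes>\<^bsub>M\<^esub> a [^]\<^bsub>M\<^esub> k = a [^]\<^bsub>M\<^esub> k \<otimes>\<^bsub>M\<^esub> b [^]\<^bsub>M\<^esub> j"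
      using a b comm by (metis M.group_commutes_pow M.nat_pow_closed)
    then have "s \<otimes>\<^bsub>M\<^esub> s' = (a [^]\<^bsub>M\<^esub> i \<otimes>\<^bsub>M\<^esub> a [^]\<^bsub>M\<^esub> k) \<otimes>\<^bsub>M\<^esub> (b [^]\<^bsub>M\<^esub> j \<otimes>\<^bsub>M\<^esub> b [^]\<^bsub>M\<^esub> l)"
      unfolding s s' using a b by (metis M.m_assoc M.m_closed M.nat_pow_closed)
    then show ?thesis using a b inS by (simp add: M.nat_pow_mult)
  qed
  have "snd ` S = X"
  proof -
    have "snd (a [^]\<^bsub>M\<^esub> i \<otimes>\<^bsub>M\<^esub> b [^]\<^bsub>M\<^esub> j) = \<chi> [^]\<^bsub>K\<^esub> i \<otimes>\<^bsub>K\<^esub> \<gamma> [^]\<^bsub>K\<^esub> j" for i j :: nat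
      using snd_pow[of a i] snd_pow[of b j] a b by (simp add: M_def K_def)
    then show ?thesis unfolding S_def by (subst gen) (simp add: image_image case_prod_beta)
  qed
  moreover have "card S \<le> q * q"
    unfolding S_def by (rule order_trans[OF card_image_le]) auto
  moreover have finS: "finite S" unfolding S_def by auto
  ultimately have inj: "inj_on snd S"
    using card card_X card_image_le[OF finS, of snd] by (intro eq_card_imp_inj_on) auto
  define s where "s \<alpha> = the_inv_into S snd \<alpha>" for \<alpha>
  have sS: "s \<alpha> \<in> S" and snd_s: "snd (s \<alpha>) = \<alpha>" if "\<alpha> \<in> X" for \<alpha>
    using that \<open>snd ` S = X\<close> inj unfolding s_def
    by (auto intro: the_inv_into_into f_the_inv_into_f)
  have s_nz: "fst (s \<alpha>) \<noteq> 0" if "\<alpha> \<in> X" for \<alpha> using sS[OF that] SM by (auto simp: M_def)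
  have s_mult: "fst (s (char_mult \<alpha> \<beta>)) = fst (s \<alpha>) * fst (s \<beta>) * \<omega> \<alpha> \<beta>" if "\<alpha> \<in> X" "\<beta> \<in> X" for \<alpha> \<beta>
  proof -
    have "s \<alpha> \<otimes>\<^bsub>M\<^esub> s \<beta> \<in> S" using that by (intro S_mult sS)
    moreover have "snd (s \<alpha> \<otimes>\<^bsub>M\<^esub> s \<beta>) = snd (s (char_mult \<alpha> \<beta>))"
      using that by (simp add: snd_s) (simp add: M_def snd_s)
    ultimately have "s \<alpha> \<otimes>\<^bsub>M\<^esub> s \<beta> = s (char_mult \<alpha> \<beta>)"
      using inj that by (intro inj_onD[OF inj]) (auto intro: sS)
    then have "fst (s (char_mult \<alpha> \<beta>)) = fst (s \<alpha> \<otimes>\<^bsub>M\<^esub> s \<beta>)" by simp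
    then show ?thesis using that by (simp add: M_def snd_s)
  qed
  \<comment> \<open>In the scalar coordinate, multiplicativity of the section reads
    s(\<alpha>\<beta>) = s(\<alpha>) s(\<beta>) \<omega>(\<alpha>, \<beta>), so the trivializing
    cochain is the inverse of that coordinate.\<close>
  show ?thesis
    unfolding coboundary_def X_def[symmetric]
  proof (intro exI[of _ "\<lambda>\<alpha>. inverse (fst (s \<alpha>))"] conjI ballI)
    fix \<alpha> \<beta> assume "\<alpha> \<in> X" "\<beta> \<in> X"
    then show "\<omega> \<alpha> \<beta> = inverse (fst (s \<alpha>)) * inverse (fst (s \<beta>)) / inverse (fst (s (char_mult \<alpha> \<beta>)))"
      using s_nz by (simp add: s_mult field_simps)
  qed (use s_nz in auto)
qed

end

section \<open>Normal Hopf subalgebras\<close>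

locale normal_hopf_sub = twist G H X \<omega>
  for G (structure) and H :: "'a set" and X :: "('a \<Rightarrow> 'k::field_char_0) set"
    and \<omega> :: "('a \<Rightarrow> 'k) \<Rightarrow> ('a \<Rightarrow> 'k) \<Rightarrow> 'k" +
  fixes B :: "('a \<Rightarrow> 'k) set"
  assumes normal_B: "normal_hopf_subalgebra G (twist_of G H \<omega>) B"
begin

lemma hopf_B: "hopf_subalgebra G J B"
  using normal_B by (simp add: normal_hopf_subalgebra_def)

lemma B_galg: "b \<in> B \<Longrightarrow> b \<in> galg G"
  and B_zero: "(\<lambda>_. 0) \<in> B"
  and B_add: "b \<in> B \<Longrightarrow> b' \<in> B \<Longrightarrow> (\<lambda>x. b x + b' x) \<in> B"
  and B_scale: "b \<in> B \<Longrightarrow> (\<lambda>x. c * b x) \<in> B"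
  and B_gunit: "gunit G \<in> B"
  and B_gmult: "b \<in> B \<Longrightarrow> b' \<in> B \<Longrightarrow> gmult G b b' \<in> B"
  and B_comult: "b \<in> B \<Longrightarrow> \<Delta> b \<in> tensor_span B"
  and B_antipode: "b \<in> B \<Longrightarrow> tw_antipode G J b \<in> B"
  using hopf_B by (auto simp: hopf_subalgebra_def)

lemma B_adjoint: "h \<in> galg G \<Longrightarrow> b \<in> B \<Longrightarrow> tw_adjoint G J h b \<in> B"
  using normal_B by (simp add: normal_hopf_subalgebra_def)

lemma B_sum: "finite I \<Longrightarrow> (\<And>i. i \<in> I \<Longrightarrow> f i \<in> B) \<Longrightarrow> (\<lambda>x. \<Sum>i\<in>I. c i * f i x) \<in> B"
  by (rule linear_combination_closed) (simp_all add: B_zero B_add B_scale)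

lemma B_comultE:
  assumes "b \<in> B"
  obtains n :: nat and us vs where "\<And>i. i < n \<Longrightarrow> us i \<in> B" "\<And>i. i < n \<Longrightarrow> vs i \<in> B"
    "\<Delta> b = (\<lambda>(x, y). \<Sum>i<n. us i x * vs i y)"
  using B_comult[OF assms] unfolding tensor_span_def by blast

lemma B_slice_left: "b \<in> B \<Longrightarrow> (\<lambda>x. \<Delta> b (x, y)) \<in> B"
proof (erule B_comultE)
  fix n :: nat and us vs
  assume *: "\<And>i. i < n \<Longrightarrow> us i \<in> B" "\<Delta> b = (\<lambda>(x, y). \<Sum>i<n. us i x * vs i y)"
  have "(\<lambda>x. \<Sum>i<n. vs i y * us i x) \<in> B" by (rule B_sum) (use * in auto)
  then show ?thesis by (simp add: * mult.commute)
qed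

lemma B_slice_right: "b \<in> B \<Longrightarrow> (\<lambda>y. \<Delta> b (x, y)) \<in> B"
proof (erule B_comultE)
  fix n :: nat and us vs
  assume *: "\<And>i. i < n \<Longrightarrow> vs i \<in> B" "\<Delta> b = (\<lambda>(x, y). \<Sum>i<n. us i x * vs i y)"
  have "(\<lambda>y. \<Sum>i<n. us i x * vs i y) \<in> B" by (rule B_sum) (use * in auto)
  then show ?thesis by (simp add: *)
qed

text \<open>The integral of \<open>B\<close> is the character of the regular representation of the dual of \<open>B\<close>, i.e. the
  trace over \<open>B\<close> of the second leg of the comultiplication. Its invariance is the cyclicity
  of the trace together with \<open>S(h\<^sub>2) h\<^sub>1 = \<epsilon>(h)\<close>.\<close>

lemma ex_right_integral:
  "\<exists>\<Lambda>\<in>B. gcounit G \<Lambda> = 1 \<and> (\<forall>b\<in>B. gmult G \<Lambda> b = (\<lambda>x. gcounit G b * \<Lambda> x))"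
proof -
  have out: "b x = 0" if "b \<in> B" "x \<notin> C" for b x
    using B_galg[OF that(1)] that(2) by (simp add: galg_def)
  have "\<exists>Y bas. Y \<subseteq> C \<and> (\<forall>y\<in>Y. bas y \<in> B \<and> (\<forall>z\<in>Y. bas y z = (if z = y then 1 else 0))) \<and>
    (\<forall>b\<in>B. \<forall>x. b x = (\<Sum>y\<in>Y. b y * bas y x))"
    by (rule ex_evaluation_dual_basis) (simp_all add: out B_add B_scale B_zero)
  then obtain Y bas where YC: "Y \<subseteq> C" and bas: "\<And>y. y \<in> Y \<Longrightarrow> bas y \<in> B"
    "\<And>y z. y \<in> Y \<Longrightarrow> z \<in> Y \<Longrightarrow> bas y z = (if z = y then 1 else 0)"
    and expand: "\<And>b x. b \<in> B \<Longrightarrow> b x = (\<Sum>y\<in>Y. b y * bas y x)"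
    by metis
  have finY: "finite Y" using YC finite_carrier by (rule finite_subset)
  \<comment> \<open>Partial trace: the diagonal entries, in the dual basis, of the second leg of the
    coproduct.\<close>
  define L where "L x = (\<Sum>y\<in>Y. 1 * \<Delta> (bas y) (x, y))" for x
  have LB: "L \<in> B" unfolding L_def by (rule B_sum) (auto intro: finY B_slice_left bas)
  \<comment> \<open>The counit on the first leg leaves the trace of the identity, that is the
    dimension of \<open>B\<close>, which is invertible in characteristic zero.\<close>
  have epsL: "gcounit G L = of_nat (card Y)"
  proof -
    have "gcounit G L = (\<Sum>y\<in>Y. \<Sum>x\<in>C. \<Delta> (bas y) (x, y))"
      unfolding gcounit_def L_def by (subst sum.swap) simp
    also have "\<dots> = (\<Sum>y\<in>Y. 1)"
      by (intro sum.cong refl) (simp add: tw_comult_counit_left B_galg bas)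
    finally show ?thesis by simp
  qed
  have "Y \<noteq> {}"
  proof
    assume "Y = {}"
    then have "gunit G \<one> = (0::'k)" using expand[OF B_gunit] by simp
    then show False by (simp add: gunit_def gdelta_def)
  qed
  then have epsL_nz: "gcounit G L \<noteq> 0" using epsL finY by simp
  have inv: "gmult G L h x = gcounit G h * L x" if h: "h \<in> B" for h x
  proof -
    obtain n :: nat and us vs where us: "\<And>i. i < n \<Longrightarrow> us i \<in> B" and vs: "\<And>i. i < n \<Longrightarrow> vs i \<in> B"
      and T: "\<Delta> h = (\<lambda>(x, y). \<Sum>i<n. us i x * vs i y)"
      using B_comultE[OF h] by blast
    \<comment> \<open>Matrices over \<open>Y\<close>: \<open>M\<close> and \<open>N\<close> are
      right multiplication by the first leg of \<open>h\<close> and by the antipode of the second,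
      and \<open>W\<close> holds the slices at \<open>x\<close> of the coproducts of the
      basis.\<close>
    define W where "W y' z = \<Delta> (bas y') (x, z)" for y' z
    define M where "M i y y' = gmult G (bas y) (us i) y'" for i y y'
    define N where "N i z y = gmult G (bas z) (tw_antipode G J (vs i)) y" for i z y
    have WB: "W y' \<in> B" if "y' \<in> Y" for y' unfolding W_def using bas(1)[OF that] by (rule B_slice_right)
    have step: "gmult G (\<lambda>z. \<Delta> (gmult G (bas y) (us i)) (x, z)) (tw_antipode G J (vs i)) y =
       (\<Sum>y'\<in>Y. \<Sum>z\<in>Y. W y' z * (N i z y * M i y y'))" if i: "i < n" and y: "y \<in> Y" for i y
    proof -
      have "gmult G (bas y) (us i) \<in> B" using bas us i y by (intro B_gmult)
      then have "gmult G (bas y) (us i) = (\<lambda>x. \<Sum>y'\<in>Y. M i y y' * bas y' x)"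
        unfolding M_def by (intro ext expand)
      then have "(\<lambda>z. \<Delta> (gmult G (bas y) (us i)) (x, z)) = (\<lambda>z. \<Sum>y'\<in>Y. M i y y' * W y' z)"
        by (simp add: tw_comult_linear B_galg bas W_def)
      moreover have "gmult G (W y') f y = (\<Sum>z\<in>Y. W y' z * gmult G (bas z) f y)" if "y' \<in> Y" for y' f
      proof -
        have "W y' = (\<lambda>x. \<Sum>z\<in>Y. W y' z * bas z x)" by (intro ext expand WB that)
        then have "gmult G (W y') f = gmult G (\<lambda>x. \<Sum>z\<in>Y. W y' z * bas z x) f" by simp
        then show ?thesis by (simp add: gmult_sum_left)
      qed
      ultimately show ?thesis
        by (simp add: gmult_sum_left N_def sum_distrib_left) (simp only: mult_ac)
    qed
    \<comment> \<open>Composed in the other order, as cyclicity of the trace permits, the two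
      matrices give right multiplication by S(h2) h1.\<close>
    have trace: "(\<Sum>y\<in>Y. N i z y * M i y y') = gmult G (bas z) (gmult G (tw_antipode G J (vs i)) (us i)) y'"
      if i: "i < n" and z: "z \<in> Y" for i z y'
    proof -
      let ?f = "gmult G (bas z) (tw_antipode G J (vs i))"
      have "?f \<in> B" using bas vs i z by (intro B_gmult B_antipode)
      then have "?f = (\<lambda>x. \<Sum>y\<in>Y. N i z y * bas y x)" unfolding N_def by (intro ext expand)
      then have "gmult G ?f (us i) y' = (\<Sum>y\<in>Y. N i z y * M i y y')"
        by (simp add: gmult_sum_left M_def)
      then show ?thesis by (simp add: gmult_assoc)
    qed
    have S: "(\<Sum>i<n. gmult G (tw_antipode G J (vs i)) (us i) x) = gcounit G h * gunit G x" for x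
    proof -
      have "gmult G (tw_antipode G J (vs i)) (us i) x =
         (\<Sum>u\<in>C. \<Sum>v\<in>C. us i u * vs i v * gmult G (anti v) (gdelta u) x)" if "i < n" for i
      proof -
        have "gmult G (tw_antipode G J (vs i)) (us i) x =
          gmult G (\<lambda>x. \<Sum>v\<in>C. vs i v * anti v x) (\<lambda>x. \<Sum>u\<in>C. us i u * gdelta u x) x"
          using us[OF that] by (simp add: tw_antipode_eq galg_sum_gdelta B_galg)
        also have "\<dots> = (\<Sum>v\<in>C. \<Sum>u\<in>C. vs i v * us i u * gmult G (anti v) (gdelta u) x)"
          by (rule sum_sum_gmult[symmetric])
        also have "\<dots> = (\<Sum>u\<in>C. \<Sum>v\<in>C. vs i v * us i u * gmult G (anti v) (gdelta u) x)"
          by (rule sum.swap)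
        finally show ?thesis by (simp add: mult.commute)
      qed
      then have "(\<Sum>i<n. gmult G (tw_antipode G J (vs i)) (us i) x) =
         (\<Sum>i<n. \<Sum>u\<in>C. \<Sum>v\<in>C. us i u * vs i v * gmult G (anti v) (gdelta u) x)" by simp
      also have "\<dots> = (\<Sum>u\<in>C. \<Sum>v\<in>C. \<Delta> h (u, v) * gmult G (anti v) (gdelta u) x)"
        by (rule sum_tensor[OF T, symmetric])
      finally show ?thesis using tw_comult_anti_op[OF B_galg[OF h]] by simp
    qed
    have trace_sum: "(\<Sum>i<n. \<Sum>y\<in>Y. N i z y * M i y y') = gcounit G h * bas z y'" if z: "z \<in> Y" for z y'
    proof -
      have "(\<Sum>i<n. \<Sum>y\<in>Y. N i z y * M i y y') =
         gmult G (bas z) (\<lambda>x. \<Sum>i<n. 1 * gmult G (tw_antipode G J (vs i)) (us i) x) y'"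
        unfolding gmult_sum_right using z by (simp add: trace)
      then show ?thesis using z by (simp add: S gmult_scale_right B_galg bas)
    qed
    have "gmult G L h x = (\<Sum>y\<in>Y. gmult G (\<lambda>x. \<Delta> (bas y) (x, y)) h x)"
      unfolding L_def gmult_sum_left by simp
    also have "\<dots> = (\<Sum>y\<in>Y. \<Sum>i<n. \<Sum>y'\<in>Y. \<Sum>z\<in>Y. W y' z * (N i z y * M i y y'))"
      using us h by (intro sum.cong refl)
        (simp add: slice_identity[OF _ _ T] B_galg step)
    also have "\<dots> = (\<Sum>i<n. \<Sum>y\<in>Y. \<Sum>y'\<in>Y. \<Sum>z\<in>Y. W y' z * (N i z y * M i y y'))"
      by (rule sum.swap)
    also have "\<dots> = (\<Sum>p\<in>{..<n}\<times>Y. \<Sum>t\<in>Y\<times>Y. W (fst t) (snd t) *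
        (N (fst p) (snd t) (snd p) * M (fst p) (snd p) (fst t)))"
      by (simp add: sum_Times)
    also have "\<dots> = (\<Sum>t\<in>Y\<times>Y. \<Sum>p\<in>{..<n}\<times>Y. W (fst t) (snd t) *
        (N (fst p) (snd t) (snd p) * M (fst p) (snd p) (fst t)))"
      by (rule sum.swap)
    also have "\<dots> = (\<Sum>y'\<in>Y. \<Sum>z\<in>Y. W y' z * (\<Sum>i<n. \<Sum>y\<in>Y. N i z y * M i y y'))"
      by (simp add: sum_Times sum_distrib_left)
    also have "\<dots> = (\<Sum>y'\<in>Y. \<Sum>z\<in>Y. if z = y' then gcounit G h * W y' y' else 0)"
      by (intro sum.cong refl) (auto simp: trace_sum bas(2))
    also have "\<dots> = gcounit G h * L x"
      using finY by (simp add: sum.delta L_def W_def sum_distrib_left)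
    finally show ?thesis .
  qed
  define \<Lambda> where "\<Lambda> x = inverse (gcounit G L) * L x" for x
  have "\<Lambda> \<in> B" unfolding \<Lambda>_def using LB by (rule B_scale)
  moreover have "gcounit G \<Lambda> = 1"
    using epsL_nz by (simp add: \<Lambda>_def gcounit_def flip: sum_distrib_left)
  moreover have "gmult G \<Lambda> b = (\<lambda>x. gcounit G b * \<Lambda> x)" if "b \<in> B" for b
    unfolding \<Lambda>_def gmult_scale_left using inv[OF that] by (simp add: mult_ac)
  ultimately show ?thesis by blast
qed

text \<open>Normality only yields \<open>\<Lambda> g \<Lambda> = \<Lambda> g\<close>. The other half, \<open>\<Lambda> g \<Lambda> = g \<Lambda>\<close>, follows because the coefficient
  of \<open>1\<close> in a product is a nondegenerate trace form on the group algebra.\<close>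

lemma integral_central:
  assumes LB: "\<Lambda> \<in> B" and eps: "gcounit G \<Lambda> = 1"
    and int: "\<And>b. b \<in> B \<Longrightarrow> gmult G \<Lambda> b = (\<lambda>x. gcounit G b * \<Lambda> x)" and g: "g \<in> C"
  shows "gmult G (gdelta g) \<Lambda> = gmult G \<Lambda> (gdelta g)"
proof -
  have sandwich: "gmult G \<Lambda> (gmult G (gdelta g) \<Lambda>) = gmult G \<Lambda> (gdelta g)" if g: "g \<in> C" for g
  proof (rule ext)
    fix x
    have "gmult G \<Lambda> (gmult G (gdelta g) \<Lambda>) x = (\<Sum>u\<in>C. \<Sum>v\<in>C.
      D g u v * gmult G (gmult G \<Lambda> (tw_adjoint G J (gdelta u) \<Lambda>)) (gdelta v) x)"
      by (subst gdelta_mult_eq_adjoint[OF g B_galg[OF LB]]) (simp add: gmult_sum2_right gmult_assoc)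
    also have "\<dots> = (\<Sum>u\<in>C. \<Sum>v\<in>C. D g u v * gmult G \<Lambda> (gdelta v) x)"
      using LB eps by (intro sum.cong refl) (simp add: int B_adjoint gcounit_tw_adjoint)
    also have "\<dots> = gmult G \<Lambda> (gdelta g) x" using g by (rule sum_D_counit_left)
    finally show "gmult G \<Lambda> (gmult G (gdelta g) \<Lambda>) x = gmult G \<Lambda> (gdelta g) x" .
  qed
  have "gmult G (gdelta g) \<Lambda> x = gmult G \<Lambda> (gdelta g) x" for x
  proof (cases "x \<in> C")
    case x: True
    \<comment> \<open>The coefficient of \<open>x\<close> is read as a coefficient of the unit,
      where the outer \<Lambda> can be moved cyclically to the right; the sandwich identity for the
      inverse of \<open>x\<close> then absorbs it.\<close>
    have ev: "f x = gmult G f (gdelta (inv x)) \<one>" for f :: "'a \<Rightarrow> 'k"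
      using x by (simp add: gmult_gdelta)
    let ?k = "gdelta (inv x) :: 'a \<Rightarrow> 'k"
    have "gmult G \<Lambda> (gdelta g) x = gmult G (gmult G \<Lambda> (gmult G (gdelta g) \<Lambda>)) ?k \<one>"
      by (subst ev) (simp add: sandwich g)
    also have "\<dots> = gmult G \<Lambda> (gmult G (gmult G (gdelta g) \<Lambda>) ?k) \<one>"
      by (simp add: gmult_assoc)
    also have "\<dots> = gmult G (gmult G (gmult G (gdelta g) \<Lambda>) ?k) \<Lambda> \<one>"
      by (rule gmult_one_commute)
    also have "\<dots> = gmult G (gdelta g) (gmult G \<Lambda> (gmult G ?k \<Lambda>)) \<one>"
      by (simp add: gmult_assoc)
    also have "\<dots> = gmult G (gmult G (gdelta g) \<Lambda>) ?k \<one>"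
      using x by (simp add: sandwich gmult_assoc)
    also have "\<dots> = gmult G (gdelta g) \<Lambda> x" by (rule ev[symmetric])
    finally show ?thesis ..
  qed (simp add: gmult_outside)
  then show ?thesis by blast
qed

lemma integral_normal_subgroup:
  obtains N c where "N \<lhd> G" "c \<noteq> 0" "(\<lambda>x. if x \<in> N then c else 0) \<in> B"
    "gcounit G (\<lambda>x. if x \<in> N then c else 0) = 1"
    "\<And>b. b \<in> B \<Longrightarrow> gmult G (\<lambda>x. if x \<in> N then c else 0) b = (\<lambda>x. gcounit G b * (if x \<in> N then c else 0))"
proof -
  obtain \<Lambda> where LB: "\<Lambda> \<in> B" and eps: "gcounit G \<Lambda> = 1"
    and int: "\<And>b. b \<in> B \<Longrightarrow> gmult G \<Lambda> b = (\<lambda>x. gcounit G b * \<Lambda> x)"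
    using ex_right_integral by blast
  have Lg: "\<Lambda> \<in> galg G" using LB by (rule B_galg)
  have central: "gmult G (gdelta g) \<Lambda> = gmult G \<Lambda> (gdelta g)" if "g \<in> C" for g
    using LB eps int that by (rule integral_central)
  obtain n :: nat and us vs where us: "\<And>i. i < n \<Longrightarrow> us i \<in> B" and vs: "\<And>i. i < n \<Longrightarrow> vs i \<in> B"
    and T: "\<Delta> \<Lambda> = (\<lambda>(x, y). \<Sum>i<n. us i x * vs i y)"
    using B_comultE[OF LB] by blast
  have T': "\<Delta> \<Lambda> = (\<lambda>t. \<Sum>i<n. 1 * tens (us i) (vs i) t)"
    unfolding T by (auto simp: tens_def)
  have "tmult G (tens (gunit G) \<Lambda>) (\<Delta> \<Lambda>) = tens \<Lambda> \<Lambda>"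
  proof (rule ext, clarify)
    fix x y
    have "tmult G (tens (gunit G) \<Lambda>) (\<Delta> \<Lambda>) (x, y) = (\<Sum>i<n. us i x * gcounit G (vs i)) * \<Lambda> y"
      unfolding T' tmult_sum_right tmult_tens sum_distrib_right using us vs
      by (intro sum.cong refl) (simp add: int B_galg tens_def)
    also have "(\<Sum>i<n. us i x * gcounit G (vs i)) = (\<Sum>y\<in>C. \<Delta> \<Lambda> (x, y))"
      unfolding T gcounit_def sum_distrib_left prod.case by (rule sum.swap)
    also have "\<dots> = \<Lambda> x" using Lg by (rule tw_comult_counit_right)
    finally show "tmult G (tens (gunit G) \<Lambda>) (\<Delta> \<Lambda>) (x, y) = tens \<Lambda> \<Lambda> (x, y)"
      by (simp add: tens_def)
  qed
  then have "tmult G (tens (gunit G) \<Lambda>) (gcomult \<Lambda>) = tmult G (tmult G J (tens \<Lambda> \<Lambda>)) Ji"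
    unfolding gcomult_eq_tw_comult[OF Lg]
    by (simp add: tmult_assoc[symmetric] tens_central[OF twist_of_in_galg gunit_central central, symmetric])
       (simp add: tmult_assoc)
  also have "\<dots> = tmult G (tens \<Lambda> \<Lambda>) (tmult G J Ji)"
    by (simp add: tens_central[OF twist_of_in_galg central central] tmult_assoc)
  also have "\<dots> = tens \<Lambda> \<Lambda>"
    using Lg by (simp add: J_Ji tens_in_galg)
  finally have grouplike: "tmult G (tens (gunit G) \<Lambda>) (gcomult \<Lambda>) = tens \<Lambda> \<Lambda>" .
  \<comment> \<open>Coefficients at (x, y) of the identity just obtained. They show that the support
    of \<Lambda> is closed under division, and the case y = x that \<Lambda> is constant on
    it.\<close>
  have key: "\<Lambda> (y \<otimes> inv x) * \<Lambda> x = \<Lambda> x * \<Lambda> y" if xy: "x \<in> C" "y \<in> C" for x y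
  proof -
    have "tmult G (tens (gunit G) \<Lambda>) (gcomult \<Lambda>) (x, y) = (\<Sum>a\<in>C. \<Sum>b\<in>C.
       if a = \<one> then (if b = y \<otimes> inv x then \<Lambda> b * \<Lambda> x else 0) else 0)"
    proof -
      have "x = inv b \<otimes> y \<longleftrightarrow> b = y \<otimes> inv x" if "b \<in> C" for b
        using that xy by (metis inv_closed inv_inv inv_solve_left inv_solve_right m_closed)
      then show ?thesis using xy
        unfolding tmult_def tens_def gcomult_def prod.case
        by (simp only: simp_thms if_True) (intro sum.cong refl, auto simp: gunit_def gdelta_def)
    qed
    also have "\<dots> = \<Lambda> (y \<otimes> inv x) * \<Lambda> x"
      using xy by (subst sum.swap) (simp add: sum.delta)
    finally show ?thesis unfolding grouplike by (simp only: tens_def prod.case)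
  qed
  define N where "N = {x \<in> C. \<Lambda> x \<noteq> 0}"
  have "\<exists>x\<in>C. \<Lambda> x \<noteq> 0"
  proof (rule ccontr)
    assume "\<not> ?thesis"
    then have "gcounit G \<Lambda> = 0" by (simp add: gcounit_def)
    then show False using eps by simp
  qed
  then have one: "\<Lambda> \<one> \<noteq> 0" using key by force
  have inv_N: "inv x \<in> N" if "x \<in> N" for x
    using key[of x \<one>] that one by (auto simp: N_def)
  have const: "\<Lambda> x = \<Lambda> \<one>" if "x \<in> N" for x
    using key[of x x] that by (auto simp: N_def)
  have mult_N: "x \<otimes> y \<in> N" if "x \<in> N" "y \<in> N" for x y
    using key[of "inv y" x] that inv_N[OF that(2)] by (auto simp: N_def)
  have sub: "subgroup N G"
    by (rule subgroup.intro) (use one inv_N mult_N in \<open>auto simp: N_def\<close>)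
  have conj: "g \<otimes> m \<otimes> inv g \<in> N" if g: "g \<in> C" and m: "m \<in> N" for g m
  proof -
    have mC: "m \<in> C" using m by (simp add: N_def)
    have "\<Lambda> (inv g \<otimes> (g \<otimes> m)) = \<Lambda> (g \<otimes> m \<otimes> inv g)"
      using fun_cong[OF central[OF g], of "g \<otimes> m"] g mC by (simp add: gdelta_gmult gmult_gdelta)
    then show ?thesis using g m mC by (simp add: N_def m_assoc[symmetric])
  qed
  have normal: "N \<lhd> G" using sub conj by (simp add: normal_inv_iff)
  have L: "\<Lambda> = (\<lambda>x. if x \<in> N then \<Lambda> \<one> else 0)"
    using const Lg by (auto simp: fun_eq_iff N_def galg_def)
  show thesis
    by (rule that[OF normal one, folded L]) (use LB eps int fun_cong[OF L] in auto)
qed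

text \<open>For a multiple of the unit the integral property reads b = \<epsilon>(b) 1.\<close>

lemma trivial_if_integral_trivial:
  assumes int: "\<And>b. b \<in> B \<Longrightarrow> gmult G (\<lambda>x. c * gunit G x) b = (\<lambda>x. gcounit G b * (c * gunit G x))"
    and c: "c \<noteq> 0"
  shows "B = {(\<lambda>x. a * gunit G x) |a. True}"
proof -
  have "b = (\<lambda>x. gcounit G b * gunit G x)" if b: "b \<in> B" for b
  proof (rule ext)
    fix x
    have "c * b x = gcounit G b * (c * gunit G x)"
      using fun_cong[OF int[OF b], of x] B_galg[OF b] by (simp add: gmult_scale_left)
    then show "b x = gcounit G b * gunit G x" using c by (simp add: mult.left_commute)
  qed
  then show ?thesis using B_scale[OF B_gunit] by blast
qed

text \<open>The integral absorbs group elements, so moving \<open>a\<close> across its coproduct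
  gives \<Delta>(L) (a \<otimes> 1) = \<Delta>(L) (1 \<otimes> S(a)). At the unit in the second leg
  the left side is \<open>c\<close> times \<open>a\<close>, because \<Delta>(L) has there the slice
  \<open>c\<close> times the unit. The right side is a combination of slices of \<Delta>(L), which
  lie in \<open>B\<close>.\<close>

lemma full_if_integral_full:
  assumes LB: "(\<lambda>x. if x \<in> C then c else 0) \<in> B" and c: "c \<noteq> 0"
  shows "B = galg G"
proof
  show "B \<subseteq> galg G" using B_galg by blast
  show "galg G \<subseteq> B"
  proof
    fix a :: "'a \<Rightarrow> 'k" assume a: "a \<in> galg G"
    define L where "L = (\<lambda>x. if x \<in> C then c else 0)"
    have LB: "L \<in> B" using LB by (simp add: L_def)
    have Lu: "gmult G L (gdelta u) = L" if "u \<in> C" for u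
      using that by (auto simp: fun_eq_iff L_def gmult_gdelta gmult_outside)
    have "(\<lambda>x. c * a x) = (\<lambda>x. \<Sum>t\<in>(C\<times>C)\<times>C.
        \<Delta> a (fst t) * anti (snd (fst t)) (inv (snd t)) * \<Delta> L (x, snd t))"
    proof (rule ext)
      fix x
      have "\<Delta> L (x, \<one>) = (\<Sum>g\<in>C. c * D g x \<one>)" for x
        using LB by (subst tw_comult_expand) (auto simp: B_galg L_def intro!: sum.cong)
      then have "(\<lambda>x. \<Delta> L (x, \<one>)) = (\<lambda>x. c * gunit G x)"
        by (simp add: D_at_one sum.delta flip: sum_distrib_left)
      then have "c * a x = gmult G (\<lambda>x. \<Delta> L (x, \<one>)) a x"
        using a by (simp add: gmult_scale_left)
      also have "\<dots> = tmult G (\<Delta> L) (tens a (gunit G)) (x, \<one>)"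
        by (simp add: tmult_tens_gunit_right)
      also have "\<dots> = (\<Sum>u\<in>C. \<Sum>v\<in>C. \<Delta> a (u, v) *
          gmult G (\<lambda>y. \<Delta> L (x, y)) (anti v) \<one>)"
        by (subst tw_comult_tens_gunit[OF a]) (simp add: Lu tmult_tens_gunit_left)
      also have "\<dots> = (\<Sum>t\<in>(C\<times>C)\<times>C.
        \<Delta> a (fst t) * anti (snd (fst t)) (inv (snd t)) * \<Delta> L (x, snd t))"
        by (simp add: sum_Times gmult_def sum_distrib_left mult_ac)
      finally show "c * a x = (\<Sum>t\<in>(C\<times>C)\<times>C.
        \<Delta> a (fst t) * anti (snd (fst t)) (inv (snd t)) * \<Delta> L (x, snd t))" .
    qed
    moreover have "\<dots> \<in> B"
      by (rule B_sum) (auto intro: B_slice_left LB)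
    ultimately have "(\<lambda>x. c * a x) \<in> B" by simp
    then have "(\<lambda>x. inverse c * (c * a x)) \<in> B" by (rule B_scale)
    then show "a \<in> B" using c by (simp flip: mult.assoc)
  qed
qed

section \<open>Characters of the group that restrict to the counit on B\<close>

context
  fixes \<beta> :: "'a \<Rightarrow> 'k" and \<chi> :: "'a \<Rightarrow> 'k" and t :: 'a
  assumes hom: "\<And>x y. x \<in> C \<Longrightarrow> y \<in> C \<Longrightarrow> \<beta> (x \<otimes> y) = \<beta> x * \<beta> y"
    and \<chi>X: "\<chi> \<in> X" and \<chi>: "\<And>h. h \<in> H \<Longrightarrow> \<chi> h = \<beta> h"
    and t: "t \<in> H" "\<And>\<alpha>. \<alpha> \<in> X \<Longrightarrow> \<alpha> t = \<omega> \<alpha> \<chi> / \<omega> \<chi> \<alpha>"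
    and eps: "\<And>b. b \<in> B \<Longrightarrow> (\<Sum>x\<in>C. \<beta> x * b x) = gcounit G b"
begin

text \<open>Slices of \<Delta>(b) lie in \<open>B\<close>, where \<beta> is the counit, so \<beta>
  on either leg returns \<open>b\<close>. In weight \<open>k\<close> this expresses one component
  through two scalars, one for each leg.\<close>

lemma bicomp_sum_char:
  assumes b: "b \<in> B" and k: "k \<in> XX"
  shows "(\<Sum>u\<in>C. b u * bicomp k u x) =
      \<sigma> k (\<chi>, \<chi>) * (\<Sum>g\<in>C. b g * \<beta> g * bicomp k g x)"
    and "(\<Sum>u\<in>C. b u * bicomp k u x) =
      \<sigma> (\<chi>, \<chi>) k * (\<Sum>g\<in>C. b g * \<beta> g * bicomp k g x)"
proof -
  have bg: "b \<in> galg G" using b by (rule B_galg)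
  have right: "b x = (\<Sum>g\<in>C. b g * \<beta> g * (\<Sum>i\<in>XX. \<sigma> i (\<chi>, \<chi>) * bicomp i g x))" for x
  proof -
    have "b x = (\<Sum>y\<in>C. \<Delta> b (x, y) * \<beta> y)"
      using eps[OF B_slice_right[OF b]] tw_comult_counit_right[OF bg] by (simp add: gcounit_def mult.commute)
    also have "\<dots> = (\<Sum>y\<in>C. \<Sum>g\<in>C. b g * (D g x y * \<beta> y))"
      using bg by (simp add: tw_comult_expand sum_distrib_right mult.assoc)
    also have "\<dots> = (\<Sum>g\<in>C. \<Sum>y\<in>C. b g * (D g x y * \<beta> y))"
      by (rule sum.swap)
    also have "\<dots> = (\<Sum>g\<in>C. b g * \<beta> g * (\<Sum>i\<in>XX. \<sigma> i (\<chi>, \<chi>) * bicomp i g x))"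
      using sum_D_char_right[OF _ \<chi>X \<chi> hom]
      by (intro sum.cong refl) (simp add: sum_distrib_left[symmetric])
    finally show ?thesis .
  qed
  have left: "b y = (\<Sum>g\<in>C. b g * \<beta> g * (\<Sum>i\<in>XX. \<sigma> (\<chi>, \<chi>) i * bicomp i g y))" for y
  proof -
    have "b y = (\<Sum>x\<in>C. \<Delta> b (x, y) * \<beta> x)"
      using eps[OF B_slice_left[OF b]] tw_comult_counit_left[OF bg] by (simp add: gcounit_def mult.commute)
    also have "\<dots> = (\<Sum>x\<in>C. \<Sum>g\<in>C. b g * (D g x y * \<beta> x))"
      using bg by (simp add: tw_comult_expand sum_distrib_right mult.assoc)
    also have "\<dots> = (\<Sum>g\<in>C. \<Sum>x\<in>C. b g * (D g x y * \<beta> x))"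
      by (rule sum.swap)
    also have "\<dots> = (\<Sum>g\<in>C. b g * \<beta> g * (\<Sum>i\<in>XX. \<sigma> (\<chi>, \<chi>) i * bicomp i g y))"
      using sum_D_char_left[OF _ \<chi>X \<chi> hom]
      by (intro sum.cong refl) (simp add: sum_distrib_left[symmetric])
    finally show ?thesis .
  qed
  have proj: "(\<Sum>u\<in>C. (\<Sum>g\<in>C. a g * (\<Sum>i\<in>XX. s i * bicomp i g u)) * bicomp k u x) =
      s k * (\<Sum>g\<in>C. a g * bicomp k g x)" for a :: "'a \<Rightarrow> 'k" and s
  proof -
    have "(\<Sum>u\<in>C. (\<Sum>g\<in>C. a g * (\<Sum>i\<in>XX. s i * bicomp i g u)) * bicomp k u x) =
      (\<Sum>u\<in>C. \<Sum>p\<in>C\<times>XX. a (fst p) * s (snd p) * (bicomp (snd p) (fst p) u * bicomp k u x))"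
      by (simp add: sum_Times[of _ "C"] sum_distrib_left sum_distrib_right mult.assoc)
    also have "\<dots> = (\<Sum>p\<in>C\<times>XX. \<Sum>u\<in>C. a (fst p) * s (snd p) * (bicomp (snd p) (fst p) u * bicomp k u x))"
      by (rule sum.swap)
    also have "\<dots> = (\<Sum>g\<in>C. \<Sum>i\<in>XX. a g * s i * (\<Sum>u\<in>C. bicomp i g u * bicomp k u x))"
      by (simp add: sum_Times[of _ "C"] sum_distrib_left)
    also have "\<dots> = (\<Sum>g\<in>C. \<Sum>i\<in>XX. if i = k then s k * (a g * bicomp k g x) else 0)"
    proof (intro sum.cong refl)
      fix g i assume gi: "g \<in> C" "i \<in> XX"
      have "(\<Sum>u\<in>C. bicomp i g u * bicomp k u x) = (if i = (fst k, snd k) then bicomp k g x else 0)"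
        using gi k by (intro sum_bicomp_mult) (auto simp: bicomp_translate)
      then show "a g * s i * (\<Sum>u\<in>C. bicomp i g u * bicomp k u x) =
         (if i = k then s k * (a g * bicomp k g x) else 0)" by simp
    qed
    also have "\<dots> = s k * (\<Sum>g\<in>C. a g * bicomp k g x)"
      using k by (simp add: sum.delta sum_distrib_left)
    finally show ?thesis .
  qed
  show "(\<Sum>u\<in>C. b u * bicomp k u x) = \<sigma> k (\<chi>, \<chi>) * (\<Sum>g\<in>C. b g * \<beta> g * bicomp k g x)"
    using proj[of "\<lambda>g. b g * \<beta> g" "\<lambda>i. \<sigma> i (\<chi>, \<chi>)"] by (simp only: right[symmetric])
  show "(\<Sum>u\<in>C. b u * bicomp k u x) = \<sigma> (\<chi>, \<chi>) k * (\<Sum>g\<in>C. b g * \<beta> g * bicomp k g x)"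
    using proj[of "\<lambda>g. b g * \<beta> g" "\<lambda>i. \<sigma> (\<chi>, \<chi>) i"] by (simp only: left[symmetric])
qed

text \<open>A component of weight (\<alpha>, \<gamma>) commutes with \<open>t\<close> if \<alpha>(t)
  = \<gamma>(t). In every other weight the scalars of the two legs differ, which forces the
  component of \<open>b\<close> to vanish.\<close>

lemma B_commutes:
  assumes b: "b \<in> B"
  shows "gmult G (gdelta t) b = gmult G b (gdelta t)"
proof (rule ext)
  fix x
  let ?A = "\<lambda>k x. \<Sum>g\<in>C. b g * bicomp k g x"
  have tC: "t \<in> C" using t by simp
  have bx: "b = (\<lambda>x. \<Sum>p\<in>C\<times>XX. b (fst p) * bicomp (snd p) (fst p) x)"
    by (rule ext, subst sum_Times)
       (simp add: sum_distrib_left[symmetric] sum_all_bicomp galg_sum_gdelta[OF B_galg[OF b]])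
  have lt: "gmult G (gdelta t) (bicomp k g) x = fst k t * bicomp k g x"
    and rt: "gmult G (bicomp k g) (gdelta t) x = snd k t * bicomp k g x"
    if "g \<in> C" "k \<in> XX" for g k
  proof -
    have "gmult G (gdelta t) (bicomp k g) = gmult G (gmult G (gmult G (gdelta t) (e (fst k))) (gdelta g)) (e (snd k))"
      using that by (simp add: bicomp_eq gmult_assoc)
    also have "gmult G (gdelta t) (e (fst k)) = (\<lambda>x. fst k t * e (fst k) x)"
      using that t by (intro gdelta_e) auto
    finally show "gmult G (gdelta t) (bicomp k g) x = fst k t * bicomp k g x"
      using that by (simp add: gmult_scale_left bicomp_eq)
    have "gmult G (bicomp k g) (gdelta t) = gmult G (gmult G (e (fst k)) (gdelta g)) (gmult G (e (snd k)) (gdelta t))"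
      using that by (simp add: bicomp_eq gmult_assoc)
    also have "gmult G (e (snd k)) (gdelta t) = (\<lambda>x. snd k t * e (snd k) x)"
      using that t by (intro e_gdelta) auto
    finally show "gmult G (bicomp k g) (gdelta t) x = snd k t * bicomp k g x"
      using that by (simp add: gmult_scale_right bicomp_eq)
  qed
  have "gmult G (gdelta t) b x = (\<Sum>p\<in>C\<times>XX. b (fst p) * gmult G (gdelta t) (bicomp (snd p) (fst p)) x)"
    by (subst bx) (simp only: gmult_sum_right)
  also have "\<dots> = (\<Sum>g\<in>C. \<Sum>k\<in>XX. b g * (fst k t * bicomp k g x))"
    by (subst sum_Times) (intro sum.cong refl, simp add: lt)
  also have "\<dots> = (\<Sum>k\<in>XX. fst k t * ?A k x)"
    by (subst sum.swap) (simp add: sum_distrib_left mult.left_commute)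
  also have "\<dots> = (\<Sum>k\<in>XX. snd k t * ?A k x)"
  proof (intro sum.cong refl)
    fix k assume k: "k \<in> XX"
    let ?A' = "\<Sum>g\<in>C. b g * \<beta> g * bicomp k g x"
    show "fst k t * ?A k x = snd k t * ?A k x"
    proof (cases "?A' = 0")
      case True
      then show ?thesis using bicomp_sum_char(1)[OF b k, of x] by simp
    next
      case False
      then have "\<sigma> k (\<chi>, \<chi>) = \<sigma> (\<chi>, \<chi>) k"
        using bicomp_sum_char[OF b k, of x] by simp
      then have "fst k t = snd k t"
        using k \<chi>X by (auto simp: \<sigma>_def t(2) field_simps)
      then show ?thesis by simp
    qed
  qed
  also have "\<dots> = (\<Sum>g\<in>C. \<Sum>k\<in>XX. b g * (snd k t * bicomp k g x))"
    by (subst sum.swap) (simp add: sum_distrib_left mult.left_commute)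
  also have "\<dots> = (\<Sum>p\<in>C\<times>XX. b (fst p) * gmult G (bicomp (snd p) (fst p)) (gdelta t) x)"
    by (subst sum_Times) (intro sum.cong refl, simp add: rt)
  also have "\<dots> = gmult G b (gdelta t) x"
    by (subst (2) bx) (simp only: gmult_sum_left)
  finally show "gmult G (gdelta t) b x = gmult G b (gdelta t) x" .
qed

text \<open>Group elements in the support of \<open>b\<close> need not lie in \<open>B\<close>, but
  the first legs of \<Delta>(b) do, so t \<otimes> 1 commutes with \<Delta>(b). It also commutes
  with \<open>J\<close>, hence with the untwisted coproduct, the sum of all b(n) n \<otimes> n,
  whose terms are separated by the second leg.\<close>

lemma support_commutes:
  assumes b: "b \<in> B" and n: "n \<in> C" "b n \<noteq> 0"
  shows "t \<otimes> n = n \<otimes> t"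
proof -
  let ?t = "tens (gdelta t) (gunit G) :: 'a \<times> 'a \<Rightarrow> 'k"
  have tC: "t \<in> C" using t by simp
  obtain m :: nat and us vs where us: "\<And>i. i < m \<Longrightarrow> us i \<in> B" and vs: "\<And>i. i < m \<Longrightarrow> vs i \<in> B"
    and T: "\<Delta> b = (\<lambda>(x, y). \<Sum>i<m. us i x * vs i y)"
    using B_comultE[OF b] by blast
  have T': "\<Delta> b = (\<lambda>t. \<Sum>i<m. 1 * tens (us i) (vs i) t)"
    unfolding T by (auto simp: tens_def)
  have 1: "tmult G ?t (\<Delta> b) = tmult G (\<Delta> b) ?t"
    unfolding T' tmult_sum_left tmult_sum_right tmult_tens
    using us vs by (intro ext sum.cong refl) (simp add: B_commutes B_galg)
  have 2: "tmult G (twist_of G H w) ?t = tmult G ?t (twist_of G H w)"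
    for w :: "('a \<Rightarrow> 'k) \<Rightarrow> ('a \<Rightarrow> 'k) \<Rightarrow> 'k"
    using twist_of_commute[of t \<one> w] t by (simp add: gunit_def)
  have "tmult G ?t (gcomult b) = tmult G (tmult G ?t J) (tmult G (\<Delta> b) Ji)"
    by (simp add: gcomult_eq_tw_comult B_galg b tmult_assoc)
  also have "\<dots> = tmult G J (tmult G (tmult G ?t (\<Delta> b)) Ji)"
    by (simp add: 2[symmetric] tmult_assoc)
  also have "\<dots> = tmult G J (tmult G (\<Delta> b) (tmult G ?t Ji))"
    by (simp add: 1 tmult_assoc)
  also have "\<dots> = tmult G (gcomult b) ?t"
    by (simp add: 2[symmetric] gcomult_eq_tw_comult B_galg b tmult_assoc)
  finally have "tmult G ?t (gcomult b) (t \<otimes> n, n) = tmult G (gcomult b) ?t (t \<otimes> n, n)" by simp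
  then have "b n = gcomult b (t \<otimes> n \<otimes> inv t, n)"
    using tC n unfolding gunit_def
    by (simp add: gdelta_tmult tmult_gdelta) (simp add: gcomult_def flip: m_assoc)
  then have "gcomult b (t \<otimes> n \<otimes> inv t, n) \<noteq> 0" using n(2) by metis
  then have "t \<otimes> n \<otimes> inv t = n" by (auto simp: gcomult_def split: if_splits)
  then show ?thesis using tC n by (metis inv_solve_right' m_closed)
qed

end

end

text \<open>The passage from Hopf algebras to groups: what remains afterwards concerns a normal
  subgroup \<open>N\<close> and elements of \<open>H\<close> centralizing it. The retraction \<phi>
  is there to extend characters of \<open>H\<close> to the whole group.\<close>

lemma (in twist) normal_hopf_subalgebra_normal_subgroup:
  fixes q :: nat
  assumes closed: "alg_closed TYPE('k)" and q: "prime q" and card: "card H = q * q"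
    and exp: "\<And>h. h \<in> H \<Longrightarrow> h [^] q = \<one>" and nontriv: "\<not> coboundary G H \<omega>"
    and retr: "\<And>x. x \<in> C \<Longrightarrow> \<phi> x \<in> H" "\<And>h. h \<in> H \<Longrightarrow> \<phi> h = h"
      "\<And>x y. x \<in> C \<Longrightarrow> y \<in> C \<Longrightarrow> \<phi> (x \<otimes> y) = \<phi> x \<otimes> \<phi> y"
    and B: "normal_hopf_subalgebra G (twist_of G H \<omega>) B"
  obtains N where "N \<lhd> G" "N = {\<one>} \<Longrightarrow> B = {(\<lambda>x. a * gunit G x) |a. True}"
    "N = C \<Longrightarrow> B = galg G"
    "\<And>\<chi>. \<chi> \<in> X \<Longrightarrow> \<chi> \<noteq> triv \<Longrightarrow> (\<And>n. n \<in> N \<Longrightarrow> \<chi> (\<phi> n) = 1) \<Longrightarrow>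
      \<exists>t\<in>H. t \<noteq> \<one> \<and> \<chi> t = 1 \<and> (\<forall>n\<in>N. t \<otimes> n = n \<otimes> t)"
proof -
  interpret normal_hopf_sub G H X \<omega> B
    by unfold_locales (rule B)
  obtain N c where N: "N \<lhd> G" and c: "c \<noteq> 0"
    and LB: "(\<lambda>x. if x \<in> N then c else 0) \<in> B"
    and eps: "gcounit G (\<lambda>x. if x \<in> N then c else 0) = 1"
    and int: "\<And>b. b \<in> B \<Longrightarrow> gmult G (\<lambda>x. if x \<in> N then c else 0) b = (\<lambda>x. gcounit G b * (if x \<in> N then c else 0))"
    using integral_normal_subgroup by blast
  define L where "L = (\<lambda>x. if x \<in> N then c else 0)"
  note LB = LB[folded L_def] and eps = eps[folded L_def]
  have int: "gmult G L b = (\<lambda>x. gcounit G b * L x)" if "b \<in> B" for b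
    using int[OF that] by (simp only: L_def)
  have NC: "n \<in> C" if "n \<in> N" for n
    using N that by (meson normal_imp_subgroup subgroup.mem_carrier)
  show thesis
  proof (rule that[OF N])
    assume "N = {\<one>}"
    then have "L = (\<lambda>x. c * gunit G x)" by (auto simp: L_def gunit_def gdelta_def)
    then show "B = {(\<lambda>x. a * gunit G x) |a. True}"
      using int c by (intro trivial_if_integral_trivial[of c]) auto
  next
    assume "N = C"
    then show "B = galg G" using LB c by (intro full_if_integral_full[of c]) (auto simp: L_def)
  next
    fix \<chi> assume \<chi>: "\<chi> \<in> X" "\<chi> \<noteq> triv" and triv_N: "\<And>n. n \<in> N \<Longrightarrow> \<chi> (\<phi> n) = 1"
    obtain t where t: "t \<in> H" "\<And>\<alpha>. \<alpha> \<in> X \<Longrightarrow> \<alpha> t = \<omega> \<alpha> \<chi> / \<omega> \<chi> \<alpha>"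
      using ex_commutator_element[OF \<chi>(1)] by blast
    have "t \<noteq> \<one>"
    proof
      assume "t = \<one>"
      then have "\<omega> \<alpha> \<chi> = \<omega> \<chi> \<alpha>" if "\<alpha> \<in> X" for \<alpha>
        using t(2)[OF that] that \<chi>(1) by (simp add: char_one)
      then show False
        using coboundary_if_degenerate[OF closed q card exp \<chi>] nontriv by blast
    qed
    moreover have "\<chi> t = 1" using t(2)[OF \<chi>(1)] \<chi>(1) by simp
    moreover have "t \<otimes> n = n \<otimes> t" if n: "n \<in> N" for n
    proof (rule support_commutes[where \<beta> = "\<lambda>x. \<chi> (\<phi> x)" and \<chi> = \<chi> and b = L])
      fix x y assume "x \<in> C" "y \<in> C"
      then show "\<chi> (\<phi> (x \<otimes> y)) = \<chi> (\<phi> x) * \<chi> (\<phi> y)" using \<chi>(1) retr by (simp add: char_hom)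
    next
      fix b assume b: "b \<in> B"
      have hom: "\<chi> (\<phi> (x \<otimes> y)) = \<chi> (\<phi> x) * \<chi> (\<phi> y)" if "x \<in> C" "y \<in> C" for x y
        using that \<chi>(1) retr by (simp add: char_hom)
      \<comment> \<open>The extended character is trivial on \<open>N\<close>, so its value on the
        integral is 1. Applied to L b = \<epsilon>(b) L it then returns \<epsilon>(b) on
        \<open>b\<close>.\<close>
      have "(\<Sum>x\<in>C. \<chi> (\<phi> x) * L x) = gcounit G L"
        unfolding gcounit_def by (intro sum.cong refl) (auto simp: L_def triv_N)
      then have "(\<Sum>x\<in>C. \<chi> (\<phi> x) * b x) =
         (\<Sum>x\<in>C. \<chi> (\<phi> x) * L x) * (\<Sum>x\<in>C. \<chi> (\<phi> x) * b x)" using eps by simp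
      also have "\<dots> = (\<Sum>x\<in>C. \<chi> (\<phi> x) * gmult G L b x)"
        by (rule gcounit_gmult_char[symmetric]) (rule hom)
      also have "\<dots> = gcounit G b * (\<Sum>x\<in>C. \<chi> (\<phi> x) * L x)"
        by (simp add: int[OF b] sum_distrib_left mult.left_commute)
      also have "\<dots> = gcounit G b"
        using \<open>(\<Sum>x\<in>C. \<chi> (\<phi> x) * L x) = gcounit G L\<close> eps by simp
      finally show "(\<Sum>x\<in>C. \<chi> (\<phi> x) * b x) = gcounit G b" .
    qed (use \<chi> t n c NC retr LB in \<open>auto simp: L_def\<close>)
    ultimately show "\<exists>t\<in>H. t \<noteq> \<one> \<and> \<chi> t = 1 \<and> (\<forall>n\<in>N. t \<otimes> n = n \<otimes> t)" using t by blast
  qed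
qed

section \<open>Simplicity\<close>

text \<open>The order divides p * q. The value p * q is excluded because the whole group is not
  abelian, and \<open>p\<close> because only the unit has order dividing both \<open>p\<close> and
  \<open>q\<close>. It bounds the projections of \<open>H\<close>.\<close>

lemma abelian_exponent_subgroup_card:
  fixes G (structure)
  assumes "group G" and p: "prime p" and q: "prime q" and "q < p"
    and order: "card (carrier G) = p * q" and noncomm: "\<not> comm_group G"
    and sub: "subgroup K G" and comm: "\<And>x y. x \<in> K \<Longrightarrow> y \<in> K \<Longrightarrow> x \<otimes> y = y \<otimes> x"
    and exp: "\<And>x. x \<in> K \<Longrightarrow> x [^] q = \<one>"
  shows "card K = 1 \<or> card K = q"
proof -
  interpret group G by fact
  have fin: "finite (carrier G)" using order p q by (metis card.infinite mult_is_0 not_prime_0)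
  have KC: "x \<in> carrier G" if "x \<in> K" for x using sub that by (rule subgroup.mem_carrier)
  have finK: "finite K" using KC fin by (meson finite_subset subsetI)
  have "card K dvd p * q"
    using lagrange_finite[OF fin sub] order by (simp add: Coset.order_def) (metis dvd_triv_right)
  then obtain a b where ab: "card K = a * b" "a dvd p" "b dvd q" using division_decomp by blast
  then have ab': "a = 1 \<or> a = p" "b = 1 \<or> b = q" using p q by (auto simp: prime_nat_iff)
  have "card K \<noteq> p * q"
  proof
    assume "card K = p * q"
    then have "K = carrier G" using KC fin order by (intro card_subset_eq) auto
    then show False using comm noncomm by (auto intro: group_comm_groupI)
  qed
  moreover have "card K \<noteq> p"
  proof
    assume Kp: "card K = p"
    have "K \<subseteq> {\<one>}"
    proof
      fix x assume x: "x \<in> K"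
      interpret K: group "G\<lparr>carrier := K\<rparr>" using sub by (rule subgroup_imp_group)
      have "x [^]\<^bsub>G\<lparr>carrier := K\<rparr>\<^esub> p = \<one>"
        using K.pow_order_eq_1[of x] x Kp by (simp add: Coset.order_def)
      then have "x [^] p = \<one>" by (simp add: nat_pow_consistent[symmetric])
      then have "ord x dvd p" "ord x dvd q" using exp[OF x] KC[OF x] by (simp_all add: pow_eq_id)
      moreover have "coprime p q" using p q \<open>q < p\<close> by (simp add: primes_coprime)
      ultimately have "ord x = 1" by (metis coprime_def nat_dvd_1_iff_1)
      then show "x \<in> {\<one>}" using ord_eq_1[OF KC[OF x]] by simp
    qed
    then have "card K \<le> 1" using card_mono[of "{\<one>}" K] by simp
    then show False using Kp prime_gt_1_nat[OF p] by simp
  qed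
  ultimately show ?thesis using ab(1) ab' by auto
qed

section \<open>Normal subgroups of a product of two groups of this kind\<close>

context
  fixes G1 :: "('a, 'c) monoid_scheme" and G2 :: "('b, 'd) monoid_scheme"
    and p q r :: nat and Q1 Q2
  assumes pq1: "pq_group G1 p q Q1" and pq2: "pq_group G2 r q Q2"
begin

interpretation A: pq_group G1 p q Q1 by (rule pq1)
interpretation B: pq_group G2 r q Q2 by (rule pq2)
interpretation G: group "G1 \<times>\<times> G2" by (intro DirProd_group A.is_group B.is_group)

lemma DirProd_commutator_in_normal:
  assumes "N \<lhd> G1 \<times>\<times> G2" "(n1, n2) \<in> N" "g1 \<in> carrier G1" "g2 \<in> carrier G2"
  shows "(n1 \<otimes>\<^bsub>G1\<^esub> g1 \<otimes>\<^bsub>G1\<^esub> inv\<^bsub>G1\<^esub> n1 \<otimes>\<^bsub>G1\<^esub> inv\<^bsub>G1\<^esub> g1,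
    n2 \<otimes>\<^bsub>G2\<^esub> g2 \<otimes>\<^bsub>G2\<^esub> inv\<^bsub>G2\<^esub> n2 \<otimes>\<^bsub>G2\<^esub> inv\<^bsub>G2\<^esub> g2) \<in> N"
proof -
  let ?G = "G1 \<times>\<times> G2"
  have sub: "subgroup N ?G" using assms(1) by (rule normal_imp_subgroup)
  have nC: "n1 \<in> carrier G1" "n2 \<in> carrier G2" using subgroup.mem_carrier[OF sub assms(2)] by auto
  have "(g1, g2) \<otimes>\<^bsub>?G\<^esub> inv\<^bsub>?G\<^esub> (n1, n2) \<otimes>\<^bsub>?G\<^esub> inv\<^bsub>?G\<^esub> (g1, g2) \<in> N"
    using assms sub by (simp add: G.normal_inv_iff subgroup.m_inv_closed)
  then have "(n1, n2) \<otimes>\<^bsub>?G\<^esub> ((g1, g2) \<otimes>\<^bsub>?G\<^esub> inv\<^bsub>?G\<^esub> (n1, n2) \<otimes>\<^bsub>?G\<^esub> inv\<^bsub>?G\<^esub> (g1, g2)) \<in> N"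
    using subgroup.m_closed[OF sub assms(2)] by blast
  then show ?thesis
    using nC assms A.is_group B.is_group by (simp add: inv_DirProd A.m_assoc B.m_assoc)
qed

lemma DirProd_pow: "(x, y) [^]\<^bsub>G1 \<times>\<times> G2\<^esub> (i::nat) = (x [^]\<^bsub>G1\<^esub> i, y [^]\<^bsub>G2\<^esub> i)"
  by (induction i) auto

lemma subgroup_pow_closed: "subgroup N (G1 \<times>\<times> G2) \<Longrightarrow> n \<in> N \<Longrightarrow> n [^]\<^bsub>G1 \<times>\<times> G2\<^esub> (i::nat) \<in> N"
  by (induction i) (simp_all only: nat_pow_0 nat_pow_Suc subgroup.one_closed subgroup.m_closed)

text \<open>The centre of \<open>G1\<close> is trivial, so some commutator of (n1, n2) with an
  element (g, 1) is nontrivial. It lies in \<open>A.P\<close> in the first coordinate, is trivial in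
  the second, and generates this group of prime order.\<close>

lemma normal_contains_P1:
  assumes N: "N \<lhd> G1 \<times>\<times> G2" and n: "(n1, n2) \<in> N" "n1 \<noteq> \<one>\<^bsub>G1\<^esub>" and x: "x \<in> A.P"
  shows "(x, \<one>\<^bsub>G2\<^esub>) \<in> N"
proof -
  have sub: "subgroup N (G1 \<times>\<times> G2)" using N by (rule normal_imp_subgroup)
  have nC: "n1 \<in> carrier G1" "n2 \<in> carrier G2" using subgroup.mem_carrier[OF sub n(1)] by auto
  obtain g where g: "g \<in> carrier G1" "n1 \<otimes>\<^bsub>G1\<^esub> g \<noteq> g \<otimes>\<^bsub>G1\<^esub> n1"
    using A.center_trivial[OF nC(1)] n(2) by blast
  let ?c = "n1 \<otimes>\<^bsub>G1\<^esub> g \<otimes>\<^bsub>G1\<^esub> inv\<^bsub>G1\<^esub> n1 \<otimes>\<^bsub>G1\<^esub> inv\<^bsub>G1\<^esub> g"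
  have cN: "(?c, \<one>\<^bsub>G2\<^esub>) \<in> N" using DirProd_commutator_in_normal[OF N n(1) g(1), of "\<one>\<^bsub>G2\<^esub>"] nC by simp
  have "?c \<noteq> \<one>\<^bsub>G1\<^esub>"
  proof
    assume "?c = \<one>\<^bsub>G1\<^esub>"
    then have "?c \<otimes>\<^bsub>G1\<^esub> (g \<otimes>\<^bsub>G1\<^esub> n1) = g \<otimes>\<^bsub>G1\<^esub> n1" using g nC by simp
    moreover have "?c \<otimes>\<^bsub>G1\<^esub> (g \<otimes>\<^bsub>G1\<^esub> n1) = n1 \<otimes>\<^bsub>G1\<^esub> g"
    proof -
      have "?c \<otimes>\<^bsub>G1\<^esub> (g \<otimes>\<^bsub>G1\<^esub> n1) = n1 \<otimes>\<^bsub>G1\<^esub> g \<otimes>\<^bsub>G1\<^esub> (inv\<^bsub>G1\<^esub> n1 \<otimes>\<^bsub>G1\<^esub> (inv\<^bsub>G1\<^esub> g \<otimes>\<^bsub>G1\<^esub> g) \<otimes>\<^bsub>G1\<^esub> n1)"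
        using g nC by (simp only: A.m_assoc A.m_closed A.inv_closed)
      then show ?thesis using g nC by simp
    qed
    ultimately show False using g by simp
  qed
  then obtain i :: nat where "x = ?c [^]\<^bsub>G1\<^esub> i"
    using A.prime_subgroup_powers[OF A.P_sub A.card_P A.p A.commutator_in_P[OF nC(1) g(1)] _ x] by blast
  then have "(x, \<one>\<^bsub>G2\<^esub>) = (?c, \<one>\<^bsub>G2\<^esub>) [^]\<^bsub>G1 \<times>\<times> G2\<^esub> i" by (simp add: DirProd_pow)
  then show ?thesis using subgroup_pow_closed[OF sub cN] by simp
qed

lemma centralizer_fst:
  assumes N: "N \<lhd> G1 \<times>\<times> G2" and n: "(n1, n2) \<in> N" "n1 \<noteq> \<one>\<^bsub>G1\<^esub>"
    and t: "(t1, t2) \<in> Q1 \<times> Q2" "\<And>n. n \<in> N \<Longrightarrow> (t1, t2) \<otimes>\<^bsub>G1 \<times>\<times> G2\<^esub> n = n \<otimes>\<^bsub>G1 \<times>\<times> G2\<^esub> (t1, t2)"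
  shows "t1 = \<one>\<^bsub>G1\<^esub>"
proof (rule A.centralizing_P_trivial)
  fix x assume "x \<in> A.P"
  then show "t1 \<otimes>\<^bsub>G1\<^esub> x = x \<otimes>\<^bsub>G1\<^esub> t1" using t(2)[OF normal_contains_P1[OF N n]] by simp
qed (use t in simp)

end

text \<open>Exchanging the factors lets the statements about the first coordinate serve for the
  second.\<close>

lemma normal_swap:
  assumes "group G1" "group G2" "N \<lhd> G1 \<times>\<times> G2"
  shows "prod.swap ` N \<lhd> G2 \<times>\<times> G1"
proof -
  have iso: "prod.swap \<in> iso (G1 \<times>\<times> G2) (G2 \<times>\<times> G1)"
    by (auto simp: iso_def hom_def bij_betw_def inj_on_def image_iff)
  show ?thesis
    using iso_normal_subgroup[OF iso DirProd_group DirProd_group] assms by blast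
qed

theorem theorem4p4:
  fixes p q r :: nat
    and G1 :: "'a monoid" and G2 :: "'b monoid"
    and H :: "('a \<times> 'b) set"
    and \<omega> :: "(('a \<times> 'b) \<Rightarrow> 'k::field_char_0) \<Rightarrow> (('a \<times> 'b) \<Rightarrow> 'k) \<Rightarrow> 'k"
  assumes "alg_closed TYPE('k)"
    and "prime p" "prime q" "prime r"
    and "q dvd p - 1" "q dvd r - 1"
    and "group G1" "Coset.order G1 = p * q" "\<not> comm_group G1"
    and "group G2" "Coset.order G2 = r * q" "\<not> comm_group G2"
    and "subgroup H (G1 \<times>\<times> G2)"
    and "(G1 \<times>\<times> G2)\<lparr>carrier := H\<rparr> \<cong> integer_mod_group q \<times>\<times> integer_mod_group q"
    and "two_cocycle (G1 \<times>\<times> G2) H \<omega>"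
    and "\<not> coboundary (G1 \<times>\<times> G2) H \<omega>"
  shows "simple_twisted_group_hopf (G1 \<times>\<times> G2) (twist_of (G1 \<times>\<times> G2) H \<omega>)"
proof -
  let ?G = "G1 \<times>\<times> G2"
  have card1: "card (carrier G1) = p * q" and card2: "card (carrier G2) = r * q"
    using assms(8,11) by (simp_all add: Coset.order_def)
  have qp: "q < p" and qr: "q < r"
    using dvd_imp_le[OF assms(5)] dvd_imp_le[OF assms(6)] prime_gt_1_nat[OF assms(2)] prime_gt_1_nat[OF assms(4)]
    by auto
  have q1: "q > 1" using assms(3) by (rule prime_gt_1_nat)
  interpret G1: group G1 by fact
  interpret G2: group G2 by fact
  interpret G: group ?G by (intro DirProd_group assms)
  obtain f where f: "f \<in> iso (?G\<lparr>carrier := H\<rparr>) (integer_mod_group q \<times>\<times> integer_mod_group q)"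
    using assms(14) by (auto simp: is_iso_def)
  interpret E: elementary_abelian_sub ?G H q f
    by (intro elementary_abelian_sub.intro elementary_abelian_sub_axioms.intro G.is_group assms f)
  have pow: "(x, y) [^]\<^bsub>?G\<^esub> (i::nat) = (x [^]\<^bsub>G1\<^esub> i, y [^]\<^bsub>G2\<^esub> i)" for x y i
    by (induction i) auto
  define Q1 where "Q1 = fst ` H"
  define Q2 where "Q2 = snd ` H"
  have sub1: "subgroup Q1 G1"
  proof -
    interpret group_hom ?G G1 fst by unfold_locales (auto simp: hom_def)
    show ?thesis unfolding Q1_def using assms(13) by (rule subgroup_img_is_subgroup)
  qed
  have sub2: "subgroup Q2 G2"
  proof -
    interpret group_hom ?G G2 snd by unfold_locales (auto simp: hom_def)
    show ?thesis unfolding Q2_def using assms(13) by (rule subgroup_img_is_subgroup)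
  qed
  have HQ: "H \<subseteq> Q1 \<times> Q2" by (force simp: Q1_def Q2_def)
  have c1: "card Q1 = 1 \<or> card Q1 = q"
  proof (rule abelian_exponent_subgroup_card[OF assms(7,2,3) qp card1 assms(9) sub1])
    fix x y assume "x \<in> Q1" "y \<in> Q1"
    then obtain x' y' where "(x, x') \<in> H" "(y, y') \<in> H" by (auto simp: Q1_def)
    then show "x \<otimes>\<^bsub>G1\<^esub> y = y \<otimes>\<^bsub>G1\<^esub> x" using E.commute[of "(x, x')" "(y, y')"] by simp
  next
    fix x assume "x \<in> Q1"
    then obtain x' where "(x, x') \<in> H" by (auto simp: Q1_def)
    then show "x [^]\<^bsub>G1\<^esub> q = \<one>\<^bsub>G1\<^esub>" using E.exponent[of "(x, x')"] by (simp add: pow)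
  qed
  have c2: "card Q2 = 1 \<or> card Q2 = q"
  proof (rule abelian_exponent_subgroup_card[OF assms(10,4,3) qr card2 assms(12) sub2])
    fix x y assume "x \<in> Q2" "y \<in> Q2"
    then obtain x' y' where "(x', x) \<in> H" "(y', y) \<in> H" by (auto simp: Q2_def)
    then show "x \<otimes>\<^bsub>G2\<^esub> y = y \<otimes>\<^bsub>G2\<^esub> x" using E.commute[of "(x', x)" "(y', y)"] by simp
  next
    fix x assume "x \<in> Q2"
    then obtain x' where "(x', x) \<in> H" by (auto simp: Q2_def)
    then show "x [^]\<^bsub>G2\<^esub> q = \<one>\<^bsub>G2\<^esub>" using E.exponent[of "(x', x)"] by (simp add: pow)
  qed
  have finQ: "finite Q1" "finite Q2" using E.finite_H by (simp_all add: Q1_def Q2_def)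
  \<comment> \<open>\<open>H\<close> has q * q elements inside \<open>Q1 \<times> Q2\<close>, whose
    factors have at most \<open>q\<close> elements each, so it is the whole product.\<close>
  have "q * q \<le> card Q1 * card Q2"
    using card_mono[OF _ HQ] finQ E.card_H by (simp add: card_cartesian_product)
  moreover have "\<not> q * q \<le> q" "\<not> q * q \<le> 1" using q1 less_1_mult[of q q] by auto
  ultimately have cardQ: "card Q1 = q" "card Q2 = q" using c1 c2 by (metis mult_1 mult_1_right)+
  have H: "H = Q1 \<times> Q2"
    using HQ finQ cardQ E.card_H by (intro card_subset_eq) (auto simp: card_cartesian_product)
  have pq1: "pq_group G1 p q Q1" and pq2: "pq_group G2 r q Q2"
    using assms card1 card2 sub1 sub2 cardQ by (auto intro!: pq_group.intro pq_group_axioms.intro)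
  interpret A: pq_group G1 p q Q1 by (rule pq1)
  interpret B: pq_group G2 r q Q2 by (rule pq2)
  interpret twist ?G H "characters ?G H :: ('a \<times> 'b \<Rightarrow> 'k) set" \<omega>
  proof (intro twist.intro twist_axioms.intro dual_subgroup.intro dual_subgroup_axioms.intro
      fin_group.intro fin_group_axioms.intro G.is_group refl assms(13,15))
    show "finite (carrier ?G)" using A.fin B.fin by simp
  qed (fact E.commute E.sum_all_characters[OF assms(1)])+
  \<comment> \<open>A retraction onto \<open>H\<close> whose kernel is the product of the two normal
    Sylow subgroups.\<close>
  define \<phi> where "\<phi> x = (A.\<phi> (fst x), B.\<phi> (snd x))" for x
  show ?thesis
    unfolding simple_twisted_group_hopf_def
  proof (intro allI impI)
    fix B assume B: "normal_hopf_subalgebra ?G (twist_of ?G H \<omega>) B"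
    have retr: "\<And>x. x \<in> carrier ?G \<Longrightarrow> \<phi> x \<in> H" "\<And>h. h \<in> H \<Longrightarrow> \<phi> h = h"
      "\<And>x y. x \<in> carrier ?G \<Longrightarrow> y \<in> carrier ?G \<Longrightarrow> \<phi> (x \<otimes>\<^bsub>?G\<^esub> y) = \<phi> x \<otimes>\<^bsub>?G\<^esub> \<phi> y"
      by (auto simp: \<phi>_def H A.\<phi>_in B.\<phi>_in A.\<phi>_Q B.\<phi>_Q A.\<phi>_mult B.\<phi>_mult)
    obtain N where N: "N \<lhd> ?G" and triv_N: "N = {\<one>\<^bsub>?G\<^esub>} \<Longrightarrow> B = {(\<lambda>x. a * gunit ?G x) |a. True}"
      and full_N: "N = carrier ?G \<Longrightarrow> B = galg ?G"
      and cent: "\<And>\<chi>. \<chi> \<in> characters ?G H \<Longrightarrow> \<chi> \<noteq> triv \<Longrightarrow> (\<And>n. n \<in> N \<Longrightarrow> \<chi> (\<phi> n) = 1) \<Longrightarrow>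
        \<exists>t\<in>H. t \<noteq> \<one>\<^bsub>?G\<^esub> \<and> \<chi> t = 1 \<and> (\<forall>n\<in>N. t \<otimes>\<^bsub>?G\<^esub> n = n \<otimes>\<^bsub>?G\<^esub> t)"
      by (rule normal_hopf_subalgebra_normal_subgroup[OF assms(1,3) E.card_H E.exponent assms(16) retr B])
        (assumption | (rule that; blast))+
    have subN: "subgroup N ?G" using N by (rule normal_imp_subgroup)
    have N': "prod.swap ` N \<lhd> G2 \<times>\<times> G1" using assms(7,10) N by (rule normal_swap)
    have fst_t: "fst t = \<one>\<^bsub>G1\<^esub>"
      if "n \<in> N" "fst n \<noteq> \<one>\<^bsub>G1\<^esub>" "t \<in> H" "\<And>n. n \<in> N \<Longrightarrow> t \<otimes>\<^bsub>?G\<^esub> n = n \<otimes>\<^bsub>?G\<^esub> t" for n t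
      using centralizer_fst[OF pq1 pq2 N, of "fst n" "snd n" "fst t" "snd t"] that by (simp add: H)
    have snd_t: "snd t = \<one>\<^bsub>G2\<^esub>"
      if n: "n \<in> N" "snd n \<noteq> \<one>\<^bsub>G2\<^esub>" and t: "t \<in> H" "\<And>n. n \<in> N \<Longrightarrow> t \<otimes>\<^bsub>?G\<^esub> n = n \<otimes>\<^bsub>?G\<^esub> t" for n t
    proof (rule centralizer_fst[OF pq2 pq1 N', of "snd n" "fst n" "snd t" "fst t"])
      show "(snd n, fst n) \<in> prod.swap ` N" using n by force
      show "(snd t, fst t) \<in> Q2 \<times> Q1" using t by (auto simp: H)
      fix m assume "m \<in> prod.swap ` N"
      then obtain x y where "(x, y) \<in> N" "m = (y, x)" by auto
      then show "(snd t, fst t) \<otimes>\<^bsub>G2 \<times>\<times> G1\<^esub> m = m \<otimes>\<^bsub>G2 \<times>\<times> G1\<^esub> (snd t, fst t)"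
        using t(2)[of "(x, y)"] by (cases t) simp
    qed (use n in simp)
    have P1: "(x, \<one>\<^bsub>G2\<^esub>) \<in> N" if "n \<in> N" "fst n \<noteq> \<one>\<^bsub>G1\<^esub>" "x \<in> A.P" for n x
      using normal_contains_P1[OF pq1 pq2 N, of "fst n" "snd n" x] that by simp
    have P2: "(\<one>\<^bsub>G1\<^esub>, y) \<in> N" if "n \<in> N" "snd n \<noteq> \<one>\<^bsub>G2\<^esub>" "y \<in> B.P" for n y
      using normal_contains_P1[OF pq2 pq1 N', of "snd n" "fst n" y] that by force
    have "N = {\<one>\<^bsub>?G\<^esub>} \<or> N = carrier ?G"
    proof (rule ccontr)
      assume "\<not> ?thesis"
      then have N1: "N \<noteq> {\<one>\<^bsub>?G\<^esub>}" and NC: "N \<noteq> carrier ?G" by auto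
      have N_mem: "fst n \<in> carrier G1" "snd n \<in> carrier G2" if "n \<in> N" for n
        using subgroup.mem_carrier[OF subN that] by auto
      obtain n0 where n0: "n0 \<in> N" "n0 \<noteq> \<one>\<^bsub>?G\<^esub>" using N1 subgroup.one_closed[OF subN] by blast
      have n0': "fst n0 \<noteq> \<one>\<^bsub>G1\<^esub> \<or> snd n0 \<noteq> \<one>\<^bsub>G2\<^esub>" using n0(2) by (cases n0) auto
      have subH1: "subgroup (Q1 \<times> {\<one>\<^bsub>G2\<^esub>}) ?G" and subH2: "subgroup ({\<one>\<^bsub>G1\<^esub>} \<times> Q2) ?G"
        using DirProd_subgroups[OF assms(7) sub1 assms(10) G2.triv_subgroup]
          DirProd_subgroups[OF assms(7) G1.triv_subgroup assms(10) sub2] by auto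
      \<comment> \<open>The elements that are nontrivial in the first and in the second coordinate
        may differ: each of them alone already puts the Sylow subgroup of its factor into
        \<open>N\<close>.\<close>
      consider (both) n m where "n \<in> N" "fst n \<noteq> \<one>\<^bsub>G1\<^esub>" "m \<in> N" "snd m \<noteq> \<one>\<^bsub>G2\<^esub>"
        | (first) n where "n \<in> N" "fst n \<noteq> \<one>\<^bsub>G1\<^esub>" "\<And>m. m \<in> N \<Longrightarrow> snd m = \<one>\<^bsub>G2\<^esub>"
        | (second) n where "n \<in> N" "snd n \<noteq> \<one>\<^bsub>G2\<^esub>" "\<And>m. m \<in> N \<Longrightarrow> fst m = \<one>\<^bsub>G1\<^esub>"
        using n0' n0(1) by metis
      then show False
      proof cases
        case both
        have hom: "\<phi> \<in> hom ?G ?G"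
          by (auto simp: hom_def \<phi>_def A.\<phi>_in B.\<phi>_in A.\<phi>_mult B.\<phi>_mult)
        then interpret group_hom ?G ?G \<phi> by unfold_locales
        have K: "subgroup (\<phi> ` N) ?G" using subN by (rule subgroup_img_is_subgroup)
        have KH: "\<phi> ` N \<subseteq> H" using N_mem by (auto simp: \<phi>_def H intro!: A.\<phi>_in B.\<phi>_in)
        \<comment> \<open>\<open>N\<close> contains both normal Sylow subgroups, hence the kernel of
          \<phi>, so mapping onto \<open>H\<close> would make it the whole group.\<close>
        have "\<phi> ` N \<noteq> H"
        proof
          assume KH: "\<phi> ` N = H"
          have "carrier ?G \<subseteq> N"
          proof
            fix g assume g: "g \<in> carrier ?G"
            then have "\<phi> g \<in> H" by (auto simp: \<phi>_def H A.\<phi>_in B.\<phi>_in)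
            then obtain n where n: "n \<in> N" "\<phi> g = \<phi> n" using KH by (metis imageE)
            have nC: "n \<in> carrier ?G" using subgroup.mem_carrier[OF subN n(1)] .
            have "\<phi> (g \<otimes>\<^bsub>?G\<^esub> inv\<^bsub>?G\<^esub> n) = \<one>\<^bsub>?G\<^esub>"
              by (simp only: hom_mult[OF g G.inv_closed[OF nC]] hom_inv[OF nC] n(2) G.r_inv[OF hom_closed[OF nC]])
            moreover obtain x y where xy: "g \<otimes>\<^bsub>?G\<^esub> inv\<^bsub>?G\<^esub> n = (x, y)" by fastforce
            moreover have "(x, y) \<in> carrier ?G" using xy g nC by (metis G.inv_closed G.m_closed)
            ultimately have "x \<in> A.P" "y \<in> B.P"
              by (auto simp: \<phi>_def A.\<phi>_one_iff B.\<phi>_one_iff)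
            then have "(x, \<one>\<^bsub>G2\<^esub>) \<otimes>\<^bsub>?G\<^esub> (\<one>\<^bsub>G1\<^esub>, y) \<in> N"
              using P1[OF both(1,2)] P2[OF both(3,4)] subgroup.m_closed[OF subN] by blast
            then have "g \<otimes>\<^bsub>?G\<^esub> inv\<^bsub>?G\<^esub> n \<in> N"
              using xy \<open>x \<in> A.P\<close> \<open>y \<in> B.P\<close> by simp
            then have "g \<otimes>\<^bsub>?G\<^esub> inv\<^bsub>?G\<^esub> n \<otimes>\<^bsub>?G\<^esub> n \<in> N" using n subgroup.m_closed[OF subN] by blast
            then show "g \<in> N"
              by (simp only: G.m_assoc[OF g G.inv_closed[OF nC] nC] G.l_inv[OF nC] G.r_one[OF g])
          qed
          then show False using NC subgroup.subset[OF subN] by blast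
        qed
        then obtain \<chi> where \<chi>: "\<chi> \<in> characters ?G H" "\<chi> \<noteq> triv" "\<And>k. k \<in> \<phi> ` N \<Longrightarrow> \<chi> k = 1"
          using ex_char_trivial_on[OF KH _ K] by blast
        then obtain t where "t \<in> H" "t \<noteq> \<one>\<^bsub>?G\<^esub>" "\<And>n. n \<in> N \<Longrightarrow> t \<otimes>\<^bsub>?G\<^esub> n = n \<otimes>\<^bsub>?G\<^esub> t"
          using cent[OF \<chi>(1,2)] by blast
        then show False using fst_t[OF both(1,2)] snd_t[OF both(3,4)] by (cases t) force
      next
        case first
        have KH: "Q1 \<times> {\<one>\<^bsub>G2\<^esub>} \<subseteq> H" by (auto simp: H)
        have "card (Q1 \<times> {\<one>\<^bsub>G2\<^esub>}) \<noteq> card H" using q1 cardQ E.card_H by (simp add: card_cartesian_product)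
        then obtain \<chi> where \<chi>: "\<chi> \<in> characters ?G H" "\<chi> \<noteq> triv" "\<And>k. k \<in> Q1 \<times> {\<one>\<^bsub>G2\<^esub>} \<Longrightarrow> \<chi> k = 1"
          using ex_char_trivial_on[OF KH _ subH1] by blast
        have "\<chi> (\<phi> n) = 1" if "n \<in> N" for n
          using \<chi>(3)[of "\<phi> n"] first(3)[OF that] N_mem[OF that] by (simp add: \<phi>_def A.\<phi>_in B.\<phi>_Q)
        then obtain t where t: "t \<in> H" "t \<noteq> \<one>\<^bsub>?G\<^esub>" "\<chi> t = 1" "\<And>n. n \<in> N \<Longrightarrow> t \<otimes>\<^bsub>?G\<^esub> n = n \<otimes>\<^bsub>?G\<^esub> t"
          using cent[OF \<chi>(1,2)] by blast
        \<comment> \<open>Only the second coordinate of \<open>t\<close> is left. It generates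
          \<open>Q2\<close>, so \<chi>(t) = 1 makes \<chi> trivial on \<open>Q2\<close> as well as
          on \<open>Q1\<close>, against its choice.\<close>
        have "fst t = \<one>\<^bsub>G1\<^esub>" using first(1,2) t(1,4) by (rule fst_t)
        then obtain t2 where t2: "t = (\<one>\<^bsub>G1\<^esub>, t2)" "t2 \<in> Q2" "t2 \<noteq> \<one>\<^bsub>G2\<^esub>"
          using t(1,2) by (cases t) (auto simp: H)
        have "\<chi> = triv"
        proof (rule char_eq_triv[OF \<chi>(1) _ t(1,3)])
          fix h assume "h \<in> H"
          then obtain h1 h2 where h12: "h = (h1, h2)" "h1 \<in> Q1" "h2 \<in> Q2" by (auto simp: H)
          obtain i :: nat where i: "h2 = t2 [^]\<^bsub>G2\<^esub> i"
            using G2.prime_subgroup_powers[OF B.Q B.q t2(2,3) h12(3)] by blast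
          have "h = (h1, \<one>\<^bsub>G2\<^esub>) \<otimes>\<^bsub>?G\<^esub> t [^]\<^bsub>?G\<^esub> i" using h12 t2 i by (simp add: pow)
          then show "\<exists>k\<in>Q1 \<times> {\<one>\<^bsub>G2\<^esub>}. \<exists>i::nat. h = k \<otimes>\<^bsub>?G\<^esub> t [^]\<^bsub>?G\<^esub> i" using h12 by blast
        qed (use \<chi>(3) KH in blast)
        then show False using \<chi>(2) by simp
      next
        case second
        have KH: "{\<one>\<^bsub>G1\<^esub>} \<times> Q2 \<subseteq> H" by (auto simp: H)
        have "card ({\<one>\<^bsub>G1\<^esub>} \<times> Q2) \<noteq> card H" using q1 cardQ E.card_H by (simp add: card_cartesian_product)
        then obtain \<chi> where \<chi>: "\<chi> \<in> characters ?G H" "\<chi> \<noteq> triv" "\<And>k. k \<in> {\<one>\<^bsub>G1\<^esub>} \<times> Q2 \<Longrightarrow> \<chi> k = 1"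
          using ex_char_trivial_on[OF KH _ subH2] by blast
        have "\<chi> (\<phi> n) = 1" if "n \<in> N" for n
          using \<chi>(3)[of "\<phi> n"] second(3)[OF that] N_mem[OF that] by (simp add: \<phi>_def B.\<phi>_in A.\<phi>_Q)
        then obtain t where t: "t \<in> H" "t \<noteq> \<one>\<^bsub>?G\<^esub>" "\<chi> t = 1" "\<And>n. n \<in> N \<Longrightarrow> t \<otimes>\<^bsub>?G\<^esub> n = n \<otimes>\<^bsub>?G\<^esub> t"
          using cent[OF \<chi>(1,2)] by blast
        have "snd t = \<one>\<^bsub>G2\<^esub>" using second(1,2) t(1,4) by (rule snd_t)
        then obtain t1 where t1: "t = (t1, \<one>\<^bsub>G2\<^esub>)" "t1 \<in> Q1" "t1 \<noteq> \<one>\<^bsub>G1\<^esub>"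
          using t(1,2) by (cases t) (auto simp: H)
        have "\<chi> = triv"
        proof (rule char_eq_triv[OF \<chi>(1) _ t(1,3)])
          fix h assume "h \<in> H"
          then obtain h1 h2 where h12: "h = (h1, h2)" "h1 \<in> Q1" "h2 \<in> Q2" by (auto simp: H)
          obtain i :: nat where i: "h1 = t1 [^]\<^bsub>G1\<^esub> i"
            using G1.prime_subgroup_powers[OF A.Q A.q t1(2,3) h12(2)] by blast
          have "h = (\<one>\<^bsub>G1\<^esub>, h2) \<otimes>\<^bsub>?G\<^esub> t [^]\<^bsub>?G\<^esub> i" using h12 t1 i by (simp add: pow)
          then show "\<exists>k\<in>{\<one>\<^bsub>G1\<^esub>} \<times> Q2. \<exists>i::nat. h = k \<otimes>\<^bsub>?G\<^esub> t [^]\<^bsub>?G\<^esub> i" using h12 by blast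
        qed (use \<chi>(3) KH in blast)
        then show False using \<chi>(2) by simp
      qed
    qed
    then show "B = {(\<lambda>x. c * gunit ?G x) |c. True} \<or> B = galg ?G"
      using triv_N full_N by blast
  qed
qed

end
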